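(* Let $G$ be a finite graph embedded in the closed orientable surface $T^2=T\# T$ of genus $2$ (the double torus), presented via the highway surface, and let $C$ be a separating curve on $T^2$ as described in the context. Let $G_1^S, G_2^S$ be the graphs obtained from the two parts $G_1,G_2$ of $G$ by attaching the target $S$, with variable vectors $y_1,y_2$. Let $q$ be a quadratic form on $(H_1(T^2,\mathbb{F}_2),\cdot)$, and let $q_1,q_2$ be the two quadratic forms on the first $\mathbb{F}_2$-homology of the torus determined by $q$. Then $$\mathcal{E}(G,q,x)=\big\langle \mathcal{E}(G_1^S,q_1,y_1),\ \mathcal{E}(G_2^S,q_2,y_2)\big\rangle .$$
   Context: Graphs are finite and unoriented; loops and multiple edges are allowed. Each edge $e$ of $G$ carries an indeterminate $x_e$. A set $E'\subset E(G)$ is even if every vertex has even degree (possibly $0$) in $(V(G),E')$; $\mathcal{E}(G)$ (with one argument) is the set of even subsets. Quadratic forms and signed generating functions. For a closed orientable surface $X$ let $H=H_1(X,\mathbb{F}_2)$ with mod $2$ intersection form "$\cdot$". A quadratic form on $(H,\cdot)$ is a function $q:H\to\mathbb{F}_2$ with $q(x+y)=q(x)+q(y)+x\cdot y$. For a graph $G$ embedded in $X$, $\mathcal{E}(G,q,x)=\sum_{E'\in\mathcal{E}(G)}(-1)^{q([E'])}\prod_{e\in E'}x_e$, where $[E']\in H$ is the class of $E'$. Highway surface. The highway surface of genus $g$ consists of a convex $4g$-gon $R_0$ with vertices $a_1,\dots,a_{4g}$ numbered clockwise, and rectangles (bridges) $R_1,\dots,R_{2g}$ glued to $R_0$. For $i=1,\dots,g$,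 $R_{2i-1}$ has vertices $x(i,1),\dots,x(i,4)$ numbered clockwise, with $[x(i,1),x(i,2)]$ glued to $[a_{4(i-1)+1},a_{4(i-1)+2}]$ and $[x(i,3),x(i,4)]$ glued to $[a_{4(i-1)+3},a_{4(i-1)+4}]$. The rectangle $R_{2i}$ has vertices $y(i,1),\dots,y(i,4)$ numbered clockwise, with $[y(i,1),y(i,2)]$ glued to $[a_{4(i-1)+2},a_{4(i-1)+3}]$ and $[y(i,3),y(i,4)]$ glued to $[a_{4(i-1)+4},a_{4(i-1)+5}]$ (indices mod $4g$). Gluing a disk to the boundary of the highway surface gives the closed orientable surface of genus $g$. A graph embedded in the closed surface is assumed to lie in the highway surface, with all vertices in the interior of $R_0$ and meeting each bridge in disjoint straight segments joining the two glued sides. Homology basis: $a_i$ (resp. $b_i$) is the class of a closed curve that crosses bridge $R_{2i-1}$ (resp. $R_{2i}$) once and no other bridge; $a_1,b_1,\dots,a_g,b_g$ is a basis of $H$, and a quadratic form is determined by its values on this basis. The curve $C$. $C$ is a simple closed curve on $T^2$ such that: (1) $T^2\setminus C$ has two components, each a torus with a disc bounded by $C$ cut out; (2) $C$ meets $G$ in an even number $k$ of vertices $v^1,\dots,v^k$ (ordered along $C$) and in no interior point of an edge; (3) $G$ has an even number of vertices in each component of $T^2\setminus C$. In the highway surface of genus $2$, the part of $C$ containing $v^1,\dots,v^k$ is a chord of $R_0$ separating the pair of bridges $R_1,R_2$ from the pair $R_3,R_4$. $G_1$ and $G_2$ are the subgraphs of $G$ supported on the two components (the first containing $R_1,R_2$,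 the second $R_3,R_4$), together with the vertices $v^1,\dots,v^k$. The forms $q_1,q_2$. With $a_1,b_1$ denoting the corresponding basis of the homology of the torus, $q_1,q_2$ are the quadratic forms on the torus with $q_1(a_1)=q(a_1)$, $q_1(b_1)=q(b_1)$, and $q_2(a_1)=q(a_2)$, $q_2(b_1)=q(b_2)$. Target. For $i=1,\dots,k$ let $L(i)$ be a path of length $2$ with vertices $v_1^i,v_2^i,v_3^i$ and edges $\{v_3^i,v_2^i\},\{v_2^i,v_1^i\}$. The target $S$ is the union of the $L(i)$ with all $v_3^i$ identified to a single vertex. $G_j^S$ ($j=1,2$) is obtained from $G_j$ and $S$ by identifying $v^i$ with $v_1^i$ for all $i$. It is embedded in the torus obtained from the $j$-th component of $T^2\setminus C$ by closing it with a disc along $C$, with $S$ drawn without crossings in that disc. Gluing variables and pairing. Let $e_1^1<e_2^1<\dots<e_1^k<e_2^k$ generate the exterior algebra $\Lambda(e_1^1,e_2^1,\dots,e_1^k,e_2^k)$, with basis $B$ of increasing monomials $e_{\epsilon_1}^{i_1}\cdots e_{\epsilon_\ell}^{i_\ell}$. The dual exterior algebra $\Lambda(e_2^{k*},e_1^{k*},\dots,e_2^{1*},e_1^{1*})$ has basis $B^*$ of the reversed monomials $e_{\epsilon_\ell}^{i_\ell *}\cdots e_{\epsilon_1}^{i_1*}$. The pairing $\langle\ ,\ \rangle$ is bilinear over the polynomial ring $\mathbb{Z}[(x_e)_{e\in E(G)}]$, with $\langle e_{\epsilon_1}^{i_1}\cdots e_{\epsilon_\ell}^{i_\ell},\, e_{\alpha_m}^{j_m*}\cdots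 e_{\alpha_1}^{j_1*}\rangle=1$ if $m=\ell$ and $\epsilon_p=\alpha_p$, $i_p=j_p$ for all $p$, and $0$ otherwise. In $y_1$ the edges of $G_1$ carry the $x_e$, the edge $\{v_3^i,v_2^i\}$ carries $e_1^i$ and $\{v_2^i,v_1^i\}$ carries $e_2^i$. In $y_2$ the edges of $G_2$ carry the $x_e$, the edge $\{v_3^i,v_2^i\}$ carries $e_2^{i*}$ and $\{v_2^i,v_1^i\}$ carries $e_1^{i*}$. In the generating functions, the product of the gluing variables of an edge set is the corresponding basis monomial in $B$ (resp. $B^*$). *)

theory Defs
  imports "HOL-Homology.Homology" "HOL-Library.Multiset" "HOL-Library.Poly_Mapping" "HOL-Library.Z2"
begin

subsection \<open>Multigraphs and even sets\<close>

record ('v, 'e) mgraph =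
  verts :: "'v set"
  edges :: "'e set"
  ends :: "'e \<Rightarrow> 'v multiset"

text \<open>The two-element multiset of ends makes an edge unoriented; a loop at \<open>v\<close> has ends
  \<open>{#v, v#}\<close> and contributes \<open>2\<close> to the degree of \<open>v\<close>.\<close>

definition finite_mgraph :: "('v, 'e) mgraph \<Rightarrow> bool" where
  "finite_mgraph G \<longleftrightarrow> finite (verts G) \<and> finite (edges G) \<and>
     (\<forall>e\<in>edges G. size (ends G e) = 2 \<and> set_mset (ends G e) \<subseteq> verts G)"

definition degree_in :: "('v, 'e) mgraph \<Rightarrow> 'e set \<Rightarrow> 'v \<Rightarrow> nat" where
  "degree_in G E' v = (\<Sum>e\<in>E'. count (ends G e) v)"

definition even_sets :: "('v, 'e) mgraph \<Rightarrow> 'e set set" where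
  "even_sets G = {E'. E' \<subseteq> edges G \<and> (\<forall>v\<in>verts G. even (degree_in G E' v))}"


subsection \<open>Singular homology with coefficients in the field with two elements\<close>

text \<open>The complex of mod 2 singular chains is the integral complex modulo \<open>2\<close>. A cycle is represented
  by an integral chain whose boundary is divisible by \<open>2\<close>; it is trivial if it is an integral boundary
  up to a multiple of \<open>2\<close>.\<close>

definition mod2_cycles :: "nat \<Rightarrow> 'a topology \<Rightarrow> 'a chain set" where
  "mod2_cycles p X = {c. singular_chain p X c \<and>
     (\<exists>d. singular_chain (p - 1) X d \<and> chain_boundary p c = frag_cmul 2 d)}"

definition mod2_boundaries :: "nat \<Rightarrow> 'a topology \<Rightarrow> 'a chain set" where
  "mod2_boundaries p X = {chain_boundary (Suc p) d + frag_cmul 2 c | d c.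
     singular_chain (Suc p) X d \<and> singular_chain p X c}"

definition mod2_homology :: "nat \<Rightarrow> 'a topology \<Rightarrow> 'a chain set monoid" where
  "mod2_homology p X =
     subgroup_generated (chain_group p X) (mod2_cycles p X) Mod mod2_boundaries p X"

definition path_simplex :: "(real \<Rightarrow> 'a) \<Rightarrow> (nat \<Rightarrow> real) \<Rightarrow> 'a" where
  "path_simplex \<gamma> = restrict (\<lambda>x. \<gamma> (x 1)) (standard_simplex 1)"

definition mod2_class :: "'a topology \<Rightarrow> 'a chain \<Rightarrow> 'a chain set" where
  "mod2_class X c = mod2_boundaries 1 X #>\<^bsub>chain_group 1 X\<^esub> c"

abbreviation curve_class :: "'a topology \<Rightarrow> (real \<Rightarrow> 'a) \<Rightarrow> 'a chain set" where
  "curve_class X \<gamma> \<equiv> mod2_class X (frag_of (path_simplex \<gamma>))"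

definition edge_set_class :: "'a topology \<Rightarrow> ('e \<Rightarrow> real \<Rightarrow> 'a) \<Rightarrow> 'e set \<Rightarrow> 'a chain set" where
  "edge_set_class X \<gamma> E' = mod2_class X (\<Sum>e\<in>E'. frag_of (path_simplex (\<gamma> e)))"


subsection \<open>The mod 2 intersection form and quadratic forms\<close>

definition simple_closed_curve :: "'a topology \<Rightarrow> (real \<Rightarrow> 'a) \<Rightarrow> bool" where
  "simple_closed_curve X c \<longleftrightarrow> pathin X c \<and> c 0 = c 1 \<and> inj_on c {0..<1}"

text \<open>\<open>A\<close> and \<open>B\<close> cross transversally at \<open>p\<close> if some chart around \<open>p\<close> carries them to the two
  coordinate axes of the plane.\<close>

definition transversal_at :: "'a topology \<Rightarrow> 'a set \<Rightarrow> 'a set \<Rightarrow> 'a \<Rightarrow> bool" where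
  "transversal_at X A B p \<longleftrightarrow>
     (\<exists>U (V :: complex set) h. openin X U \<and> p \<in> U \<and> open V \<and>
        homeomorphic_map (subtopology X U) (top_of_set V) h \<and> h p = 0 \<and>
        h ` (U \<inter> A) = V \<inter> {z. Im z = 0} \<and> h ` (U \<inter> B) = V \<inter> {z. Re z = 0})"

text \<open>The intersection form is the bilinear form that counts, modulo \<open>2\<close>, the intersection points of
  transversal simple closed curves.\<close>

definition intersection_form :: "'a topology \<Rightarrow> ('a chain set \<Rightarrow> 'a chain set \<Rightarrow> bit) \<Rightarrow> bool" where
  "intersection_form X dot \<longleftrightarrow>
     (let H = mod2_homology 1 X in
       (\<forall>x\<in>carrier H. \<forall>y\<in>carrier H. \<forall>z\<in>carrier H.
          dot (x \<otimes>\<^bsub>H\<^esub> y) z = dot x z + dot y z \<and> dot z (x \<otimes>\<^bsub>H\<^esub> y) = dot z x + dot z y)) \<and>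
     (\<forall>c d. simple_closed_curve X c \<longrightarrow> simple_closed_curve X d \<longrightarrow>
        finite (c ` {0..1} \<inter> d ` {0..1}) \<longrightarrow>
        (\<forall>p \<in> c ` {0..1} \<inter> d ` {0..1}. transversal_at X (c ` {0..1}) (d ` {0..1}) p) \<longrightarrow>
        dot (curve_class X c) (curve_class X d) = of_nat (card (c ` {0..1} \<inter> d ` {0..1})))"

text \<open>Quadratic forms on \<open>(H, dot)\<close>; only their values on the carrier of \<open>H\<close> matter.\<close>

definition quadratic_form ::
    "'a topology \<Rightarrow> ('a chain set \<Rightarrow> 'a chain set \<Rightarrow> bit) \<Rightarrow> ('a chain set \<Rightarrow> bit) \<Rightarrow> bool" where
  "quadratic_form X dot q \<longleftrightarrow>
     (let H = mod2_homology 1 X in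
       \<forall>x\<in>carrier H. \<forall>y\<in>carrier H. q (x \<otimes>\<^bsub>H\<^esub> y) = q x + q y + dot x y)"

text \<open>The generating function of the even sets, with sign \<open>(-1) ^ q [E']\<close>; the argument \<open>w\<close> gives the
  product of the variables of an edge set.\<close>

definition signed_gf ::
    "'a topology \<Rightarrow> ('v, 'e) mgraph \<Rightarrow> ('e \<Rightarrow> real \<Rightarrow> 'a) \<Rightarrow> ('a chain set \<Rightarrow> bit) \<Rightarrow>
     ('e set \<Rightarrow> 'r) \<Rightarrow> 'r :: ab_group_add" where
  "signed_gf X G \<gamma> q w =
     (\<Sum>E' \<in> even_sets G. if q (edge_set_class X \<gamma> E') = 0 then w E' else - w E')"


subsection \<open>Quotient spaces and gluing of discs\<close>

text \<open>The quotient of \<open>X\<close> by the fibres of \<open>r\<close>, with the image of \<open>r\<close> as the set of points.\<close>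

definition quotient_topology :: "'a topology \<Rightarrow> ('a \<Rightarrow> 'b) \<Rightarrow> 'b topology" where
  "quotient_topology X r =
     topology (\<lambda>U. U \<subseteq> r ` topspace X \<and> openin X {x \<in> topspace X. r x \<in> U})"

lemma openin_quotient_topology:
  "openin (quotient_topology X r) U \<longleftrightarrow> U \<subseteq> r ` topspace X \<and> openin X {x \<in> topspace X. r x \<in> U}"
proof -
  let ?L = "\<lambda>U. U \<subseteq> r ` topspace X \<and> openin X {x \<in> topspace X. r x \<in> U}"
  have "istopology ?L"
    unfolding istopology_def
  proof (intro conjI allI impI)
    fix S T assume "?L S" "?L T"
    moreover have "{x \<in> topspace X. r x \<in> S \<inter> T} =
        {x \<in> topspace X. r x \<in> S} \<inter> {x \<in> topspace X. r x \<in> T}" by auto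
    ultimately show "S \<inter> T \<subseteq> r ` topspace X" "openin X {x \<in> topspace X. r x \<in> S \<inter> T}"
      by auto
  next
    fix \<K> assume K: "\<forall>K\<in>\<K>. ?L K"
    then show "\<Union>\<K> \<subseteq> r ` topspace X" by auto
    have "{x \<in> topspace X. r x \<in> \<Union>\<K>} = (\<Union>K\<in>\<K>. {x \<in> topspace X. r x \<in> K})" by auto
    then show "openin X {x \<in> topspace X. r x \<in> \<Union>\<K>}" using K by auto
  qed
  then show ?thesis by (simp add: quotient_topology_def)
qed

lemma topspace_quotient_topology [simp]: "topspace (quotient_topology X r) = r ` topspace X"
proof -
  have "{x \<in> topspace X. r x \<in> r ` topspace X} = topspace X" by auto
  then have "openin (quotient_topology X r) (r ` topspace X)"
    by (simp add: openin_quotient_topology)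
  then show ?thesis
    by (metis openin_quotient_topology openin_subset openin_topspace subset_antisym)
qed

text \<open>Attaching to \<open>Y\<close> a cone over its subset \<open>A\<close>. If \<open>A\<close> is a simple closed curve, the cone over \<open>A\<close>
  is a disc, so this glues a disc to \<open>Y\<close> along \<open>A\<close>. A point \<open>y\<close> of \<open>Y\<close> appears as \<open>(y, 0)\<close>.\<close>

definition cone_point :: "'a \<Rightarrow> real \<Rightarrow> 'a \<times> real" where
  "cone_point y t = (if t = 1 then (undefined, 1) else (y, t))"

definition cone_off :: "'a topology \<Rightarrow> 'a set \<Rightarrow> ('a \<times> real) topology" where
  "cone_off Y A =
     quotient_topology
       (subtopology (prod_topology Y (top_of_set {0..1})) (topspace Y \<times> {0} \<union> A \<times> {0..1}))
       (\<lambda>(y, t). cone_point y t)"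


subsection \<open>The highway surface\<close>

definition clockwise_convex :: "nat \<Rightarrow> (nat \<Rightarrow> complex) \<Rightarrow> bool" where
  "clockwise_convex n a \<longleftrightarrow>
     (\<forall>i j l. 1 \<le> i \<and> i < j \<and> j < l \<and> l \<le> n \<longrightarrow> Im (cnj (a j - a i) * (a l - a i)) < 0)"

definition polygon :: "nat \<Rightarrow> (nat \<Rightarrow> complex) \<Rightarrow> complex set" where
  "polygon g a = convex hull (a ` {1..4 * g})"

definition corner :: "nat \<Rightarrow> (nat \<Rightarrow> complex) \<Rightarrow> nat \<Rightarrow> complex" where
  "corner g a m = a (Suc ((m - 1) mod (4 * g)))"

text \<open>Every bridge is a copy of the unit square with vertices \<open>0\<close>, \<open>\<i>\<close>, \<open>1 + \<i>\<close>, \<open>1\<close>, in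
  this (clockwise) order.\<close>

definition rectangle :: "complex set" where
  "rectangle = {z. 0 \<le> Re z \<and> Re z \<le> 1 \<and> 0 \<le> Im z \<and> Im z \<le> 1}"

text \<open>The disjoint union of \<open>R\<^sub>0\<close> and the bridges; the first component is the index of the piece.\<close>

definition highway_pieces :: "nat \<Rightarrow> (nat \<Rightarrow> complex) \<Rightarrow> (nat \<times> complex) set" where
  "highway_pieces g a = {0} \<times> polygon g a \<union> {1..2 * g} \<times> rectangle"

text \<open>If \<open>m\<close> is the first corner used by bridge \<open>j\<close>, then its vertices \<open>0\<close>, \<open>\<i>\<close>, \<open>1 + \<i>\<close>, \<open>1\<close> are glued
  to the corners \<open>m\<close>, \<open>m + 1\<close>, \<open>m + 2\<close>, \<open>m + 3\<close>. Here \<open>m = 4 (i - 1) + 1\<close> for \<open>j = 2 i - 1\<close> and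
  \<open>m = 4 (i - 1) + 2\<close> for \<open>j = 2 i\<close>.\<close>

definition first_corner :: "nat \<Rightarrow> nat" where
  "first_corner j = (if odd j then 2 * j - 1 else 2 * j - 2)"

definition glue :: "nat \<Rightarrow> (nat \<Rightarrow> complex) \<Rightarrow> nat \<times> complex \<Rightarrow> nat \<times> complex" where
  "glue g a = (\<lambda>(j, z). let m = first_corner j in
     if j = 0 then (0, z)
     else if Re z = 0 then (0, linepath (corner g a m) (corner g a (m + 1)) (Im z))
     else if Re z = 1 then (0, linepath (corner g a (m + 3)) (corner g a (m + 2)) (Im z))
     else (j, z))"

definition highway_surface :: "nat \<Rightarrow> (nat \<Rightarrow> complex) \<Rightarrow> (nat \<times> complex) topology" where
  "highway_surface g a = quotient_topology (top_of_set (highway_pieces g a)) (glue g a)"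

definition highway_boundary :: "nat \<Rightarrow> (nat \<Rightarrow> complex) \<Rightarrow> (nat \<times> complex) set" where
  "highway_boundary g a =
     glue g a ` ({1..2 * g} \<times> {z \<in> rectangle. Im z = 0 \<or> Im z = 1})"

definition closed_surface :: "nat \<Rightarrow> (nat \<Rightarrow> complex) \<Rightarrow> ((nat \<times> complex) \<times> real) topology" where
  "closed_surface g a = cone_off (highway_surface g a) (highway_boundary g a)"

text \<open>A closed curve that follows bridge \<open>j\<close> along its middle line and returns inside \<open>R\<^sub>0\<close>. The classes
  of these curves for \<open>j = 1, 2, 3, 4, \<dots>\<close> are the basis \<open>a\<^sub>1, b\<^sub>1, a\<^sub>2, b\<^sub>2, \<dots>\<close>.\<close>

definition bridge_curve :: "nat \<Rightarrow> (nat \<Rightarrow> complex) \<Rightarrow> nat \<Rightarrow> real \<Rightarrow> nat \<times> complex" where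
  "bridge_curve g a j t =
     (if t \<le> 1/2 then glue g a (j, Complex (2 * t) (1/2))
      else (0, linepath (snd (glue g a (j, Complex 1 (1/2))))
                        (snd (glue g a (j, Complex 0 (1/2)))) (2 * t - 1)))"


subsection \<open>Graphs drawn on the highway surface\<close>

definition embedded_graph ::
    "'a topology \<Rightarrow> ('v, 'e) mgraph \<Rightarrow> ('v \<Rightarrow> 'a) \<Rightarrow> ('e \<Rightarrow> real \<Rightarrow> 'a) \<Rightarrow> bool" where
  "embedded_graph Y G pos \<gamma> \<longleftrightarrow>
     pos ` verts G \<subseteq> topspace Y \<and> inj_on pos (verts G) \<and>
     (\<forall>e\<in>edges G. pathin Y (\<gamma> e) \<and> inj_on (\<gamma> e) {0<..<1} \<and>
        image_mset pos (ends G e) = {#\<gamma> e 0, \<gamma> e 1#} \<and>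
        \<gamma> e ` {0<..<1} \<inter> pos ` verts G = {}) \<and>
     (\<forall>e\<in>edges G. \<forall>e'\<in>edges G. e \<noteq> e' \<longrightarrow> \<gamma> e ` {0<..<1} \<inter> \<gamma> e' ` {0<..<1} = {})"

definition polygon_piece ::
    "nat \<Rightarrow> (nat \<Rightarrow> complex) \<Rightarrow> (real \<Rightarrow> nat \<times> complex) \<Rightarrow> real \<Rightarrow> real \<Rightarrow> bool" where
  "polygon_piece g a \<gamma> u v \<longleftrightarrow>
     (\<exists>f. continuous_on {u..v} f \<and> f ` {u..v} \<subseteq> polygon g a \<and> (\<forall>s\<in>{u..v}. \<gamma> s = (0, f s)))"

text \<open>A straight segment of bridge \<open>j\<close>, from one of the two glued sides to the other.\<close>

definition bridge_piece ::
    "nat \<Rightarrow> (nat \<Rightarrow> complex) \<Rightarrow> nat \<Rightarrow> (real \<Rightarrow> nat \<times> complex) \<Rightarrow> real \<Rightarrow> real \<Rightarrow> bool" where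
  "bridge_piece g a j \<gamma> u v \<longleftrightarrow>
     (\<exists>f. continuous_on {u..v} f \<and> f ` {u..v} = closed_segment (f u) (f v) \<and>
        f u \<in> rectangle \<and> f v \<in> rectangle \<and> {Re (f u), Re (f v)} = {0, 1} \<and>
        (\<forall>s\<in>{u..v}. \<gamma> s = glue g a (j, f s)))"

text \<open>The curve is cut into finitely many pieces, each in \<open>R\<^sub>0\<close> or a straight crossing of a bridge; outside
  of the crossings it stays in the interior of \<open>R\<^sub>0\<close>.\<close>

definition highway_curve :: "nat \<Rightarrow> (nat \<Rightarrow> complex) \<Rightarrow> (real \<Rightarrow> nat \<times> complex) \<Rightarrow> bool" where
  "highway_curve g a \<gamma> \<longleftrightarrow>
     (\<exists>n (t :: nat \<Rightarrow> real). t 0 = 0 \<and> t n = 1 \<and> (\<forall>i<n. t i < t (Suc i)) \<and>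
        (\<forall>i<n. polygon_piece g a \<gamma> (t i) (t (Suc i)) \<or>
               (\<exists>j\<in>{1..2 * g}. bridge_piece g a j \<gamma> (t i) (t (Suc i)))) \<and>
        (\<forall>s\<in>{0..1}. \<gamma> s \<in> {0} \<times> interior (polygon g a) \<or>
           (\<exists>i<n. s \<in> {t i..t (Suc i)} \<and> (\<exists>j\<in>{1..2 * g}. bridge_piece g a j \<gamma> (t i) (t (Suc i))))))"

text \<open>That crossings of the same bridge are disjoint is part of \<open>embedded_graph\<close>.\<close>

definition highway_graph ::
    "nat \<Rightarrow> (nat \<Rightarrow> complex) \<Rightarrow> ('v, 'e) mgraph \<Rightarrow> ('v \<Rightarrow> nat \<times> complex) \<Rightarrow>
     ('e \<Rightarrow> real \<Rightarrow> nat \<times> complex) \<Rightarrow> bool" where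
  "highway_graph g a G pos \<gamma> \<longleftrightarrow>
     embedded_graph (highway_surface g a) G pos \<gamma> \<and>
     pos ` verts G \<subseteq> {0} \<times> interior (polygon g a) \<and>
     (\<forall>e\<in>edges G. highway_curve g a (\<gamma> e))"


subsection \<open>The separating curve and the two tori\<close>

abbreviation double_torus :: "(nat \<Rightarrow> complex) \<Rightarrow> ((nat \<times> complex) \<times> real) topology" where
  "double_torus a \<equiv> closed_surface 2 a"

definition standard_torus :: "(complex \<times> complex) topology" where
  "standard_torus = prod_topology (top_of_set (sphere 0 1)) (top_of_set (sphere 0 1))"

text \<open>The component \<open>U\<close> of the complement of the curve \<open>c\<close>, closed by a disc along \<open>c\<close>.\<close>

definition capped ::
    "(nat \<Rightarrow> complex) \<Rightarrow> (real \<Rightarrow> (nat \<times> complex) \<times> real) \<Rightarrow> ((nat \<times> complex) \<times> real) set \<Rightarrow>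
     (((nat \<times> complex) \<times> real) \<times> real) topology" where
  "capped a c U = cone_off (subtopology (double_torus a) (U \<union> c ` {0..1})) (c ` {0..1})"

text \<open>All eight sides of \<open>R\<^sub>0\<close> are glued to bridges, so a chord that separates \<open>R\<^sub>1\<close>, \<open>R\<^sub>2\<close> from \<open>R\<^sub>3\<close>,
  \<open>R\<^sub>4\<close> joins the corners \<open>a 1\<close> and \<open>a 5\<close>; the rest of the curve lies in the disc glued to the
  highway surface.\<close>

definition separating_curve ::
    "(nat \<Rightarrow> complex) \<Rightarrow> (real \<Rightarrow> (nat \<times> complex) \<times> real) \<Rightarrow>
     ((nat \<times> complex) \<times> real) set \<Rightarrow> ((nat \<times> complex) \<times> real) set \<Rightarrow> bool" where
  "separating_curve a c U\<^sub>1 U\<^sub>2 \<longleftrightarrow>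
     simple_closed_curve (double_torus a) c \<and>
     c ` {0..1} \<inter> topspace (highway_surface 2 a) \<times> {0} = ({0} \<times> closed_segment (a 1) (a 5)) \<times> {0} \<and>
     U\<^sub>1 \<noteq> U\<^sub>2 \<and>
     connected_components_of
       (subtopology (double_torus a) (topspace (double_torus a) - c ` {0..1})) = {U\<^sub>1, U\<^sub>2} \<and>
     (glue 2 a ` ({1, 2} \<times> rectangle)) \<times> {0} - c ` {0..1} \<subseteq> U\<^sub>1 \<and>
     (glue 2 a ` ({3, 4} \<times> rectangle)) \<times> {0} - c ` {0..1} \<subseteq> U\<^sub>2 \<and>
     capped a c U\<^sub>1 homeomorphic_space standard_torus \<and>
     capped a c U\<^sub>2 homeomorphic_space standard_torus"

text \<open>The curve meets the graph exactly in the vertices \<open>vc 1, \<dots>, vc k\<close>, numbered along the curve.\<close>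

definition meets_in_vertices ::
    "(real \<Rightarrow> (nat \<times> complex) \<times> real) \<Rightarrow> ('v, 'e) mgraph \<Rightarrow> ('v \<Rightarrow> nat \<times> complex) \<Rightarrow>
     ('e \<Rightarrow> real \<Rightarrow> nat \<times> complex) \<Rightarrow> nat \<Rightarrow> (nat \<Rightarrow> 'v) \<Rightarrow> bool" where
  "meets_in_vertices c G pos \<gamma> k vc \<longleftrightarrow>
     {v \<in> verts G. (pos v, 0) \<in> c ` {0..1}} = vc ` {1..k} \<and>
     (\<exists>\<sigma>. strict_mono_on {1..k} \<sigma> \<and> (\<forall>i\<in>{1..k}. \<sigma> i \<in> {0..<1} \<and> c (\<sigma> i) = (pos (vc i), 0))) \<and>
     (\<forall>e\<in>edges G. \<forall>s\<in>{0<..<1}. (\<gamma> e s, 0) \<notin> c ` {0..1})"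

definition side_graph ::
    "('v, 'e) mgraph \<Rightarrow> ('v \<Rightarrow> nat \<times> complex) \<Rightarrow> ('e \<Rightarrow> real \<Rightarrow> nat \<times> complex) \<Rightarrow>
     nat \<Rightarrow> (nat \<Rightarrow> 'v) \<Rightarrow> ((nat \<times> complex) \<times> real) set \<Rightarrow> ('v, 'e) mgraph" where
  "side_graph G pos \<gamma> k vc U =
     \<lparr>verts = {v \<in> verts G. (pos v, 0) \<in> U} \<union> vc ` {1..k},
      edges = {e \<in> edges G. \<forall>s\<in>{0<..<1}. (\<gamma> e s, 0) \<in> U},
      ends = ends G\<rparr>"


subsection \<open>Attaching the target\<close>

text \<open>\<open>Mid i\<close> is \<open>v\<^sub>2\<^sup>i\<close>, \<open>Hub\<close> is the common vertex \<open>v\<^sub>3\<^sup>i\<close>, and \<open>v\<^sub>1\<^sup>i\<close> is identified with the vertex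
  \<open>vc i\<close> of the graph. \<open>Outer i\<close> is the edge \<open>{v\<^sub>3\<^sup>i, v\<^sub>2\<^sup>i}\<close> and \<open>Inner i\<close> the edge \<open>{v\<^sub>2\<^sup>i, v\<^sub>1\<^sup>i}\<close>.\<close>

datatype 'v tvert = Vert 'v | Mid nat | Hub
datatype 'e tedge = Edge 'e | Outer nat | Inner nat

definition attach_target ::
    "nat \<Rightarrow> (nat \<Rightarrow> 'v) \<Rightarrow> ('v, 'e) mgraph \<Rightarrow> ('v tvert, 'e tedge) mgraph" where
  "attach_target k vc G =
     \<lparr>verts = Vert ` verts G \<union> Mid ` {1..k} \<union> (\<lambda>i. Hub) ` {1..k},
      edges = Edge ` edges G \<union> Outer ` {1..k} \<union> Inner ` {1..k},
      ends = (\<lambda>d. case d of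
          Edge e \<Rightarrow> image_mset Vert (ends G e)
        | Outer i \<Rightarrow> {#Hub, Mid i#}
        | Inner i \<Rightarrow> {#Mid i, Vert (vc i)#})\<rparr>"

text \<open>The target is drawn in the capping disc, which is a cone: the path \<open>L i\<close> is the ray from the apex to
  \<open>vc i\<close>, with \<open>Mid i\<close> half way.\<close>

definition target_curve ::
    "('v \<Rightarrow> nat \<times> complex) \<Rightarrow> ('e \<Rightarrow> real \<Rightarrow> nat \<times> complex) \<Rightarrow> (nat \<Rightarrow> 'v) \<Rightarrow>
     'e tedge \<Rightarrow> real \<Rightarrow> ((nat \<times> complex) \<times> real) \<times> real" where
  "target_curve pos \<gamma> vc d s =
     (case d of
        Edge e \<Rightarrow> ((\<gamma> e s, 0), 0)
      | Outer i \<Rightarrow> cone_point (pos (vc i), 0) (1 - s / 2)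
      | Inner i \<Rightarrow> cone_point (pos (vc i), 0) (1 / 2 - s / 2))"


subsection \<open>Gluing variables and the pairing\<close>

text \<open>The polynomial ring over the integers in the indeterminates \<open>x\<^sub>e\<close>: finitely supported functions from
  exponent vectors to coefficients.\<close>

type_synonym 'e polyring = "('e \<Rightarrow>\<^sub>0 nat) \<Rightarrow>\<^sub>0 int"

definition indet :: "'e \<Rightarrow> 'e polyring" where
  "indet e = Poly_Mapping.single (Poly_Mapping.single e 1) 1"

text \<open>The pair \<open>(i, \<epsilon>)\<close> stands for the generator \<open>e\<^sub>\<epsilon>\<^sup>i\<close>, or for its dual. A basis monomial is the list of its
  factors. Only the module structure of the two exterior algebras is needed, so an element is a finitely
  supported function from basis monomials to coefficients.\<close>

definition generators :: "nat \<Rightarrow> (nat \<times> nat) list" where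
  "generators k = concat (map (\<lambda>i. [(i, 1), (i, 2)]) [1..<Suc k])"

definition increasing_monomial :: "nat \<Rightarrow> (nat \<times> nat) set \<Rightarrow> (nat \<times> nat) list" where
  "increasing_monomial k A = filter (\<lambda>x. x \<in> A) (generators k)"

definition basis :: "nat \<Rightarrow> (nat \<times> nat) list set" where
  "basis k = increasing_monomial k ` Pow (set (generators k))"

definition dual_basis :: "nat \<Rightarrow> (nat \<times> nat) list set" where
  "dual_basis k = rev ` basis k"

definition pairing ::
    "nat \<Rightarrow> ((nat \<times> nat) list \<Rightarrow>\<^sub>0 'r) \<Rightarrow> ((nat \<times> nat) list \<Rightarrow>\<^sub>0 'r) \<Rightarrow> 'r :: comm_ring_1" where
  "pairing k f h =
     (\<Sum>b\<in>basis k. \<Sum>b'\<in>dual_basis k.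
        Poly_Mapping.lookup f b * Poly_Mapping.lookup h b' * (if b' = rev b then 1 else 0))"

definition weight :: "'e set \<Rightarrow> 'e polyring" where
  "weight E' = (\<Prod>e\<in>E'. indet e)"

definition weight1 :: "nat \<Rightarrow> 'e tedge set \<Rightarrow> (nat \<times> nat) list \<Rightarrow>\<^sub>0 'e polyring" where
  "weight1 k D =
     Poly_Mapping.single
       (increasing_monomial k ({(i, 1) | i. Outer i \<in> D} \<union> {(i, 2) | i. Inner i \<in> D}))
       (weight {e. Edge e \<in> D})"

definition weight2 :: "nat \<Rightarrow> 'e tedge set \<Rightarrow> (nat \<times> nat) list \<Rightarrow>\<^sub>0 'e polyring" where
  "weight2 k D =
     Poly_Mapping.single
       (rev (increasing_monomial k ({(i, 2) | i. Outer i \<in> D} \<union> {(i, 1) | i. Inner i \<in> D})))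
       (weight {e. Edge e \<in> D})"

end

theory Submission
  imports Defs
begin

text \<open>Modulo boundaries, a curve on the highway surface is the sum of the basis curves of the bridges it
  crosses and of the two segments that join its end points to a fixed point of \<open>R\<^sub>0\<close>. Hence the class of an
  even set \<open>E\<close> depends only on the parities of its numbers of bridge crossings. The same holds for the two
  parts of \<open>E\<close> in the capped tori, where the rays of the target cancel the segments at the odd vertices. So
  only explicit homologies are needed: the linear independence of the basis is never used.

  The basis curves \<open>a\<^sub>i, b\<^sub>i\<close> cross transversally in exactly one point of \<open>R\<^sub>0\<close>, and those of different handles
  are disjoint. Thus \<open>q [E]\<close> is the sum of the values of \<open>q\<^sub>1\<close> and \<open>q\<^sub>2\<close> on the two parts, and since the
  pairing selects the pairs of even sets that use the same rays, these being exactly the splittings of the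
  even sets of the graph, the generating functions agree.\<close>

subsection \<open>Mod 2 homologous chains\<close>

text \<open>No map between the double torus and the capped tori relates their homology; the surfaces
  are compared only through the bridges that are crossed. Hence the chain computations live in a
  locale describing a convex piece of R_0 together with some bridges, which is interpreted three
  times: for the octagon with four bridges and for either half of it with two. A quadratic form is
  not linear, so its value on a sum of basis curves involves their intersection numbers, and
  \<open>intersection_form\<close> supplies these only for transversal simple closed curves. This
  forces explicit charts at the crossing of a_i and b_i. Since the return segments of
  \<open>bridge_curve\<close> are straight, all the planar geometry comes down to signs of oriented
  triples of vertices. The rays of the target share the apex of the cone, which leaves one copy of a
  fixed chain per ray besides the spokes; these copies vanish because the number of rays is even.
  For a lifted even set this is the degree of the hub, for the two halves of an even set of G it is
  the handshake lemma on one side.\<close>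

lemma frag_cmul_2: "frag_cmul 2 c = c + c"
  using frag_cmul_distrib [of 1 1 c] by simp

lemma mod2_boundaries_zero [simp]: "0 \<in> mod2_boundaries p X"
  unfolding mod2_boundaries_def by (force intro: exI [of _ 0])

lemma mod2_boundaries_add:
  assumes "c \<in> mod2_boundaries p X" "d \<in> mod2_boundaries p X"
  shows "c + d \<in> mod2_boundaries p X"
proof -
  obtain c1 c2 where c: "c = chain_boundary (Suc p) c1 + frag_cmul 2 c2"
      "singular_chain (Suc p) X c1" "singular_chain p X c2"
    using assms(1) unfolding mod2_boundaries_def by blast
  obtain d1 d2 where d: "d = chain_boundary (Suc p) d1 + frag_cmul 2 d2"
      "singular_chain (Suc p) X d1" "singular_chain p X d2"
    using assms(2) unfolding mod2_boundaries_def by blast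
  have "c + d = chain_boundary (Suc p) (c1 + d1) + frag_cmul 2 (c2 + d2)"
    by (simp add: c d chain_boundary_add frag_cmul_distrib2)
  then show ?thesis
    unfolding mod2_boundaries_def using c d singular_chain_add by blast
qed

lemma mod2_boundaries_uminus:
  assumes "c \<in> mod2_boundaries p X"
  shows "- c \<in> mod2_boundaries p X"
proof -
  obtain c1 c2 where c: "c = chain_boundary (Suc p) c1 + frag_cmul 2 c2"
      "singular_chain (Suc p) X c1" "singular_chain p X c2"
    using assms unfolding mod2_boundaries_def by blast
  have "- c = chain_boundary (Suc p) (- c1) + frag_cmul 2 (- c2)"
    by (simp add: c chain_boundary_minus frag_cmul_2)
  then show ?thesis
    unfolding mod2_boundaries_def using c singular_chain_minus by blast
qed

lemma mod2_boundaries_diff: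
  "\<lbrakk>c \<in> mod2_boundaries p X; d \<in> mod2_boundaries p X\<rbrakk> \<Longrightarrow> c - d \<in> mod2_boundaries p X"
  using mod2_boundaries_add [OF _ mod2_boundaries_uminus] by fastforce

lemma mod2_boundaries_double: "singular_chain p X c \<Longrightarrow> c + c \<in> mod2_boundaries p X"
  unfolding mod2_boundaries_def frag_cmul_2 [symmetric]
  by (force intro: exI [of _ 0])

lemma mod2_boundaries_boundary:
  "singular_chain (Suc p) X c \<Longrightarrow> chain_boundary (Suc p) c \<in> mod2_boundaries p X"
  unfolding mod2_boundaries_def by (force intro: exI [of _ 0])

text \<open>Defined on all chains, not only on cycles: a single segment or spoke has a boundary. As
  a congruence for sums the relation allows chains to be replaced piece by piece.\<close>

definition mod2_homologous :: "'a topology \<Rightarrow> 'a chain \<Rightarrow> 'a chain \<Rightarrow> bool" where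
  "mod2_homologous X c d \<longleftrightarrow> c - d \<in> mod2_boundaries 1 X"

lemma mod2_homologous_refl [simp]: "mod2_homologous X c c"
  by (simp add: mod2_homologous_def)

lemma mod2_homologous_sym: "mod2_homologous X c d \<Longrightarrow> mod2_homologous X d c"
  unfolding mod2_homologous_def using mod2_boundaries_uminus by fastforce

lemma mod2_homologous_trans [trans]:
  "\<lbrakk>mod2_homologous X c d; mod2_homologous X d e\<rbrakk> \<Longrightarrow> mod2_homologous X c e"
  unfolding mod2_homologous_def using mod2_boundaries_add by fastforce

lemma mod2_homologous_add:
  "\<lbrakk>mod2_homologous X c d; mod2_homologous X c' d'\<rbrakk> \<Longrightarrow> mod2_homologous X (c + c') (d + d')"
  unfolding mod2_homologous_def
  using mod2_boundaries_add [of "c - d" 1 X "c' - d'"] by (simp add: algebra_simps)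

lemma mod2_homologous_diff:
  "\<lbrakk>mod2_homologous X c d; mod2_homologous X c' d'\<rbrakk> \<Longrightarrow> mod2_homologous X (c - c') (d - d')"
  unfolding mod2_homologous_def
  using mod2_boundaries_diff [of "c - d" 1 X "c' - d'"] by (simp add: algebra_simps)

lemma mod2_homologous_sum:
  "(\<And>i. i \<in> I \<Longrightarrow> mod2_homologous X (f i) (h i)) \<Longrightarrow> mod2_homologous X (sum f I) (sum h I)"
  by (induction I rule: infinite_finite_induct) (auto intro: mod2_homologous_add)

text \<open>The two chains differ by a double. This makes the direction of paths irrelevant.\<close>

lemma mod2_homologous_uminus:
  "singular_chain 1 X c \<Longrightarrow> mod2_homologous X (- c) c"
  unfolding mod2_homologous_def
  using mod2_boundaries_uminus [OF mod2_boundaries_double] by fastforce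

lemma mod2_homologous_cmul:
  assumes "singular_chain 1 X c"
  shows "mod2_homologous X (frag_cmul (int n) c) (if odd n then c else 0)"
proof (induction n)
  case (Suc n)
  have 1: "frag_cmul (int (Suc n)) c = frag_cmul (int n) c + c"
    using frag_cmul_distrib [of "int n" 1 c] by (simp add: add.commute)
  have "mod2_homologous X (frag_cmul (int n) c + c) ((if odd n then c else 0) + c)"
    using Suc by (intro mod2_homologous_add) auto
  moreover have "mod2_homologous X (c + c) 0"
    using assms by (simp add: mod2_homologous_def mod2_boundaries_double)
  ultimately show ?case
    unfolding 1 by (auto intro: mod2_homologous_trans)
qed simp

lemma frag_cmul_of_nat_sum: "finite I \<Longrightarrow> frag_cmul (int (card I)) c = (\<Sum>i\<in>I. c)"
  by (induction I rule: finite_induct) (auto simp: frag_cmul_distrib)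

lemma mod2_class_eqI:
  assumes "mod2_homologous X c d"
  shows "mod2_class X c = mod2_class X d"
proof -
  have *: "mod2_class X c \<subseteq> mod2_class X d" if "mod2_homologous X c d" for c d
  proof
    fix x assume "x \<in> mod2_class X c"
    then obtain b where b: "b \<in> mod2_boundaries 1 X" "x = b + c"
      by (auto simp: mod2_class_def r_coset_def)
    have "x = (b + (c - d)) + d" using b by simp
    moreover have "b + (c - d) \<in> mod2_boundaries 1 X"
      using b that mod2_boundaries_add by (auto simp: mod2_homologous_def)
    ultimately show "x \<in> mod2_class X d" unfolding mod2_class_def r_coset_def by force
  qed
  show ?thesis using * [OF assms] * [OF mod2_homologous_sym [OF assms]] by blast
qed

lemma mod2_cycles_add:
  assumes "c \<in> mod2_cycles p X" "d \<in> mod2_cycles p X"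
  shows "c + d \<in> mod2_cycles p X"
proof -
  obtain c1 where c: "singular_chain p X c" "singular_chain (p - 1) X c1"
      "chain_boundary p c = frag_cmul 2 c1"
    using assms(1) unfolding mod2_cycles_def by blast
  obtain d1 where d: "singular_chain p X d" "singular_chain (p - 1) X d1"
      "chain_boundary p d = frag_cmul 2 d1"
    using assms(2) unfolding mod2_cycles_def by blast
  have "chain_boundary p (c + d) = frag_cmul 2 (c1 + d1)"
    by (simp add: c d chain_boundary_add frag_cmul_distrib2)
  then show ?thesis
    unfolding mod2_cycles_def using c d singular_chain_add by blast
qed

lemma mod2_cycles_zero [simp]: "0 \<in> mod2_cycles p X"
  unfolding mod2_cycles_def by (auto intro!: exI [of _ 0])

lemma mod2_class_in_homology:
  assumes "c \<in> mod2_cycles 1 X"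
  shows "mod2_class X c \<in> carrier (mod2_homology 1 X)"
proof -
  have "c \<in> carrier (subgroup_generated (chain_group 1 X) (mod2_cycles 1 X))"
    unfolding carrier_subgroup_generated
    using assms by (intro generate.incl) (auto simp: mod2_cycles_def)
  then show ?thesis
    unfolding mod2_homology_def mod2_class_def FactGroup_def RCOSETS_def
    by (auto simp: r_coset_def)
qed

text \<open>The factor group multiplies cosets elementwise, so this comes down to boundaries being
  closed under addition and containing 0.\<close>

lemma mod2_class_add:
  "mod2_class X c \<otimes>\<^bsub>mod2_homology 1 X\<^esub> mod2_class X d = mod2_class X (c + d)"
proof -
  have "mod2_class X c \<otimes>\<^bsub>mod2_homology 1 X\<^esub> mod2_class X d =
        {(x + c) + (y + d) | x y. x \<in> mod2_boundaries 1 X \<and> y \<in> mod2_boundaries 1 X}"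
    unfolding mod2_homology_def mod2_class_def FactGroup_def set_mult_def r_coset_def by auto
  also have "\<dots> = mod2_class X (c + d)"
  proof (intro equalityI subsetI)
    fix z assume "z \<in> {(x + c) + (y + d) | x y. x \<in> mod2_boundaries 1 X \<and> y \<in> mod2_boundaries 1 X}"
    then obtain x y where "x \<in> mod2_boundaries 1 X" "y \<in> mod2_boundaries 1 X" "z = (x + y) + (c + d)"
      by (auto simp: algebra_simps)
    then show "z \<in> mod2_class X (c + d)"
      using mod2_boundaries_add [of x 1 X y] by (auto simp: mod2_class_def r_coset_def)
  next
    fix z assume "z \<in> mod2_class X (c + d)"
    then obtain x where x: "x \<in> mod2_boundaries 1 X" "z = x + (c + d)"
      by (auto simp: mod2_class_def r_coset_def)
    then have "z = (x + c) + (0 + d)" by simp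
    then show "z \<in> {(x + c) + (y + d) | x y. x \<in> mod2_boundaries 1 X \<and> y \<in> mod2_boundaries 1 X}"
      using x(1) mod2_boundaries_zero by blast
  qed
  finally show ?thesis .
qed

subsection \<open>Chains of paths\<close>

lemma standard_simplex_1_iff:
  "x \<in> standard_simplex 1 \<longleftrightarrow> 0 \<le> x 1 \<and> x 1 \<le> 1 \<and> x 0 = 1 - x 1 \<and> (\<forall>i>1. x i = 0)"
proof -
  have "x \<in> standard_simplex 1" if h: "0 \<le> x 1" "x 1 \<le> 1" "x 0 = 1 - x 1" "\<forall>i>1. x i = 0"
  proof -
    have "0 \<le> x i \<and> x i \<le> 1" for i
    proof -
      consider "i = 0" | "i = 1" | "i > 1" by linarith
      then show ?thesis using h by cases auto
    qed
    then show ?thesis using h by (simp add: standard_simplex_def)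
  qed
  then show ?thesis by (auto simp: standard_simplex_def)
qed

lemma standard_simplex_2_iff:
  "x \<in> standard_simplex 2 \<longleftrightarrow>
     0 \<le> x 1 \<and> 0 \<le> x 2 \<and> x 1 + x 2 \<le> 1 \<and> x 0 = 1 - x 1 - x 2 \<and> (\<forall>i>2. x i = 0)"
proof -
  have "x \<in> standard_simplex 2"
    if h: "0 \<le> x 1" "0 \<le> x 2" "x 1 + x 2 \<le> 1" "x 0 = 1 - x 1 - x 2" "\<forall>i>2. x i = 0"
  proof -
    have "0 \<le> x i \<and> x i \<le> 1" for i
    proof -
      consider "i = 0" | "i = 1" | "i = 2" | "i > 2" by linarith
      then show ?thesis using h by cases auto
    qed
    then show ?thesis using h by (simp add: standard_simplex_def numeral_2_eq_2)
  qed
  moreover have "0 \<le> x 0 \<and> 0 \<le> x 1 \<and> 0 \<le> x 2 \<and> x 0 + x 1 + x 2 = 1 \<and> (\<forall>i>2. x i = 0)"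
    if "x \<in> standard_simplex 2"
    using that by (simp add: standard_simplex_def numeral_2_eq_2)
  ultimately show ?thesis by (smt (verit, best))
qed

lemma path_simplex_cong:
  "(\<And>s. 0 \<le> s \<Longrightarrow> s \<le> 1 \<Longrightarrow> \<gamma> s = \<delta> s) \<Longrightarrow> path_simplex \<gamma> = path_simplex \<delta>"
  unfolding path_simplex_def fun_eq_iff restrict_def standard_simplex_1_iff by auto

lemma continuous_map_real_coordinate:
  "continuous_map (subtopology (powertop_real UNIV) S) euclideanreal (\<lambda>x. x (i::nat))"
  by (intro continuous_map_from_subtopology continuous_map_product_projection) simp

lemma singular_simplex_path:
  assumes "pathin X \<gamma>"
  shows "singular_simplex 1 X (path_simplex \<gamma>)"
  unfolding singular_simplex_def path_simplex_def
proof
  have "continuous_map (subtopology (powertop_real UNIV) (standard_simplex 1)) (top_of_set {0..1})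
          (\<lambda>x. x 1)"
    unfolding continuous_map_in_subtopology
    by (auto simp: continuous_map_real_coordinate standard_simplex_1_iff simp del: One_nat_def)
  then have "continuous_map (subtopology (powertop_real UNIV) (standard_simplex 1)) X (\<gamma> \<circ> (\<lambda>x. x 1))"
    using assms unfolding pathin_def by (rule continuous_map_compose)
  then show "continuous_map (subtopology (powertop_real UNIV) (standard_simplex 1)) X
          (restrict (\<lambda>x. \<gamma> (x 1)) (standard_simplex 1))"
    by (rule continuous_map_eq) auto
qed auto

lemma singular_chain_path: "pathin X \<gamma> \<Longrightarrow> singular_chain 1 X (frag_of (path_simplex \<gamma>))"
  by (simp add: singular_chain_of singular_simplex_path del: One_nat_def)

text \<open>The two faces are the 0-simplices at \<open>\<gamma> 1\<close> and
  \<open>\<gamma> 0\<close>, so the boundary vanishes already over the integers.\<close>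

lemma closed_path_cycle:
  assumes "pathin X \<gamma>" "\<gamma> 0 = \<gamma> 1"
  shows "frag_of (path_simplex \<gamma>) \<in> mod2_cycles 1 X"
proof -
  have "singular_face 1 0 (path_simplex \<gamma>) = singular_face 1 1 (path_simplex \<gamma>)"
  proof
    fix x :: "nat \<Rightarrow> real"
    have "simplical_face 0 x \<in> standard_simplex 1" "simplical_face 1 x \<in> standard_simplex 1"
      if "x \<in> standard_simplex 0"
      using simplical_face_in_standard_simplex [of 1 _ x] that by auto
    then show "singular_face 1 0 (path_simplex \<gamma>) x = singular_face 1 1 (path_simplex \<gamma>) x"
      using assms(2) unfolding singular_face_def path_simplex_def
      by (auto simp: restrict_def simplical_face_def standard_simplex_0)
  qed
  then have "chain_boundary 1 (frag_of (path_simplex \<gamma>)) = frag_cmul 2 0"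
    by (simp add: chain_boundary_of)
  then show ?thesis
    unfolding mod2_cycles_def using singular_chain_path [OF assms(1)] singular_chain_0 by blast
qed

text \<open>The domain is any normed space because segments are taken in R_0, in a bridge, in a
  parameter interval, in the square of a homotopy and in the strip over the chord.\<close>

definition segment_chain :: "('b::real_normed_vector \<Rightarrow> 'a) \<Rightarrow> 'b \<Rightarrow> 'b \<Rightarrow> 'a chain" where
  "segment_chain F p q = frag_of (path_simplex (\<lambda>s. F (linepath p q s)))"

lemma pathin_compose_convex:
  assumes "convex C" "continuous_map (top_of_set C) X F" "p \<in> C" "q \<in> C"
  shows "pathin X (\<lambda>s. F (linepath p q s))"
proof -
  have "continuous_map (top_of_set {0..1}) (top_of_set C) (linepath p q)"
    using assms by (auto simp: linepath_def intro: convexD_alt intro!: continuous_intros)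
  then show ?thesis
    unfolding pathin_def using continuous_map_compose [OF _ assms(2)] unfolding o_def by blast
qed

lemma singular_chain_segment:
  assumes "convex C" "continuous_map (top_of_set C) X F" "p \<in> C" "q \<in> C"
  shows "singular_chain 1 X (segment_chain F p q)"
  unfolding segment_chain_def using assms by (intro singular_chain_path pathin_compose_convex)

text \<open>The affine 2-simplex with vertices p, q, r, carried into X by F, has the boundary pq +
  qr - pr.\<close>

lemma segment_chain_triangle:
  assumes C: "convex C" and F: "continuous_map (top_of_set C) X F" and "p \<in> C" "q \<in> C" "r \<in> C"
  shows "mod2_homologous X (segment_chain F p q + segment_chain F q r) (segment_chain F p r)"
proof -
  let ?l = "\<lambda>x::nat \<Rightarrow> real. x 0 *\<^sub>R p + x 1 *\<^sub>R q + x 2 *\<^sub>R r"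
  define \<sigma> where "\<sigma> = restrict (\<lambda>x. F (?l x)) (standard_simplex 2)"
  have scale: "continuous_map (subtopology (powertop_real UNIV) (standard_simplex 2)) euclidean
      (\<lambda>x. x i *\<^sub>R c)" for c :: 'a and i
  proof -
    have "continuous_map euclideanreal euclidean (\<lambda>t. t *\<^sub>R c)"
      by (simp add: continuous_intros)
    then show ?thesis
      using continuous_map_compose [OF continuous_map_real_coordinate] unfolding o_def by blast
  qed
  have l: "continuous_map (subtopology (powertop_real UNIV) (standard_simplex 2)) (top_of_set C) ?l"
    unfolding continuous_map_in_subtopology
  proof
    show "continuous_map (subtopology (powertop_real UNIV) (standard_simplex 2)) euclidean ?l"
      by (intro continuous_map_add scale)
    show "?l \<in> topspace (subtopology (powertop_real UNIV) (standard_simplex 2)) \<rightarrow> C"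
    proof
      fix x assume "x \<in> topspace (subtopology (powertop_real UNIV) (standard_simplex 2))"
      then have x: "x \<in> standard_simplex 2" by simp
      show "?l x \<in> C"
      proof -
        have "convex hull {p, q, r} \<subseteq> C" using assms(3-5) C by (intro hull_minimal) auto
        moreover have "0 \<le> x 0" "0 \<le> x 1" "0 \<le> x 2" "x 0 + x 1 + x 2 = 1"
          using x by (auto simp: standard_simplex_2_iff)
        then have "?l x \<in> convex hull {p, q, r}" unfolding convex_hull_3 by blast
        ultimately show ?thesis by blast
      qed
    qed
  qed
  have s: "singular_simplex 2 X \<sigma>"
    unfolding singular_simplex_def
  proof
    show "continuous_map (subtopology (powertop_real UNIV) (standard_simplex 2)) X \<sigma>"
      by (rule continuous_map_eq [OF continuous_map_compose [OF l F]]) (auto simp: \<sigma>_def)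
  qed (simp add: \<sigma>_def)
  have face: "singular_face 2 i \<sigma> = path_simplex (\<lambda>s. F (linepath u v s))"
    if "\<And>x. x \<in> standard_simplex 1 \<Longrightarrow> ?l (simplical_face i x) = linepath u v (x 1)" "i \<le> 2" for i u v
  proof
    fix x
    show "singular_face 2 i \<sigma> x = path_simplex (\<lambda>s. F (linepath u v s)) x"
      using that simplical_face_in_standard_simplex [of 2 i x]
      unfolding singular_face_def path_simplex_def \<sigma>_def
      by (auto simp: restrict_def)
  qed
  have "singular_face 2 0 \<sigma> = path_simplex (\<lambda>s. F (linepath q r s))"
       "singular_face 2 1 \<sigma> = path_simplex (\<lambda>s. F (linepath p r s))"
       "singular_face 2 2 \<sigma> = path_simplex (\<lambda>s. F (linepath p q s))"
    by (rule face; simp add: standard_simplex_1_iff [unfolded One_nat_def] simplical_face_def linepath_def)+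
  then have "chain_boundary (Suc 1) (frag_of \<sigma>) =
      segment_chain F p q + segment_chain F q r - segment_chain F p r"
    by (simp add: chain_boundary_of segment_chain_def numeral_2_eq_2)
  moreover have "singular_chain (Suc 1) X (frag_of \<sigma>)"
    using s by (simp add: singular_chain_of numeral_2_eq_2)
  ultimately show ?thesis
    unfolding mod2_homologous_def using mod2_boundaries_boundary by metis
qed

text \<open>The triangle p, p, p has the boundary pp + pp - pp.\<close>

lemma segment_chain_same:
  assumes "convex C" "continuous_map (top_of_set C) X F" "p \<in> C"
  shows "mod2_homologous X (segment_chain F p p) 0"
  using segment_chain_triangle [OF assms(1,2,3,3,3)] by (simp add: mod2_homologous_def)

text \<open>With a fixed base point a segment becomes the difference of a potential at its ends, so
  that sums along a subdivided curve telescope.\<close>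

lemma segment_chain_diff:
  assumes "convex C" "continuous_map (top_of_set C) X F" "o' \<in> C" "p \<in> C" "q \<in> C"
  shows "mod2_homologous X (segment_chain F p q) (segment_chain F o' q - segment_chain F o' p)"
  using segment_chain_triangle [OF assms] by (simp add: mod2_homologous_def algebra_simps)

lemma segment_chain_swap:
  assumes "convex C" "continuous_map (top_of_set C) X F" "p \<in> C" "q \<in> C"
  shows "mod2_homologous X (segment_chain F q p) (segment_chain F p q)"
proof -
  have "mod2_homologous X (segment_chain F q p) (segment_chain F p p - segment_chain F p q)"
    using assms by (intro segment_chain_diff) auto
  also have "mod2_homologous X \<dots> (0 - segment_chain F p q)"
    using assms by (intro mod2_homologous_diff segment_chain_same) auto
  also have "mod2_homologous X \<dots> (segment_chain F p q)"
    using mod2_homologous_uminus [OF singular_chain_segment [OF assms]] by simp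
  finally show ?thesis .
qed

text \<open>The chain depends only on the values of F along the segment, so it is also a segment
  chain of a constant map on the real line.\<close>

lemma segment_chain_const:
  assumes "x \<in> topspace X" "\<And>s. 0 \<le> s \<Longrightarrow> s \<le> 1 \<Longrightarrow> F (linepath p q s) = x"
  shows "mod2_homologous X (segment_chain F p q) 0"
proof -
  have "segment_chain F p q = segment_chain (\<lambda>_::real. x) 0 0"
    unfolding segment_chain_def by (intro arg_cong [where f = frag_of] path_simplex_cong assms)
  then show ?thesis
    using segment_chain_same [of UNIV X "\<lambda>_::real. x" 0] assms(1) by (simp add: continuous_map_const)
qed

text \<open>The straight-line homotopy from a path to the segment between its end points.\<close>

lemma path_homologous_segment:
  assumes C: "convex C" and F: "continuous_map (top_of_set C) X F"
    and g: "continuous_on {0..1} g" "g ` {0..1} \<subseteq> C"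
  shows "mod2_homologous X (frag_of (path_simplex (\<lambda>s. F (g s)))) (segment_chain F (g 0) (g 1))"
proof -
  \<comment> \<open>The homotopy on the unit square: g on the side t = 0, the straight segment on
    the side t = 1, and constant vertical sides because the end points stay fixed.\<close>
  define h where "h = (\<lambda>(s, t). linepath (g s) (linepath (g 0) (g 1) s) t)"
  define Q :: "(real \<times> real) set" where "Q = {0..1} \<times> {0..1}"
  define H where "H = (\<lambda>z. F (h z))"
  have [simp]: "g 0 \<in> C" "g 1 \<in> C" using g by auto
  have Q: "convex Q" unfolding Q_def by (intro convex_Times) auto
  have "continuous_on Q h"
    unfolding h_def Q_def linepath_def case_prod_unfold
    by (intro continuous_intros continuous_on_compose2 [OF g(1)]) auto
  moreover have "h ` Q \<subseteq> C"
  proof clarify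
    fix s t assume "(s, t) \<in> Q"
    then have *: "0 \<le> s" "s \<le> 1" "0 \<le> t" "t \<le> 1" by (auto simp: Q_def)
    then have "linepath (g 0) (g 1) s \<in> C" "g s \<in> C"
      using g convexD_alt [OF C, of "g 0" "g 1" s] by (auto simp: linepath_def)
    then show "h (s, t) \<in> C"
      using * convexD_alt [OF C] by (auto simp: linepath_def h_def)
  qed
  ultimately have "continuous_map (top_of_set Q) (top_of_set C) h" by auto
  then have H: "continuous_map (top_of_set Q) X H"
    using continuous_map_compose [OF _ F] unfolding H_def o_def by blast
  have in_Q [simp]: "(0,0) \<in> Q" "(1,0) \<in> Q" "(0,1) \<in> Q" "(1,1) \<in> Q" by (auto simp: Q_def)
  have X: "F (g 0) \<in> topspace X" "F (g 1) \<in> topspace X"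
    using F by (auto simp: continuous_map_def Pi_iff)
  have e1: "segment_chain H (0,0) (1,0) = frag_of (path_simplex (\<lambda>s. F (g s)))"
    unfolding segment_chain_def by (simp add: H_def h_def linepath_def)
  have e2: "segment_chain H (0,1) (1,1) = segment_chain F (g 0) (g 1)"
    unfolding segment_chain_def by (simp add: H_def h_def linepath_def)
  have e3: "mod2_homologous X (segment_chain H (0,0) (0,1)) 0"
    by (rule segment_chain_const [OF X(1)]) (simp add: H_def h_def linepath_def flip: scaleR_add_left)
  have e4: "mod2_homologous X (segment_chain H (1,0) (1,1)) 0"
    by (rule segment_chain_const [OF X(2)]) (simp add: H_def h_def linepath_def flip: scaleR_add_left)
  \<comment> \<open>The diagonal from (0,0) to (1,1) cuts the square into two triangles; the chain
    moves from the bottom to the diagonal and from there to the top.\<close>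
  have "mod2_homologous X (segment_chain H (0,0) (1,0) + 0) (segment_chain H (0,0) (1,0) + segment_chain H (1,0) (1,1))"
    by (intro mod2_homologous_add mod2_homologous_refl mod2_homologous_sym [OF e4])
  also have "mod2_homologous X \<dots> (segment_chain H (0,0) (1,1))"
    by (intro segment_chain_triangle [OF Q H]) auto
  also have "mod2_homologous X \<dots> (segment_chain H (0,0) (0,1) + segment_chain H (0,1) (1,1))"
    by (intro mod2_homologous_sym [OF segment_chain_triangle [OF Q H]]) auto
  also have "mod2_homologous X \<dots> (0 + segment_chain H (0,1) (1,1))"
    by (intro mod2_homologous_add mod2_homologous_refl e3)
  finally show ?thesis using e1 e2 by simp
qed

subsection \<open>Curves on the highway surface\<close>

text \<open>The space \<open>X\<close> contains a copy of the part of the highway surface that consists of the convex piece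
  \<open>K\<close> of \<open>R\<^sub>0\<close> and the bridges in \<open>J\<close>.\<close>

locale highway_part =
  fixes g :: nat and a :: "nat \<Rightarrow> complex" and X :: "'x topology" and \<iota> :: "nat \<times> complex \<Rightarrow> 'x"
    and K :: "complex set" and J :: "nat set"
  assumes convex_K: "convex K"
    and continuous_plane: "continuous_map (top_of_set K) X (\<lambda>z. \<iota> (0, z))"
    and continuous_bridge:
      "j \<in> J \<Longrightarrow> continuous_map (top_of_set rectangle) X (\<lambda>z. \<iota> (glue g a (j, z)))"
    and corners_K: "\<lbrakk>j \<in> J; i \<le> 3\<rbrakk> \<Longrightarrow> corner g a (first_corner j + i) \<in> K"
    and zero_J: "0 \<notin> J"
begin

abbreviation spoke :: "complex \<Rightarrow> complex \<Rightarrow> 'x chain" where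
  "spoke \<equiv> segment_chain (\<lambda>z. \<iota> (0, z))"

abbreviation bridge_chain :: "nat \<Rightarrow> 'x chain" where
  "bridge_chain j \<equiv> frag_of (path_simplex (\<lambda>s. \<iota> (bridge_curve g a j s)))"

abbreviation side_mid :: "nat \<Rightarrow> real \<Rightarrow> complex" where
  "side_mid j r \<equiv> snd (glue g a (j, Complex r (1/2)))"

lemma convex_rectangle: "convex rectangle"
proof -
  have "rectangle = cbox 0 (Complex 1 1)"
    by (auto simp: rectangle_def in_cbox_complex_iff)
  then show ?thesis using convex_box(1) by metis
qed

text \<open>Treats both glued sides at once: on either of them the gluing is affine in the imaginary
  part, with end points in K.\<close>

lemma glue_side:
  assumes "j \<in> J" "Re z = 0 \<or> Re z = 1"
  obtains A B where "A \<in> K" "B \<in> K" "\<And>w. Re w = Re z \<Longrightarrow> glue g a (j, w) = (0, linepath A B (Im w))"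
proof -
  have "j \<noteq> 0" using assms zero_J by metis
  let ?m = "first_corner j"
  have K: "corner g a ?m \<in> K" "corner g a (?m + 1) \<in> K" "corner g a (?m + 3) \<in> K" "corner g a (?m + 2) \<in> K"
    using corners_K [OF assms(1), of 0] corners_K [OF assms(1), of 1] corners_K [OF assms(1), of 2]
      corners_K [OF assms(1), of 3] by auto
  show ?thesis
  proof (cases "Re z = 0")
    case True
    then show ?thesis using K \<open>j \<noteq> 0\<close> by (intro that [OF K(1,2)]) (auto simp: glue_def Let_def)
  next
    case False
    then show ?thesis using K \<open>j \<noteq> 0\<close> assms by (intro that [OF K(3,4)]) (auto simp: glue_def Let_def)
  qed
qed

lemma glue_side_K:
  assumes "j \<in> J" "z \<in> rectangle" "Re z = 0 \<or> Re z = 1"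
  shows "fst (glue g a (j, z)) = 0" "snd (glue g a (j, z)) \<in> K"
proof -
  obtain A B where AB: "A \<in> K" "B \<in> K" "glue g a (j, z) = (0, linepath A B (Im z))"
    using glue_side [OF assms(1,3)] by metis
  moreover have "linepath A B (Im z) \<in> K"
    using AB assms(2) convexD_alt [OF convex_K] by (auto simp: linepath_def rectangle_def)
  ultimately show "fst (glue g a (j, z)) = 0" "snd (glue g a (j, z)) \<in> K" by auto
qed

text \<open>Since the gluing is affine along a side, a segment there is literally a segment in K
  with the same parametrisation.\<close>

lemma bridge_side_spoke:
  assumes "j \<in> J" "p \<in> rectangle" "q \<in> rectangle" "Re p = Re q" "Re p = 0 \<or> Re p = 1" "c \<in> K"
  shows "mod2_homologous X (segment_chain (\<lambda>z. \<iota> (glue g a (j, z))) p q)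
           (spoke c (snd (glue g a (j, q))) - spoke c (snd (glue g a (j, p))))"
proof -
  obtain A B where AB: "A \<in> K" "B \<in> K" "\<And>w. Re w = Re p \<Longrightarrow> glue g a (j, w) = (0, linepath A B (Im w))"
    using glue_side [OF assms(1,5)] by metis
  have "segment_chain (\<lambda>z. \<iota> (glue g a (j, z))) p q =
        spoke (snd (glue g a (j, p))) (snd (glue g a (j, q)))"
    unfolding segment_chain_def
  proof (intro arg_cong [where f = frag_of] path_simplex_cong)
    fix s :: real
    have "Re (linepath p q s) = Re p"
      using assms(4) by (simp add: linepath_def algebra_simps)
    moreover have "linepath A B (Im (linepath p q s)) = linepath (linepath A B (Im p)) (linepath A B (Im q)) s"
      by (simp add: linepath_def algebra_simps)
    ultimately show "\<iota> (glue g a (j, linepath p q s)) =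
        \<iota> (0, linepath (snd (glue g a (j, p))) (snd (glue g a (j, q))) s)"
      using AB(3) [of p] AB(3) [of q] AB(3) [of "linepath p q s"] assms(4) by simp
  qed
  then show ?thesis
    using segment_chain_diff [OF convex_K continuous_plane assms(6)] glue_side_K assms by simp
qed

lemma pathin_bridge_curve:
  assumes "j \<in> J"
  shows "pathin X (\<lambda>s. \<iota> (bridge_curve g a j s))"
proof -
  have 1: "continuous_map (top_of_set {t \<in> {0..1}. t \<le> 1 / 2}) X
      (\<lambda>t. \<iota> (glue g a (j, Complex (2 * t) (1/2))))"
  proof -
    have "continuous_map (top_of_set {t \<in> {0..1}. t \<le> 1 / 2}) (top_of_set rectangle) (\<lambda>t. Complex (2 * t) (1/2))"
      by (auto simp: rectangle_def Complex_eq intro!: continuous_intros)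
    then show ?thesis
      using continuous_map_compose [OF _ continuous_bridge [OF assms]] unfolding o_def by blast
  qed
  have K: "side_mid j 1 \<in> K" "side_mid j 0 \<in> K"
    using assms by (intro glue_side_K; auto simp: rectangle_def)+
  have 2: "continuous_map (top_of_set {t \<in> {0..1}. 1 / 2 \<le> t}) X
      (\<lambda>t. \<iota> (0, linepath (side_mid j 1) (side_mid j 0) (2 * t - 1)))"
  proof -
    have "continuous_map (top_of_set {t \<in> {0..1}. 1 / 2 \<le> t}) (top_of_set K)
        (\<lambda>t. linepath (side_mid j 1) (side_mid j 0) (2 * t - 1))"
    proof -
      have "linepath (side_mid j 1) (side_mid j 0) (2 * t - 1) \<in> K" if "1 / 2 \<le> t" "t \<le> 1" for t
        unfolding linepath_def using that by (intro convexD_alt [OF convex_K K]) auto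
      then show ?thesis by (auto simp: linepath_def intro!: continuous_intros)
    qed
    then show ?thesis
      using continuous_map_compose [OF _ continuous_plane] unfolding o_def by blast
  qed
  have "continuous_map (top_of_set {0..1}) X (\<lambda>t. if t \<le> 1 / 2 then \<iota> (glue g a (j, Complex (2 * t) (1/2)))
       else \<iota> (0, linepath (side_mid j 1) (side_mid j 0) (2 * t - 1)))"
  proof (rule continuous_map_cases_le)
    show "continuous_map (subtopology (top_of_set {0..1}) {x \<in> topspace (top_of_set {0..1}). x \<le> 1 / 2}) X
        (\<lambda>t. \<iota> (glue g a (j, Complex (2 * t) (1/2))))"
      using 1 unfolding subtopology_subtopology
      by (elim back_subst [where P = "\<lambda>S. continuous_map (top_of_set S) X _"]) auto
    show "continuous_map (subtopology (top_of_set {0..1}) {x \<in> topspace (top_of_set {0..1}). 1 / 2 \<le> x}) X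
        (\<lambda>t. \<iota> (0, linepath (side_mid j 1) (side_mid j 0) (2 * t - 1)))"
      using 2 unfolding subtopology_subtopology
      by (elim back_subst [where P = "\<lambda>S. continuous_map (top_of_set S) X _"]) auto
    have "glue g a (j, Complex 1 (1/2)) = (0, side_mid j 1)"
      using glue_side_K(1) [OF assms, of "Complex 1 (1/2)"] by (simp add: rectangle_def prod_eq_iff)
    then show "\<iota> (glue g a (j, Complex (2 * x) (1/2))) =
        \<iota> (0, linepath (side_mid j 1) (side_mid j 0) (2 * x - 1))" if "x = 1 / 2" for x
      unfolding that by (simp add: linepath_def)
  qed (auto simp: continuous_map_from_subtopology)
  moreover have "(\<lambda>s. \<iota> (bridge_curve g a j s)) =
      (\<lambda>t. if t \<le> 1 / 2 then \<iota> (glue g a (j, Complex (2 * t) (1/2)))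
       else \<iota> (0, linepath (side_mid j 1) (side_mid j 0) (2 * t - 1)))"
    by (auto simp: bridge_curve_def)
  ultimately show ?thesis unfolding pathin_def by simp
qed

lemma bridge_curve_closed:
  assumes "j \<in> J"
  shows "bridge_curve g a j 0 = bridge_curve g a j 1"
  using glue_side_K(1) [OF assms, of "Complex 0 (1/2)"]
  by (simp add: bridge_curve_def rectangle_def linepath_def prod_eq_iff)

lemma bridge_chain_cycle: "j \<in> J \<Longrightarrow> bridge_chain j \<in> mod2_cycles 1 X"
  by (intro closed_path_cycle pathin_bridge_curve arg_cong [where f = \<iota>] bridge_curve_closed)

text \<open>The basis curve is the middle line of the bridge followed by the return segment in R_0.
  The lemma is later read from right to left, to trade the middle line for the basis curve.\<close>

lemma bridge_chain_decomposition:
  assumes j: "j \<in> J" and c: "c \<in> K"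
  shows "mod2_homologous X (bridge_chain j)
    (segment_chain (\<lambda>z. \<iota> (glue g a (j, z))) (Complex 0 (1/2)) (Complex 1 (1/2))
      + spoke c (side_mid j 0) - spoke c (side_mid j 1))"
proof -
  let ?B = "\<lambda>s. \<iota> (bridge_curve g a j s)"
  have K: "side_mid j 1 \<in> K" "side_mid j 0 \<in> K"
    using j by (intro glue_side_K; auto simp: rectangle_def)+
  have "bridge_chain j = segment_chain ?B 0 1"
    by (simp add: segment_chain_def linepath_def)
  also have "mod2_homologous X \<dots> (segment_chain ?B 0 (1/2) + segment_chain ?B (1/2) 1)"
    using pathin_bridge_curve [OF j] unfolding pathin_def
    by (intro mod2_homologous_sym [OF segment_chain_triangle [of "{0..1}"]]) auto
  also have "segment_chain ?B 0 (1/2) =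
      segment_chain (\<lambda>z. \<iota> (glue g a (j, z))) (Complex 0 (1/2)) (Complex 1 (1/2))"
    unfolding segment_chain_def
  proof (intro arg_cong [where f = frag_of] path_simplex_cong)
    fix s :: real assume "0 \<le> s" "s \<le> 1"
    moreover have "linepath (Complex 0 (1/2)) (Complex 1 (1/2)) s = Complex s (1/2)"
      by (simp add: linepath_def complex_eq_iff algebra_simps)
    ultimately show "\<iota> (bridge_curve g a j (linepath 0 (1 / 2) s)) =
        \<iota> (glue g a (j, linepath (Complex 0 (1/2)) (Complex 1 (1/2)) s))"
      by (simp add: bridge_curve_def linepath_def [of "0::real"])
  qed
  also have "segment_chain ?B (1/2) 1 = spoke (side_mid j 1) (side_mid j 0)"
    unfolding segment_chain_def
  proof (intro arg_cong [where f = frag_of] path_simplex_cong)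
    fix s :: real assume s: "0 \<le> s" "s \<le> 1"
    show "\<iota> (bridge_curve g a j (linepath (1 / 2) 1 s)) = \<iota> (0, linepath (side_mid j 1) (side_mid j 0) s)"
    \<comment> \<open>Here s = 0 is the parameter 1/2, which \<open>bridge_curve\<close> evaluates
      on the bridge; the two branches agree because that point lies on a glued side.\<close>
    proof (cases "s = 0")
      case True
      moreover have "glue g a (j, Complex 1 (1/2)) = (0, side_mid j 1)"
        using glue_side_K(1) [OF j, of "Complex 1 (1/2)"] by (simp add: rectangle_def prod_eq_iff)
      ultimately show ?thesis by (simp add: bridge_curve_def linepath_def)
    next
      case False
      have "linepath (1 / 2) 1 s = (1 + s) / 2" by (simp add: linepath_def field_simps)
      then have "2 * linepath (1 / 2) 1 s - 1 = s" "\<not> linepath (1 / 2) 1 s \<le> (1 / 2 :: real)"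
        using s False by (auto simp: field_simps)
      then show ?thesis unfolding bridge_curve_def by simp
    qed
  qed
  also have "mod2_homologous X
      (segment_chain (\<lambda>z. \<iota> (glue g a (j, z))) (Complex 0 (1/2)) (Complex 1 (1/2)) + \<dots>)
      (segment_chain (\<lambda>z. \<iota> (glue g a (j, z))) (Complex 0 (1/2)) (Complex 1 (1/2)) +
       (spoke c (side_mid j 0) - spoke c (side_mid j 1)))"
    using K c by (intro mod2_homologous_add mod2_homologous_refl segment_chain_diff [OF convex_K continuous_plane])
  finally show ?thesis by (simp add: algebra_simps)
qed

text \<open>Inside the convex rectangle the segment may be rerouted along a side to its middle,
  along the middle line and along the other side. The parts on the sides are spokes, and the spokes
  to the side middles are absorbed by the basis curve.\<close>

lemma bridge_crossing_forward:
  assumes j: "j \<in> J" and c: "c \<in> K" and pq: "p \<in> rectangle" "q \<in> rectangle" "Re p = 0" "Re q = 1"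
  shows "mod2_homologous X (segment_chain (\<lambda>z. \<iota> (glue g a (j, z))) p q)
           (bridge_chain j + spoke c (snd (glue g a (j, q))) - spoke c (snd (glue g a (j, p))))"
proof -
  let ?F = "\<lambda>z. \<iota> (glue g a (j, z))" and ?m0 = "Complex 0 (1/2)" and ?m1 = "Complex 1 (1/2)"
  let ?S = "\<lambda>z. spoke c (snd (glue g a (j, z)))"
  note F = convex_rectangle continuous_bridge [OF j]
  have m: "?m0 \<in> rectangle" "?m1 \<in> rectangle" by (auto simp: rectangle_def)
  have "mod2_homologous X (segment_chain ?F p q) (segment_chain ?F ?m0 q - segment_chain ?F ?m0 p)"
    using segment_chain_diff [OF F] m pq by blast
  also have "mod2_homologous X \<dots> (segment_chain ?F ?m0 ?m1 + segment_chain ?F ?m1 q - segment_chain ?F ?m0 p)"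
    using mod2_homologous_sym [OF segment_chain_triangle [OF F]] m pq
    by (intro mod2_homologous_diff) auto
  also have "mod2_homologous X \<dots> (segment_chain ?F ?m0 ?m1 + (?S q - ?S ?m1) - (?S p - ?S ?m0))"
    using m pq by (intro mod2_homologous_diff mod2_homologous_add mod2_homologous_refl bridge_side_spoke [OF j] c) auto
  also have "\<dots> = (segment_chain ?F ?m0 ?m1 + ?S ?m0 - ?S ?m1) + (?S q - ?S p)"
    by (simp add: algebra_simps)
  also have "mod2_homologous X \<dots> (bridge_chain j + (?S q - ?S p))"
    by (intro mod2_homologous_add mod2_homologous_refl mod2_homologous_sym [OF bridge_chain_decomposition] j c)
  finally show ?thesis by (simp add: algebra_simps)
qed

lemma singular_chain_spoke: "\<lbrakk>p \<in> K; q \<in> K\<rbrakk> \<Longrightarrow> singular_chain 1 X (spoke p q)"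
  using singular_chain_segment [OF convex_K continuous_plane] .

lemma spoke_diff_swap:
  assumes "c \<in> K" "p \<in> K" "q \<in> K"
  shows "mod2_homologous X (spoke c p - spoke c q) (spoke c q - spoke c p)"
proof -
  have "singular_chain 1 X (spoke c p - spoke c q)"
    using assms by (intro singular_chain_diff singular_chain_spoke)
  then have "mod2_homologous X (- (spoke c p - spoke c q)) (spoke c p - spoke c q)"
    by (rule mod2_homologous_uminus)
  then show ?thesis using mod2_homologous_sym by simp
qed

text \<open>A crossing in the other direction is a reversed segment, and modulo 2 both the segment
  and the difference of spokes can be reversed.\<close>

lemma bridge_crossing:
  assumes j: "j \<in> J" and c: "c \<in> K" and pq: "p \<in> rectangle" "q \<in> rectangle" "{Re p, Re q} = {0, 1}"
  shows "mod2_homologous X (segment_chain (\<lambda>z. \<iota> (glue g a (j, z))) p q)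
           (bridge_chain j + spoke c (snd (glue g a (j, q))) - spoke c (snd (glue g a (j, p))))"
proof -
  consider "Re p = 0" "Re q = 1" | "Re p = 1" "Re q = 0" using pq(3) by (auto simp: doubleton_eq_iff)
  then show ?thesis
  proof cases
    case 1
    then show ?thesis using assms by (intro bridge_crossing_forward)
  next
    case 2
    let ?F = "\<lambda>z. \<iota> (glue g a (j, z))" and ?S = "\<lambda>z. spoke c (snd (glue g a (j, z)))"
    have "mod2_homologous X (segment_chain ?F p q) (segment_chain ?F q p)"
      using pq by (intro segment_chain_swap [OF convex_rectangle continuous_bridge [OF j]])
    also have "mod2_homologous X \<dots> (bridge_chain j + ?S p - ?S q)"
      using 2 assms by (intro bridge_crossing_forward)
    also have "\<dots> = bridge_chain j + (?S p - ?S q)" by simp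
    also have "mod2_homologous X \<dots> (bridge_chain j + (?S q - ?S p))"
      using 2 pq j c by (intro mod2_homologous_add mod2_homologous_refl spoke_diff_swap glue_side_K) auto
    finally show ?thesis by (simp add: algebra_simps)
  qed
qed

end

text \<open>\<open>\<kappa> i\<close> is the bridge crossed by the \<open>i\<close>-th piece, or \<open>0\<close> for a piece in \<open>R\<^sub>0\<close>.\<close>

definition highway_subdivision ::
    "nat \<Rightarrow> (nat \<Rightarrow> complex) \<Rightarrow> (real \<Rightarrow> nat \<times> complex) \<Rightarrow> nat \<Rightarrow> (nat \<Rightarrow> real) \<Rightarrow> (nat \<Rightarrow> nat) \<Rightarrow> bool" where
  "highway_subdivision g a \<gamma> n t \<kappa> \<longleftrightarrow> t 0 = 0 \<and> t n = 1 \<and> (\<forall>i<n. t i < t (Suc i)) \<and>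
     (\<forall>i<n. if \<kappa> i = 0 then polygon_piece g a \<gamma> (t i) (t (Suc i))
            else \<kappa> i \<in> {1..2 * g} \<and> bridge_piece g a (\<kappa> i) \<gamma> (t i) (t (Suc i)))"

lemma highway_curve_subdivision:
  assumes "highway_curve g a \<gamma>"
  shows "\<exists>n t \<kappa>. highway_subdivision g a \<gamma> n t \<kappa>"
proof -
  obtain n t where t: "t 0 = 0" "t n = 1" "\<forall>i<n. t i < t (Suc i)"
    and "\<forall>i<n. polygon_piece g a \<gamma> (t i) (t (Suc i)) \<or>
               (\<exists>j\<in>{1..2 * g}. bridge_piece g a j \<gamma> (t i) (t (Suc i)))"
    using assms unfolding highway_curve_def by blast
  then have "\<forall>i. \<exists>j. i < n \<longrightarrow> (if j = 0 then polygon_piece g a \<gamma> (t i) (t (Suc i))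
            else j \<in> {1..2 * g} \<and> bridge_piece g a j \<gamma> (t i) (t (Suc i)))"
    by (metis atLeastAtMost_iff not_one_le_zero)
  then obtain \<kappa> where "\<forall>i<n. if \<kappa> i = 0 then polygon_piece g a \<gamma> (t i) (t (Suc i))
            else \<kappa> i \<in> {1..2 * g} \<and> bridge_piece g a (\<kappa> i) \<gamma> (t i) (t (Suc i))"
    by metis
  then show ?thesis using t unfolding highway_subdivision_def by blast
qed

lemma highway_subdivision_mono:
  assumes "highway_subdivision g a \<gamma> n t \<kappa>" "i \<le> j" "j \<le> n"
  shows "t i \<le> t j"
  using assms(2,3)
proof (induction j rule: dec_induct)
  case (step m)
  moreover have "t m < t (Suc m)"
    using assms(1) step.prems by (simp add: highway_subdivision_def)
  ultimately show ?case by simp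
qed simp

lemma highway_subdivision_range:
  assumes "highway_subdivision g a \<gamma> n t \<kappa>" "i \<le> n"
  shows "0 \<le> t i" "t i \<le> 1"
  using highway_subdivision_mono [OF assms(1), of 0 i] highway_subdivision_mono [OF assms(1), of i n] assms
  by (auto simp: highway_subdivision_def)

section \<open>Curves composed of pieces\<close>

context highway_part
begin

text \<open>Each piece runs in a convex set, K or the rectangle, and is straightened there. Both
  kinds of piece then give the same shape: a possible bridge term plus the difference of the spokes
  at the ends.\<close>

lemma highway_piece_homologous:
  assumes uv: "0 \<le> u" "u < v" "v \<le> 1"
    and piece: "if j = 0 then polygon_piece g a \<gamma> u v else bridge_piece g a j \<gamma> u v"
    and j: "j \<in> insert 0 J" and K: "\<And>s. \<lbrakk>s \<in> {u..v}; fst (\<gamma> s) = 0\<rbrakk> \<Longrightarrow> snd (\<gamma> s) \<in> K" and c: "c \<in> K"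
  shows "mod2_homologous X (segment_chain (\<lambda>s. \<iota> (\<gamma> s)) u v)
          ((if j = 0 then 0 else bridge_chain j) + spoke c (snd (\<gamma> v)) - spoke c (snd (\<gamma> u)))"
proof -
  have lin0: "linepath u v ` {0..1} \<subseteq> {u..v}"
    using uv by (simp add: linepath_image_01 closed_segment_eq_real_ivl)
  then have lin: "u \<le> linepath u v s" "linepath u v s \<le> v" if "0 \<le> s" "s \<le> 1" for s
    using that by (force simp: image_subset_iff)+
  have seg: "mod2_homologous X (segment_chain (\<lambda>s. \<iota> (\<gamma> s)) u v) (segment_chain F (f u) (f v))"
    if f: "continuous_on {u..v} f" "f ` {u..v} \<subseteq> C" and C: "convex C" "continuous_map (top_of_set C) X F"
      and eq: "\<And>s. s \<in> {u..v} \<Longrightarrow> \<iota> (\<gamma> s) = F (f s)" for f :: "real \<Rightarrow> complex" and C F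
  proof -
    have "segment_chain (\<lambda>s. \<iota> (\<gamma> s)) u v = frag_of (path_simplex (\<lambda>s. F (f (linepath u v s))))"
      unfolding segment_chain_def using lin
      by (intro arg_cong [where f = frag_of] path_simplex_cong eq) auto
    moreover have "mod2_homologous X \<dots> (segment_chain F (f (linepath u v 0)) (f (linepath u v 1)))"
    proof (rule path_homologous_segment [OF C])
      show "continuous_on {0..1} (\<lambda>s. f (linepath u v s))"
        using lin by (intro continuous_on_compose2 [OF f(1)]) (auto intro: continuous_on_linepath)
      show "(\<lambda>s. f (linepath u v s)) ` {0..1} \<subseteq> C" using lin f(2) by auto
    qed
    ultimately show ?thesis by (simp add: linepath_def)
  qed
  show ?thesis
  proof (cases "j = 0")
    case True
    then obtain f where f: "continuous_on {u..v} f" "\<forall>s\<in>{u..v}. \<gamma> s = (0, f s)"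
      using piece by (auto simp: polygon_piece_def)
    have fK: "f ` {u..v} \<subseteq> K" using K f(2) by auto
    have "mod2_homologous X (segment_chain (\<lambda>s. \<iota> (\<gamma> s)) u v) (spoke (f u) (f v))"
      using f fK by (intro seg [OF _ _ convex_K continuous_plane]) auto
    also have "mod2_homologous X \<dots> (spoke c (f v) - spoke c (f u))"
      using fK uv c by (intro segment_chain_diff [OF convex_K continuous_plane]) auto
    finally show ?thesis using True f(2) uv by simp
  next
    case False
    then obtain f where f: "continuous_on {u..v} f" "f ` {u..v} = closed_segment (f u) (f v)"
        "f u \<in> rectangle" "f v \<in> rectangle" "{Re (f u), Re (f v)} = {0, 1}"
        "\<forall>s\<in>{u..v}. \<gamma> s = glue g a (j, f s)"
      using piece by (auto simp: bridge_piece_def)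
    have jJ: "j \<in> J" using False j by auto
    have "mod2_homologous X (segment_chain (\<lambda>s. \<iota> (\<gamma> s)) u v)
        (segment_chain (\<lambda>z. \<iota> (glue g a (j, z))) (f u) (f v))"
      using f closed_segment_subset [OF f(3,4) convex_rectangle]
      by (intro seg [OF _ _ convex_rectangle continuous_bridge [OF jJ]]) auto
    also have "mod2_homologous X \<dots>
        (bridge_chain j + spoke c (snd (glue g a (j, f v))) - spoke c (snd (glue g a (j, f u))))"
      using f jJ c by (intro bridge_crossing)
    finally show ?thesis using False f(6) uv by simp
  qed
qed

text \<open>Induction on the number of pieces traversed: the spoke at every inner division point
  occurs with both signs and cancels.\<close>

lemma highway_curve_homologous:
  assumes sub: "highway_subdivision g a \<gamma> n t \<kappa>" and path: "pathin X (\<lambda>s. \<iota> (\<gamma> s))"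
    and J: "\<And>i. i < n \<Longrightarrow> \<kappa> i \<in> insert 0 J"
    and K: "\<And>s. \<lbrakk>s \<in> {0..1}; fst (\<gamma> s) = 0\<rbrakk> \<Longrightarrow> snd (\<gamma> s) \<in> K" and c: "c \<in> K"
  shows "mod2_homologous X (frag_of (path_simplex (\<lambda>s. \<iota> (\<gamma> s))))
          ((\<Sum>i<n. if \<kappa> i = 0 then 0 else bridge_chain (\<kappa> i)) + spoke c (snd (\<gamma> 1)) - spoke c (snd (\<gamma> 0)))"
proof -
  let ?G = "\<lambda>s. \<iota> (\<gamma> s)" and ?S = "\<lambda>s. spoke c (snd (\<gamma> s))"
    and ?b = "\<lambda>i. if \<kappa> i = 0 then 0 else bridge_chain (\<kappa> i)"
  have G: "convex {0..1::real}" "continuous_map (top_of_set {0..1}) X ?G"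
    using path by (auto simp: pathin_def)
  have t: "t 0 = 0" "t n = 1" using sub by (auto simp: highway_subdivision_def)
  have "mod2_homologous X (segment_chain ?G 0 (t m)) ((\<Sum>i<m. ?b i) + ?S (t m) - ?S 0)" if "m \<le> n" for m
    using that
  proof (induction m)
    case 0
    then show ?case using segment_chain_same [OF G, of 0] t by simp
  next
    case (Suc m)
    have r: "0 \<le> t m" "t m \<le> 1" "0 \<le> t (Suc m)" "t (Suc m) \<le> 1"
      using highway_subdivision_range [OF sub] Suc.prems by auto
    have "mod2_homologous X (segment_chain ?G 0 (t (Suc m)))
       (segment_chain ?G 0 (t m) + segment_chain ?G (t m) (t (Suc m)))"
      using r by (intro mod2_homologous_sym [OF segment_chain_triangle [OF G]]) auto
    also have "mod2_homologous X \<dots> (((\<Sum>i<m. ?b i) + ?S (t m) - ?S 0) + (?b m + ?S (t (Suc m)) - ?S (t m)))"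
    proof (intro mod2_homologous_add)
      show "mod2_homologous X (segment_chain ?G (t m) (t (Suc m))) (?b m + ?S (t (Suc m)) - ?S (t m))"
        using sub r J [of m] K Suc.prems c
        by (intro highway_piece_homologous) (auto simp: highway_subdivision_def)
    qed (use Suc in auto)
    also have "((\<Sum>i<m. ?b i) + ?S (t m) - ?S 0) + (?b m + ?S (t (Suc m)) - ?S (t m)) =
        (\<Sum>i<Suc m. ?b i) + ?S (t (Suc m)) - ?S 0"
      by (simp add: algebra_simps)
    finally show ?case .
  qed
  from this [of n] show ?thesis using t by (simp add: segment_chain_def linepath_def)
qed

end

subsection \<open>Geometry of the octagon\<close>

text \<open>Twice the signed area of the triangle p, q, r: positive if r is to the left of the line
  from p to q, negative if p, q, r are in clockwise position.\<close>

definition orient :: "complex \<Rightarrow> complex \<Rightarrow> complex \<Rightarrow> real" where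
  "orient p q r = Im (cnj (q - p) * (r - p))"

text \<open>The vector \<open>\<i> * (q - p)\<close> is normal to the line pq, so
  \<open>orient p q\<close> is an affine function and facts on half-spaces apply to it.\<close>

lemma orient_inner: "orient p q r = (\<i> * (q - p)) \<bullet> r - (\<i> * (q - p)) \<bullet> p"
  by (simp add: orient_def inner_complex_def algebra_simps)

lemma orient_cyclic: "orient p q r = orient q r p"
  by (simp add: orient_def algebra_simps)

lemma orient_degenerate [simp]: "orient p p q = 0" "orient p q p = 0" "orient p q q = 0"
  by (simp_all add: orient_def algebra_simps)

lemma continuous_on_orient [continuous_intros]: "continuous_on S (orient p q)"
  unfolding orient_def by (intro continuous_intros)

lemma orient_linepath: "orient p q (linepath x y t) = (1 - t) * orient p q x + t * orient p q y"
  by (simp add: orient_inner linepath_def inner_simps algebra_simps)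

lemma convex_orient:
  "convex {z. orient p q z \<ge> 0}" "convex {z. orient p q z \<le> 0}"
  "convex {z. orient p q z > 0}" "convex {z. orient p q z < 0}"
  unfolding orient_inner diff_ge_0_iff_ge diff_le_0_iff_le diff_gt_0_iff_gt diff_less_0_iff_less
  by (intro convex_halfspace_ge convex_halfspace_le convex_halfspace_gt convex_halfspace_lt)+

lemma interior_orient:
  assumes "p \<noteq> q"
  shows "interior {z. orient p q z \<le> 0} = {z. orient p q z < 0}"
    "interior {z. orient p q z \<ge> 0} = {z. orient p q z > 0}"
  using interior_halfspace_le [of "\<i> * (q - p)" "(\<i> * (q - p)) \<bullet> p"]
    interior_halfspace_ge [of "\<i> * (q - p)" "(\<i> * (q - p)) \<bullet> p"] assms
  by (simp_all add: orient_inner algebra_simps)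

text \<open>The quotient of z - p by q - p is real if the three points are collinear, and it is then
  the parameter of z.\<close>

lemma orient_zero_line:
  assumes "orient p q z = 0" "p \<noteq> q"
  obtains t where "z = linepath p q t"
proof -
  let ?w = "(z - p) / (q - p)"
  have "Im ?w = 0"
    using assms by (simp add: orient_def Im_divide algebra_simps)
  then have "?w = of_real (Re ?w)" by (simp add: complex_eq_iff)
  then have "z - p = of_real (Re ?w) * (q - p)"
    using assms(2) by (metis eq_iff_diff_eq_0 nonzero_divide_eq_eq)
  then have "z = linepath p q (Re ?w)"
    by (simp add: linepath_def scaleR_conv_of_real algebra_simps)
  then show ?thesis by (rule that)
qed

lemma orient_nonzero_not_collinear:
  assumes "orient p q r \<noteq> 0"
  shows "\<not> collinear {p, q, r}"
proof
  assume "collinear {p, q, r}"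
  then obtain u where u: "\<forall>x\<in>{p, q, r}. \<forall>y\<in>{p, q, r}. \<exists>c. x - y = c *\<^sub>R u"
    unfolding collinear_def by blast
  then obtain c d where "q - p = c *\<^sub>R u" "r - p = d *\<^sub>R u" by blast
  then have "orient p q r = 0" by (simp add: orient_def algebra_simps)
  then show False using assms by simp
qed

text \<open>The point is u b1 + u b2 + v b3 + v b4 with positive weights. The first three terms give
  a point inside a nondegenerate triangle, and moving it towards b4 without reaching b4 stays in the
  interior of K.\<close>

lemma convex_midpoints_interior:
  assumes K: "convex K" and b: "b1 \<in> K" "b2 \<in> K" "b3 \<in> K" "b4 \<in> K" and o: "orient b1 b2 b3 \<noteq> 0"
    and t: "0 < t" "t < 1"
  shows "linepath (midpoint b1 b2) (midpoint b3 b4) t \<in> interior K"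
proof -
  define u v where "u = (1 - t) / 2" and "v = t / 2"
  have uv: "0 < u" "0 < v" "2 * u + 2 * v = 1" using t by (auto simp: u_def v_def field_simps)
  \<comment> \<open>The weights u, u, v are normalised by their sum 2u + v, which returns below as
    the shrinking factor.\<close>
  define w where "w = (u / (2 * u + v)) *\<^sub>R b1 + (u / (2 * u + v)) *\<^sub>R b2 + (v / (2 * u + v)) *\<^sub>R b3"
  have "w \<in> interior (convex hull {b1, b2, b3})"
    unfolding interior_convex_hull_3_minimal [OF orient_nonzero_not_collinear [OF o] DIM_complex] mem_Collect_eq w_def
    using uv by (intro exI conjI) (auto simp flip: add_divide_distrib)
  moreover have "convex hull {b1, b2, b3} \<subseteq> K" using b K by (intro hull_minimal) auto
  ultimately have "w \<in> interior K" using interior_mono by blast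
  moreover have "linepath (midpoint b1 b2) (midpoint b3 b4) t = b4 - (2 * u + v) *\<^sub>R (b4 - w)"
  proof -
    have "(2 * u + v) *\<^sub>R w = u *\<^sub>R b1 + u *\<^sub>R b2 + v *\<^sub>R b3"
      using uv by (simp add: w_def scaleR_add_right)
    moreover have "b4 = (2 * u + v) *\<^sub>R b4 + v *\<^sub>R b4"
    proof -
      have "(2 * u + v) + v = 1" using uv(3) by linarith
      then show ?thesis by (metis scaleR_add_left scaleR_one)
    qed
    moreover have "linepath (midpoint b1 b2) (midpoint b3 b4) t = u *\<^sub>R b1 + u *\<^sub>R b2 + v *\<^sub>R b3 + v *\<^sub>R b4"
      by (simp add: linepath_def midpoint_def u_def v_def scaleR_add_right)
    ultimately show ?thesis by (simp add: scaleR_diff_right algebra_simps)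
  qed
  ultimately show ?thesis
    using mem_interior_convex_shrink [OF K, of w b4 "2 * u + v"] b uv by simp
qed

text \<open>The midpoints of the first and third side and those of the second and fourth side of a chain of
  four sides of a strictly convex polygon separate each other.\<close>

lemma midpoints_cross:
  assumes "orient b1 b2 b3 < 0" "orient b1 b2 b4 < 0" "orient b1 b2 b5 < 0" "orient b1 b3 b4 < 0"
    "orient b1 b3 b5 < 0" "orient b1 b4 b5 < 0" "orient b2 b3 b4 < 0" "orient b2 b3 b5 < 0"
    "orient b2 b4 b5 < 0" "orient b3 b4 b5 < 0"
  shows "orient (midpoint b1 b2) (midpoint b4 b3) (midpoint b2 b3) > 0"
    "orient (midpoint b1 b2) (midpoint b4 b3) (midpoint b5 b4) < 0"
    "orient (midpoint b2 b3) (midpoint b5 b4) (midpoint b1 b2) < 0"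
    "orient (midpoint b2 b3) (midpoint b5 b4) (midpoint b4 b3) > 0"
proof -
  \<comment> \<open>\<open>orient\<close> is affine in each argument separately, so at three
    midpoints it is the mean over the eight choices of vertices. In each of the four claims the
    nonzero terms all have the same sign.\<close>
  have m: "orient (midpoint p q) (midpoint r s) (midpoint t u) =
      (orient p r t + orient p r u + orient p s t + orient p s u
        + orient q r t + orient q r u + orient q s t + orient q s u) / 8" for p q r s t u
    by (simp add: orient_def midpoint_def scaleR_conv_of_real field_simps)
  have o: "orient y z x < 0" "orient z x y < 0" "orient x z y > 0" "orient y x z > 0" "orient z y x > 0"
    if "orient x y z < 0" for x y z
    using that by (simp_all add: orient_def algebra_simps)
  have "orient (midpoint b1 b2) (midpoint b4 b3) (midpoint b2 b3) > 0 \<and>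
    orient (midpoint b1 b2) (midpoint b4 b3) (midpoint b5 b4) < 0 \<and>
    orient (midpoint b2 b3) (midpoint b5 b4) (midpoint b1 b2) < 0 \<and>
    orient (midpoint b2 b3) (midpoint b5 b4) (midpoint b4 b3) > 0"
    using assms assms [THEN o(3)] assms [THEN o(4)] assms [THEN o(5)] assms [THEN o(1)] assms [THEN o(2)]
    unfolding m orient_degenerate zero_less_divide_iff divide_less_0_iff by - (intro conjI; simp)
  then show "orient (midpoint b1 b2) (midpoint b4 b3) (midpoint b2 b3) > 0"
    "orient (midpoint b1 b2) (midpoint b4 b3) (midpoint b5 b4) < 0"
    "orient (midpoint b2 b3) (midpoint b5 b4) (midpoint b1 b2) < 0"
    "orient (midpoint b2 b3) (midpoint b5 b4) (midpoint b4 b3) > 0"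
    by simp_all
qed

locale octagon =
  fixes a :: "nat \<Rightarrow> complex"
  assumes clockwise: "clockwise_convex 8 a"
begin

lemma orient_vertices: "\<lbrakk>1 \<le> i; i < j; j < l; l \<le> 8\<rbrakk> \<Longrightarrow> orient (a i) (a j) (a l) < 0"
  using clockwise unfolding clockwise_convex_def orient_def by blast

abbreviation P :: "complex set" where "P \<equiv> polygon 2 a"

text \<open>Sign convention: positive at the vertices 2, 3, 4, which belong to bridges 1 and 2,
  negative at 6, 7, 8, which belong to bridges 3 and 4, and zero on the chord.\<close>

definition side :: "complex \<Rightarrow> real" where "side z = orient (a 1) (a 5) z"

definition half1 :: "complex set" where "half1 = {z \<in> P. side z \<ge> 0}"

definition half2 :: "complex set" where "half2 = {z \<in> P. side z \<le> 0}"

lemma convex_polygon: "convex P"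
  by (simp add: polygon_def)

lemma vertex_in_polygon: "\<lbrakk>1 \<le> i; i \<le> 8\<rbrakk> \<Longrightarrow> a i \<in> P"
  unfolding polygon_def by (intro hull_inc) auto

lemma corner_in_polygon: "corner 2 a m \<in> P"
  unfolding corner_def by (intro vertex_in_polygon) auto

lemma convex_half: "convex half1" "convex half2"
proof -
  have "half1 = P \<inter> {z. orient (a 1) (a 5) z \<ge> 0}" "half2 = P \<inter> {z. orient (a 1) (a 5) z \<le> 0}"
    by (auto simp: half1_def half2_def side_def)
  then show "convex half1" "convex half2" using convex_Int convex_polygon convex_orient by metis+
qed

lemma side_vertex: "side (a 1) = 0" "side (a 5) = 0"
  by (simp_all add: side_def)

lemmas side_vertex' [simp] = side_vertex [unfolded One_nat_def]

lemma side_pos: "\<lbrakk>1 < i; i < 5\<rbrakk> \<Longrightarrow> side (a i) > 0"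
  using orient_vertices [of 1 i 5] unfolding side_def by (simp add: orient_def algebra_simps)

lemma side_neg: "\<lbrakk>5 < i; i \<le> 8\<rbrakk> \<Longrightarrow> side (a i) < 0"
  using orient_vertices [of 1 5 i] unfolding side_def by simp

lemma vertex_in_half1: "\<lbrakk>1 \<le> i; i \<le> 5\<rbrakk> \<Longrightarrow> a i \<in> half1"
  using side_pos [of i] vertex_in_polygon [of i] by (cases "i = 1 \<or> i = 5") (auto simp: half1_def)

lemma vertex_in_half2: "\<lbrakk>5 \<le> i; i \<le> 8\<rbrakk> \<Longrightarrow> a i \<in> half2" "a 1 \<in> half2"
  using side_neg [of i] vertex_in_polygon [of i] vertex_in_polygon [of 1]
  by (cases "i = 5"; auto simp: half2_def)+

lemma polygon_halfplane:
  assumes "\<And>i. \<lbrakk>1 \<le> i; i \<le> 8\<rbrakk> \<Longrightarrow> orient p q (a i) \<le> 0" "z \<in> P"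
  shows "orient p q z \<le> 0"
proof -
  have "P \<subseteq> {z. orient p q z \<le> 0}"
    unfolding polygon_def using assms(1) by (intro hull_minimal convex_orient) auto
  then show ?thesis using assms(2) by blast
qed

lemma vertex_halfplane:
  assumes "1 \<le> m" "m \<le> 8" "1 \<le> i" "i \<le> 8"
  shows "orient (corner 2 a m) (corner 2 a (m + 1)) (a i) \<le> 0"
\<comment> \<open>The last side runs from vertex 8 back to vertex 1, so its triples must be rotated
  into increasing order.\<close>
proof (cases "m = 8")
  case True
  consider "i = 1" | "i = 8" | "1 < i" "i < 8" using assms by linarith
  then show ?thesis
  proof cases
    case 3
    then show ?thesis using orient_vertices [of 1 i 8] True orient_cyclic by (simp add: corner_def)
  qed (auto simp: True corner_def)
next
  case False
  then have c: "corner 2 a m = a m" "corner 2 a (m + 1) = a (Suc m)"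
    using assms by (auto simp: corner_def)
  consider "i = m" | "i = Suc m" | "i < m" | "Suc m < i" by linarith
  then show ?thesis
  proof cases
    case 3
    then show ?thesis
      using orient_vertices [of i m "Suc m"] assms False orient_cyclic [of "a i"] c by simp
  next
    case 4
    then show ?thesis using orient_vertices [of m "Suc m" i] assms c by simp
  qed (auto simp: c c [simplified])
qed

lemma corner_distinct: "\<lbrakk>1 \<le> m; m \<le> 8\<rbrakk> \<Longrightarrow> corner 2 a m \<noteq> corner 2 a (m + 1)"
proof (cases "m = 8")
  case True
  then show ?thesis using orient_vertices [of 1 2 8] by (auto simp: corner_def orient_def)
next
  case False
  assume m: "1 \<le> m" "m \<le> 8"
  consider "1 < m" | "m = 1" using m by linarith
  then show ?thesis
  proof cases
    case 1
    then show ?thesis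
      using orient_vertices [of 1 m "Suc m"] m False by (auto simp: corner_def)
  next
    case 2
    then show ?thesis using orient_vertices [of 1 2 3] by (auto simp: corner_def numeral_2_eq_2)
  qed
qed

text \<open>The polygon lies in the closed half-plane of this side, hence its interior in the open
  one, whereas \<open>orient\<close> vanishes on the whole line of the side.\<close>

lemma side_not_interior:
  assumes "1 \<le> m" "m \<le> 8"
  shows "linepath (corner 2 a m) (corner 2 a (m + 1)) t \<notin> interior P"
proof
  let ?p = "corner 2 a m" and ?q = "corner 2 a (m + 1)"
  assume "linepath ?p ?q t \<in> interior P"
  moreover have "P \<subseteq> {z. orient ?p ?q z \<le> 0}"
    using polygon_halfplane vertex_halfplane [OF assms] by blast
  ultimately have "linepath ?p ?q t \<in> interior {z. orient ?p ?q z \<le> 0}"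
    using interior_mono by blast
  then show False
    using interior_orient(1) [OF corner_distinct [OF assms]] by (simp add: orient_linepath)
qed

text \<open>Turns membership in the chord into a sign condition, which is how the position of the
  curve in R_0 is used from here on.\<close>

lemma chord_iff: "z \<in> closed_segment (a 1) (a 5) \<longleftrightarrow> z \<in> P \<and> side z = 0"
proof
  assume "z \<in> closed_segment (a 1) (a 5)"
  moreover have "closed_segment (a 1) (a 5) \<subseteq> P"
    by (intro closed_segment_subset vertex_in_polygon convex_polygon) auto
  ultimately show "z \<in> P \<and> side z = 0"
    by (auto simp: side_def orient_linepath simp flip: linepath_image_01)
next
  assume z: "z \<in> P \<and> side z = 0"
  have ne: "a 1 \<noteq> a 5" using orient_vertices [of 1 5 6] by auto
  then obtain t where t: "z = linepath (a 1) (a 5) t"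
    using orient_zero_line z unfolding side_def by metis
  \<comment> \<open>The half-planes of two sides at the ends of the chord bound its parameter: the
    side starting at \<open>a 1\<close> gives 0 \<le> t, the side ending at \<open>a 5\<close> gives
    t \<le> 1.\<close>
  have "orient (a 1) (a 2) z \<le> 0" "orient (a 4) (a 5) z \<le> 0"
  proof -
    have c: "corner 2 a 1 = a 1" "corner 2 a (1 + 1) = a 2" "corner 2 a 4 = a 4" "corner 2 a (4 + 1) = a 5"
      by (simp_all add: corner_def flip: numeral_2_eq_2)
    show "orient (a 1) (a 2) z \<le> 0"
      using polygon_halfplane [of "a 1" "a 2"] vertex_halfplane [of 1] z unfolding c by auto
    show "orient (a 4) (a 5) z \<le> 0"
      using polygon_halfplane [of "a 4" "a 5"] vertex_halfplane [of 4] z unfolding c by auto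
  qed
  then have "t * orient (a 1) (a 2) (a 5) \<le> 0" "(1 - t) * orient (a 1) (a 4) (a 5) \<le> 0"
    using orient_cyclic [of "a 1" "a 4" "a 5"] by (simp_all add: t orient_linepath)
  then have "0 \<le> t" "t \<le> 1"
    using orient_vertices [of 1 2 5] orient_vertices [of 1 4 5] by (simp_all add: mult_le_0_iff)
  then show "z \<in> closed_segment (a 1) (a 5)"
    unfolding t by (simp flip: linepath_image_01)
qed

lemma interior_half:
  "interior half1 \<subseteq> interior P \<inter> {z. side z > 0}" "interior half2 \<subseteq> interior P \<inter> {z. side z < 0}"
proof -
  have ne: "a 1 \<noteq> a 5" using orient_vertices [of 1 5 6] by auto
  have "half1 \<subseteq> P" "half1 \<subseteq> {z. orient (a 1) (a 5) z \<ge> 0}" "half2 \<subseteq> P" "half2 \<subseteq> {z. orient (a 1) (a 5) z \<le> 0}"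
    by (auto simp: half1_def half2_def side_def)
  then show "interior half1 \<subseteq> interior P \<inter> {z. side z > 0}" "interior half2 \<subseteq> interior P \<inter> {z. side z < 0}"
    using interior_mono interior_orient [OF ne] unfolding side_def by (metis le_inf_iff)+
qed

lemma side_mids:
  "snd (glue 2 a (1, Complex 0 (1/2))) = midpoint (a 1) (a 2)"
  "snd (glue 2 a (1, Complex 1 (1/2))) = midpoint (a 4) (a 3)"
  "snd (glue 2 a (2, Complex 0 (1/2))) = midpoint (a 2) (a 3)"
  "snd (glue 2 a (2, Complex 1 (1/2))) = midpoint (a 5) (a 4)"
  "snd (glue 2 a (3, Complex 0 (1/2))) = midpoint (a 5) (a 6)"
  "snd (glue 2 a (3, Complex 1 (1/2))) = midpoint (a 8) (a 7)"
  "snd (glue 2 a (4, Complex 0 (1/2))) = midpoint (a 6) (a 7)"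
  "snd (glue 2 a (4, Complex 1 (1/2))) = midpoint (a 1) (a 8)"
proof -
  \<comment> \<open>Bridge 4 uses the corners 6 to 9, and corner 9 is vertex 1 again.\<close>
  have c: "corner 2 a (Suc 0) = a (Suc 0)" "corner 2 a 2 = a 2" "corner 2 a 3 = a 3" "corner 2 a 4 = a 4"
    "corner 2 a 5 = a 5" "corner 2 a 6 = a 6" "corner 2 a 7 = a 7" "corner 2 a 8 = a 8" "corner 2 a 9 = a (Suc 0)"
    by (simp_all add: corner_def flip: numeral_2_eq_2)
  have f: "first_corner (Suc 0) = Suc 0" "first_corner 2 = 2" "first_corner 3 = 5" "first_corner 4 = 6"
    by (simp_all add: first_corner_def)
  have l: "linepath x y (1 / 2) = midpoint x y" for x y :: complex
    by (simp add: linepath_def midpoint_def scaleR_add_right)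
  show "snd (glue 2 a (1, Complex 0 (1/2))) = midpoint (a 1) (a 2)"
    "snd (glue 2 a (1, Complex 1 (1/2))) = midpoint (a 4) (a 3)"
    "snd (glue 2 a (2, Complex 0 (1/2))) = midpoint (a 2) (a 3)"
    "snd (glue 2 a (2, Complex 1 (1/2))) = midpoint (a 5) (a 4)"
    "snd (glue 2 a (3, Complex 0 (1/2))) = midpoint (a 5) (a 6)"
    "snd (glue 2 a (3, Complex 1 (1/2))) = midpoint (a 8) (a 7)"
    "snd (glue 2 a (4, Complex 0 (1/2))) = midpoint (a 6) (a 7)"
    "snd (glue 2 a (4, Complex 1 (1/2))) = midpoint (a 1) (a 8)"
    by (simp_all add: glue_def Let_def f c l flip: numeral_2_eq_2)
qed

lemma side_midpoint: "side (midpoint x y) = (side x + side y) / 2"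
  by (simp add: side_def orient_inner midpoint_def inner_simps field_simps)

text \<open>Each of these points is the mean of two adjacent vertices, at most one of which lies on
  the chord, so the inequality is strict.\<close>

lemma bridge_mid_side:
  "j \<in> {1, 2} \<Longrightarrow> r \<in> {0, 1} \<Longrightarrow> side (snd (glue 2 a (j, Complex r (1/2)))) > 0"
  "j \<in> {3, 4} \<Longrightarrow> r \<in> {0, 1} \<Longrightarrow> side (snd (glue 2 a (j, Complex r (1/2)))) < 0"
  using side_pos [of 2] side_pos [of 3] side_pos [of 4] side_neg [of 6] side_neg [of 7] side_neg [of 8]
  by (auto simp: side_mids side_mids [unfolded One_nat_def] side_midpoint)

end

subsection \<open>Copies of the octagon and of the bridges in the closed surfaces\<close>

lemma continuous_map_quotient_topology: "continuous_map X (quotient_topology X r) r"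
  unfolding continuous_map by (auto simp: openin_quotient_topology)

lemma cone_point_0 [simp]: "cone_point y 0 = (y, 0)"
  by (simp add: cone_point_def)

lemma continuous_map_cone_point:
  assumes "continuous_map Z Y f" "continuous_map Z (top_of_set {0..1}) h"
    "\<And>z. z \<in> topspace Z \<Longrightarrow> f z \<in> A \<or> h z = 0"
  shows "continuous_map Z (cone_off Y A) (\<lambda>z. cone_point (f z) (h z))"
proof -
  let ?S = "subtopology (prod_topology Y (top_of_set {0..1})) (topspace Y \<times> {0} \<union> A \<times> {0..1})"
  have "continuous_map Z ?S (\<lambda>z. (f z, h z))"
    unfolding continuous_map_in_subtopology
  proof
    show "continuous_map Z (prod_topology Y (top_of_set {0..1})) (\<lambda>z. (f z, h z))"
      using assms by (auto intro: continuous_map_pairedI)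
    show "(\<lambda>z. (f z, h z)) \<in> topspace Z \<rightarrow> topspace Y \<times> {0} \<union> A \<times> {0..1}"
      using assms by (fastforce simp: continuous_map_def Pi_iff)
  qed
  from continuous_map_compose [OF this continuous_map_quotient_topology [of _ "\<lambda>(y, t). cone_point y t"]]
  show ?thesis unfolding cone_off_def by (simp add: o_def)
qed

lemma continuous_map_cone_off:
  "continuous_map Z Y f \<Longrightarrow> continuous_map Z (cone_off Y A) (\<lambda>z. (f z, 0))"
  using continuous_map_cone_point [of Z Y f "\<lambda>_. 0" A] by simp

text \<open>Since U misses A, no cone is attached over U: the preimage of its copy is U at height 0,
  which an open strip cuts out of the subspace.\<close>

lemma openin_cone_off:
  assumes "openin Y U" "U \<inter> A = {}"
  shows "openin (cone_off Y A) ((\<lambda>y. (y, 0)) ` U)"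
proof -
  let ?S = "topspace Y \<times> {0} \<union> A \<times> {0..1}"
  let ?T = "subtopology (prod_topology Y (top_of_set {0..1})) ?S"
  have U: "U \<subseteq> topspace Y" using assms openin_subset by blast
  have "{x \<in> topspace ?T. (\<lambda>(y, t). cone_point y t) x \<in> (\<lambda>y. (y, 0)) ` U} = (U \<times> {0..1}) \<inter> ?S"
    using assms U by (auto simp: cone_point_def split: if_splits)
  moreover have "openin ?T ((U \<times> {0..1}) \<inter> ?S)"
    using assms(1) by (intro openin_subtopology_Int) (simp add: openin_prod_Times_iff openin_topspace [of "top_of_set {0..1}", simplified])
  moreover have "(\<lambda>y. (y, 0)) ` U \<subseteq> (\<lambda>(y, t). cone_point y t) ` topspace ?T"
    using U by (force simp: image_iff)
  ultimately show ?thesis unfolding cone_off_def openin_quotient_topology by simp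
qed

lemma glue_0: "glue g a (0, z) = (0, z)"
  by (simp add: glue_def)

text \<open>Homologies need only continuity. Intersection numbers also need charts, hence the open
  interior of K, and injectivity, which lets intersection sets be computed before
  \<open>\<iota>\<close> is applied.\<close>

locale highway_chart = highway_part +
  assumes open_plane: "\<lbrakk>open W; W \<subseteq> interior K\<rbrakk> \<Longrightarrow> openin X ((\<lambda>z. \<iota> (0, z)) ` W)"
    and inj_chart: "inj \<iota>"

context octagon
begin

lemma corner_eq:
  assumes "1 \<le> m" "m \<le> 8"
  shows "corner 2 a m = a m"
proof -
  have "Suc ((m - 1) mod (4 * 2)) = m" using assms by simp
  then show ?thesis by (simp only: corner_def)
qed

lemma first_corner_cases:
  assumes "j \<in> {1..4}"
  shows "first_corner j \<in> {1, 2, 5, 6}"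
proof -
  have "j = 1 \<or> j = 2 \<or> j = 3 \<or> j = 4" using assms by auto
  then show ?thesis by (auto simp: first_corner_def)
qed

text \<open>Bridges meet R_0 only along sides of the octagon.\<close>

lemma glue_not_interior:
  assumes "j \<in> {1..4}" "fst (glue 2 a (j, z)) = 0"
  shows "snd (glue 2 a (j, z)) \<notin> interior P"
proof -
  let ?m = "first_corner j"
  have m: "1 \<le> ?m" "?m \<le> 8" "1 \<le> ?m + 2" "?m + 2 \<le> 8" using first_corner_cases [OF assms(1)] by auto
  have "j \<noteq> 0" using assms by auto
  consider "Re z = 0" | "Re z = 1" using assms \<open>j \<noteq> 0\<close> by (auto simp: glue_def Let_def split: if_splits)
  then show ?thesis
  proof cases
    case 1
    then show ?thesis using \<open>j \<noteq> 0\<close> side_not_interior [OF m(1,2)] by (simp add: glue_def Let_def)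
  next
    case 2
    \<comment> \<open>The side with real part 1 is glued against the direction of the octagon, hence
      the parameter \<open>1 - Im z\<close>.\<close>
    have "linepath (corner 2 a (?m + 3)) (corner 2 a (?m + 2)) (Im z) =
        linepath (corner 2 a (?m + 2)) (corner 2 a (?m + 2 + 1)) (1 - Im z)"
      by (simp add: linepath_def algebra_simps numeral_3_eq_3)
    then show ?thesis using 2 \<open>j \<noteq> 0\<close> side_not_interior [OF m(3,4)] by (simp add: glue_def Let_def)
  qed
qed

text \<open>No bridge point is glued into the interior of R_0, so the preimage of this set is only
  its copy in the piece with index 0.\<close>

lemma openin_highway_surface:
  assumes "open W" "W \<subseteq> interior P"
  shows "openin (highway_surface 2 a) ({0} \<times> W)"
proof -
  have WP: "W \<subseteq> P" using assms interior_subset by blast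
  have "{x \<in> highway_pieces 2 a. glue 2 a x \<in> {0} \<times> W} = ({0} \<times> W) \<inter> highway_pieces 2 a"
  proof (intro equalityI subsetI)
    fix x assume x: "x \<in> {x \<in> highway_pieces 2 a. glue 2 a x \<in> {0} \<times> W}"
    obtain j z where jz: "x = (j, z)" by force
    have "j \<notin> {1..4}"
      using glue_not_interior [of j z] x assms(2) jz by auto
    then have "j = 0" using x jz by (auto simp: highway_pieces_def)
    then show "x \<in> ({0} \<times> W) \<inter> highway_pieces 2 a" using x jz by (auto simp: glue_def)
  qed (auto simp: glue_def)
  moreover have "openin (top_of_set (highway_pieces 2 a)) (({0} \<times> W) \<inter> highway_pieces 2 a)"
    using assms by (intro openin_subtopology_Int) (auto intro: open_Times open_discrete)
  moreover have "{0} \<times> W \<subseteq> glue 2 a ` highway_pieces 2 a"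
  proof
    fix x assume "x \<in> {0::nat} \<times> W"
    then have "x \<in> highway_pieces 2 a" "x = glue 2 a x" using WP by (auto simp: highway_pieces_def glue_def)
    then show "x \<in> glue 2 a ` highway_pieces 2 a" by blast
  qed
  ultimately show ?thesis unfolding highway_surface_def openin_quotient_topology by simp
qed

lemma continuous_map_highway_plane: "continuous_map (top_of_set P) (highway_surface 2 a) (\<lambda>z. (0, z))"
proof -
  have "continuous_map (top_of_set P) (top_of_set (highway_pieces 2 a)) (\<lambda>z. (0, z))"
    by (auto simp: highway_pieces_def intro!: continuous_intros)
  from continuous_map_compose [OF this continuous_map_quotient_topology [of _ "glue 2 a"]]
  show ?thesis unfolding highway_surface_def by (simp add: o_def glue_0)
qed

lemma continuous_map_highway_bridge:
  assumes "j \<in> {1..4}"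
  shows "continuous_map (top_of_set rectangle) (highway_surface 2 a) (\<lambda>z. glue 2 a (j, z))"
proof -
  have "continuous_map (top_of_set rectangle) (top_of_set (highway_pieces 2 a)) (\<lambda>z. (j, z))"
    using assms by (auto simp: highway_pieces_def intro!: continuous_intros)
  from continuous_map_compose [OF this continuous_map_quotient_topology]
  show ?thesis unfolding highway_surface_def by (simp add: o_def)
qed

lemma topspace_highway_surface: "topspace (highway_surface 2 a) = glue 2 a ` highway_pieces 2 a"
  by (simp add: highway_surface_def)

lemma plane_in_highway: "z \<in> P \<Longrightarrow> (0, z) \<in> topspace (highway_surface 2 a)"
  using continuous_map_highway_plane by (auto simp: continuous_map_def Pi_iff)

text \<open>A point with index 0 comes from R_0 or from a glued side of a bridge, and such a side
  lands in the convex polygon.\<close>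

lemma plane_in_highway_iff: "(0, z) \<in> topspace (highway_surface 2 a) \<Longrightarrow> z \<in> P"
proof -
  assume "(0, z) \<in> topspace (highway_surface 2 a)"
  then obtain j w where jw: "(j, w) \<in> highway_pieces 2 a" "glue 2 a (j, w) = (0, z)"
    by (auto simp: topspace_highway_surface)
  have seg: "linepath (corner 2 a m) (corner 2 a n) (Im w) \<in> P" if "w \<in> rectangle" for m n
    using convexD_alt [OF convex_polygon corner_in_polygon corner_in_polygon] that
    by (auto simp: linepath_def rectangle_def)
  show "z \<in> P"
    using jw seg by (auto simp: highway_pieces_def glue_def Let_def split: if_splits)
qed

lemma highway_boundary_not_interior:
  assumes "W \<subseteq> interior P"
  shows "({0} \<times> W) \<inter> highway_boundary 2 a = {}"
proof -
  have "x \<notin> {0} \<times> W" if x: "x \<in> highway_boundary 2 a" for x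
  proof -
    obtain p where p: "p \<in> {1..2 * 2} \<times> {z \<in> rectangle. Im z = 0 \<or> Im z = 1}" "x = glue 2 a p"
      using x unfolding highway_boundary_def by blast
    obtain j z where jz: "p = (j, z)" by (cases p)
    have "j \<in> {1..4}" "x = glue 2 a (j, z)" using p jz by auto
    then show ?thesis using glue_not_interior [of j z] assms by auto
  qed
  then show ?thesis by blast
qed

lemma continuous_map_double_torus:
  "continuous_map Z (highway_surface 2 a) f \<Longrightarrow> continuous_map Z (double_torus a) (\<lambda>z. (f z, 0))"
  unfolding closed_surface_def by (rule continuous_map_cone_off)

lemma highway_chart_double_torus:
  "highway_chart 2 a (double_torus a) (\<lambda>y. (y, 0)) P {1..4}"
proof
  show "convex P" by (rule convex_polygon)
  show "continuous_map (top_of_set P) (double_torus a) (\<lambda>z. ((0, z), 0))"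
    by (intro continuous_map_double_torus continuous_map_highway_plane)
  show "continuous_map (top_of_set rectangle) (double_torus a) (\<lambda>z. (glue 2 a (j, z), 0))" if "j \<in> {1..4}" for j
    using that by (intro continuous_map_double_torus continuous_map_highway_bridge)
  show "corner 2 a (first_corner j + i) \<in> P" for j i by (rule corner_in_polygon)
  show "openin (double_torus a) ((\<lambda>z. ((0, z), 0)) ` W)" if "open W" "W \<subseteq> interior P" for W
  proof -
    have "openin (double_torus a) ((\<lambda>y. (y, 0)) ` ({0} \<times> W))"
      unfolding closed_surface_def
      using that by (intro openin_cone_off openin_highway_surface highway_boundary_not_interior)
    moreover have "(\<lambda>y. (y, 0::real)) ` ({0::nat} \<times> W) = (\<lambda>z. ((0, z), 0)) ` W" by auto
    ultimately show ?thesis by simp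
  qed
qed (auto intro: injI)

end

section \<open>The components of the complement of the curve and the capped tori\<close>

locale separated = octagon +
  fixes c :: "real \<Rightarrow> (nat \<times> complex) \<times> real" and U1 U2 :: "((nat \<times> complex) \<times> real) set"
  assumes separating: "separating_curve a c U1 U2"
begin

abbreviation C :: "((nat \<times> complex) \<times> real) set" where "C \<equiv> c ` {0..1}"

lemma components: "connected_components_of (subtopology (double_torus a) (topspace (double_torus a) - C)) = {U1, U2}"
  and U1_U2: "U1 \<noteq> U2"
  and bridges_U1: "(glue 2 a ` ({1, 2} \<times> rectangle)) \<times> {0} - C \<subseteq> U1"
  and bridges_U2: "(glue 2 a ` ({3, 4} \<times> rectangle)) \<times> {0} - C \<subseteq> U2"
  and curve_chord: "C \<inter> topspace (highway_surface 2 a) \<times> {0} = ({0} \<times> closed_segment (a 1) (a 5)) \<times> {0}"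
  using separating by (auto simp: separating_curve_def)

lemma disjoint_U: "U1 \<inter> U2 = {}"
  using pairwise_disjoint_connected_components_of
    [of "subtopology (double_torus a) (topspace (double_torus a) - C)"] U1_U2
  by (auto simp: components pairwise_def disjnt_def)

lemma union_U: "U1 \<union> U2 = topspace (double_torus a) - C"
  using Union_connected_components_of [of "subtopology (double_torus a) (topspace (double_torus a) - C)"]
  by (auto simp: components)

lemma connected_in_component:
  assumes "connectedin (double_torus a) S" "S \<inter> C = {}" "S \<inter> U \<noteq> {}" "U \<in> {U1, U2}"
  shows "S \<subseteq> U"
proof -
  have "connectedin (subtopology (double_torus a) (topspace (double_torus a) - C)) S"
    using assms connectedin_subset_topspace [OF assms(1)] by (auto simp: connectedin_subtopology)
  then show ?thesis
    using connected_components_of_maximal [of U "subtopology (double_torus a) (topspace (double_torus a) - C)" S]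
      assms by (auto simp: components disjnt_def)
qed

lemma plane_in_curve: "z \<in> P \<Longrightarrow> ((0, z), 0) \<in> C \<longleftrightarrow> side z = 0"
proof -
  assume z: "z \<in> P"
  have "((0, z), 0) \<in> C \<longleftrightarrow> ((0, z), 0) \<in> C \<inter> topspace (highway_surface 2 a) \<times> {0}"
    using plane_in_highway [OF z] by simp
  also have "\<dots> \<longleftrightarrow> z \<in> closed_segment (a 1) (a 5)"
    unfolding curve_chord by simp
  finally show ?thesis using chord_iff z by simp
qed

text \<open>\<open>separating_curve\<close> places only the bridges in the components. Each open
  half of the octagon is convex and misses the curve, so it lies in a single component, and one
  corner shared with a bridge tells in which.\<close>

lemma plane_component:
  assumes "z \<in> P"
  shows "side z > 0 \<Longrightarrow> ((0, z), 0) \<in> U1" "side z < 0 \<Longrightarrow> ((0, z), 0) \<in> U2"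
proof -
  have con: "connectedin (double_torus a) ((\<lambda>z. ((0, z), 0)) ` S)" if "convex S" "S \<subseteq> P" for S
  proof (rule connectedin_continuous_map_image)
    show "continuous_map (top_of_set S) (double_torus a) (\<lambda>z. ((0, z), 0))"
      using continuous_map_from_subtopology_mono [OF _ that(2)] continuous_map_double_torus
        [OF continuous_map_highway_plane] by blast
    show "connectedin (top_of_set S) S"
      using convex_connected [OF that(1)] by (simp add: connectedin_subtopology)
  qed
  \<comment> \<open>The vertex \<open>\<i>\<close> of a rectangle is glued to the second corner of
    its bridge, which is off the chord: vertex 2 for bridge 1, vertex 6 for bridge 3.\<close>
  have glue_vertex: "glue 2 a (1, \<i>) = (0, a 2)" "glue 2 a (3, \<i>) = (0, a 6)" "\<i> \<in> rectangle"
    by (auto simp: glue_def Let_def first_corner_def corner_eq rectangle_def linepath_1' simp flip: numeral_2_eq_2)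
  show "((0, z), 0) \<in> U1" if "side z > 0"
  proof -
    let ?S = "P \<inter> {z. orient (a 1) (a 5) z > 0}"
    have "(\<lambda>z. ((0::nat, z), 0::real)) ` ?S \<subseteq> U1"
    proof (rule connected_in_component [OF con])
      show "(\<lambda>z. ((0::nat, z), 0::real)) ` ?S \<inter> C = {}"
        using plane_in_curve by (force simp: side_def)
      have "a 2 \<in> ?S" using side_pos [of 2] vertex_in_polygon [of 2] by (simp add: side_def)
      moreover have "((0, a 2), 0) \<in> U1"
      proof (rule subsetD [OF bridges_U1])
        have "((0, a 2), 0) \<notin> C" using plane_in_curve [of "a 2"] side_pos [of 2] vertex_in_polygon [of 2] by simp
        moreover have "(0, a 2) \<in> glue 2 a ` ({1, 2} \<times> rectangle)"
          using glue_vertex by (metis SigmaI imageI insertI1)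
        ultimately show "((0, a 2), 0) \<in> (glue 2 a ` ({1, 2} \<times> rectangle)) \<times> {0} - C" by blast
      qed
      ultimately show "(\<lambda>z. ((0::nat, z), 0::real)) ` ?S \<inter> U1 \<noteq> {}" by blast
    qed (auto intro: convex_Int convex_polygon convex_orient)
    then show ?thesis using that assms by (auto simp: side_def)
  qed
  show "((0, z), 0) \<in> U2" if "side z < 0"
  proof -
    let ?S = "P \<inter> {z. orient (a 1) (a 5) z < 0}"
    have "(\<lambda>z. ((0::nat, z), 0::real)) ` ?S \<subseteq> U2"
    proof (rule connected_in_component [OF con])
      show "(\<lambda>z. ((0::nat, z), 0::real)) ` ?S \<inter> C = {}"
        using plane_in_curve by (force simp: side_def)
      have "a 6 \<in> ?S" using side_neg [of 6] vertex_in_polygon [of 6] by (simp add: side_def)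
      moreover have "((0, a 6), 0) \<in> U2"
      proof (rule subsetD [OF bridges_U2])
        have "((0, a 6), 0) \<notin> C" using plane_in_curve [of "a 6"] side_neg [of 6] vertex_in_polygon [of 6] by simp
        moreover have "(0, a 6) \<in> glue 2 a ` ({3, 4} \<times> rectangle)"
          using glue_vertex by (metis SigmaI imageI insertI1)
        ultimately show "((0, a 6), 0) \<in> (glue 2 a ` ({3, 4} \<times> rectangle)) \<times> {0} - C" by blast
      qed
      ultimately show "(\<lambda>z. ((0::nat, z), 0::real)) ` ?S \<inter> U2 \<noteq> {}" by blast
    qed (auto intro: convex_Int convex_polygon convex_orient)
    then show ?thesis using that assms by (auto simp: side_def)
  qed
qed

lemma half_in_component:
  "z \<in> half1 \<Longrightarrow> ((0, z), 0) \<in> U1 \<union> C" "z \<in> half2 \<Longrightarrow> ((0, z), 0) \<in> U2 \<union> C"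
proof -
  show "((0, z), 0) \<in> U1 \<union> C" if "z \<in> half1"
    using that plane_component(1) [of z] plane_in_curve [of z]
    by (cases "side z = 0") (auto simp: half1_def simp del: image_iff)
  show "((0, z), 0) \<in> U2 \<union> C" if "z \<in> half2"
    using that plane_component(2) [of z] plane_in_curve [of z]
    by (cases "side z = 0") (auto simp: half2_def simp del: image_iff)
qed

lemma plane_component_half:
  "\<lbrakk>z \<in> P; ((0, z), 0) \<in> U1 \<union> C\<rbrakk> \<Longrightarrow> z \<in> half1" "\<lbrakk>z \<in> P; ((0, z), 0) \<in> U2 \<union> C\<rbrakk> \<Longrightarrow> z \<in> half2"
  using plane_component [of z] disjoint_U union_U unfolding half1_def half2_def mem_Collect_eq not_less [symmetric]
  by blast+

text \<open>K includes its part of the chord because the bridges have corners there. Openness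
  concerns only the interior of K, which avoids the curve and hence the attached cone.\<close>

lemma highway_chart_capped:
  assumes K: "convex K" "K \<subseteq> P" and J: "J \<subseteq> {1..4}"
    and U: "\<And>z. z \<in> K \<Longrightarrow> ((0, z), 0) \<in> U \<union> C" "\<And>z. z \<in> interior K \<Longrightarrow> ((0, z), 0) \<in> U - C"
    and bridge: "\<And>j z. \<lbrakk>j \<in> J; z \<in> rectangle\<rbrakk> \<Longrightarrow> (glue 2 a (j, z), 0) \<in> U \<union> C"
    and corner: "\<And>j i. \<lbrakk>j \<in> J; i \<le> 3\<rbrakk> \<Longrightarrow> corner 2 a (first_corner j + i) \<in> K"
  shows "highway_chart 2 a (capped a c U) (\<lambda>y. ((y, 0), 0)) K J"
proof
  interpret D: highway_chart 2 a "double_torus a" "\<lambda>y. (y, 0)" P "{1..4}"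
    by (rule highway_chart_double_torus)
  have cap: "continuous_map Z (capped a c U) (\<lambda>z. (f z, 0))"
    if "continuous_map Z (double_torus a) f" "\<And>z. z \<in> topspace Z \<Longrightarrow> f z \<in> U \<union> C" for Z :: "complex topology" and f
    unfolding capped_def using that
    by (intro continuous_map_cone_off) (auto simp: continuous_map_in_subtopology)
  show "convex K" by fact
  show "continuous_map (top_of_set K) (capped a c U) (\<lambda>z. (((0, z), 0), 0))"
    using U K continuous_map_from_subtopology_mono [OF D.continuous_plane] by (intro cap) auto
  show "continuous_map (top_of_set rectangle) (capped a c U) (\<lambda>z. ((glue 2 a (j, z), 0), 0))" if "j \<in> J" for j
    using bridge that J D.continuous_bridge by (intro cap) auto
  show "corner 2 a (first_corner j + i) \<in> K" if "j \<in> J" "i \<le> 3" for j i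
    using corner that by blast
  show "0 \<notin> J" using J by auto
  show "openin (capped a c U) ((\<lambda>z. (((0, z), 0), 0)) ` W)" if "open W" "W \<subseteq> interior K" for W
  proof -
    let ?V = "(\<lambda>z. ((0, z), 0)) ` W"
    have "openin (double_torus a) ?V"
      using that interior_mono [OF K(2)] by (intro D.open_plane) auto
    then have "openin (subtopology (double_torus a) (U \<union> C)) (?V \<inter> (U \<union> C))"
      by (rule openin_subtopology_Int)
    moreover have "?V \<subseteq> U - C" using U(2) that by auto
    moreover from this have "?V \<inter> (U \<union> C) = ?V" "?V \<inter> C = {}" by blast+
    ultimately have "openin (subtopology (double_torus a) (U \<union> C)) ?V" "?V \<inter> C = {}" by simp_all
    then have "openin (capped a c U) ((\<lambda>y. (y, 0)) ` ?V)"
      unfolding capped_def by (rule openin_cone_off)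
    then show ?thesis by (simp add: image_image)
  qed
qed (auto intro: injI)

lemma highway_chart_capped1: "highway_chart 2 a (capped a c U1) (\<lambda>y. ((y, 0), 0)) half1 {1, 2}"
proof (rule highway_chart_capped)
  show "((0, z), 0) \<in> U1 - C" if "z \<in> interior half1" for z
  proof -
    have "z \<in> P" "side z > 0" using that interior_half interior_subset by blast+
    then show ?thesis using plane_component plane_in_curve by auto
  qed
  show "corner 2 a (first_corner j + i) \<in> half1" if "j \<in> {1, 2}" "i \<le> 3" for j i
  proof -
    have "1 \<le> first_corner j + i" "first_corner j + i \<le> 5" using that by (auto simp: first_corner_def)
    moreover from this have "corner 2 a (first_corner j + i) = a (first_corner j + i)"
      by (intro corner_eq) auto
    ultimately show ?thesis using vertex_in_half1 by simp
  qed
  show "(glue 2 a (j, z), 0) \<in> U1 \<union> C" if "j \<in> {1, 2}" "z \<in> rectangle" for j z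
    using bridges_U1 that by blast
qed (use convex_half half_in_component in \<open>auto simp: half1_def\<close>)

lemma highway_chart_capped2: "highway_chart 2 a (capped a c U2) (\<lambda>y. ((y, 0), 0)) half2 {3, 4}"
proof (rule highway_chart_capped)
  show "((0, z), 0) \<in> U2 - C" if "z \<in> interior half2" for z
  proof -
    have "z \<in> P" "side z < 0" using that interior_half interior_subset by blast+
    then show ?thesis using plane_component plane_in_curve by auto
  qed
  show "corner 2 a (first_corner j + i) \<in> half2" if "j \<in> {3, 4}" "i \<le> 3" for j i
  \<comment> \<open>The last corner of bridge 4 has the number 9, which \<open>corner\<close> sends
    to \<open>a 1\<close>.\<close>
  proof (cases "first_corner j + i = 9")
    case True
    then show ?thesis using vertex_in_half2 by (simp add: corner_def)
  next
    case False
    then have "5 \<le> first_corner j + i" "first_corner j + i \<le> 8" using that by (auto simp: first_corner_def)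
    moreover from this have "corner 2 a (first_corner j + i) = a (first_corner j + i)"
      by (intro corner_eq) auto
    ultimately show ?thesis using vertex_in_half2 by simp
  qed
  show "(glue 2 a (j, z), 0) \<in> U2 \<union> C" if "j \<in> {3, 4}" "z \<in> rectangle" for j z
    using bridges_U2 that by blast
qed (use convex_half half_in_component in \<open>auto simp: half2_def\<close>)

end

subsection \<open>Intersections of the basis curves\<close>

context highway_chart
begin

lemma side_mid_glue: "\<lbrakk>j \<in> J; r = 0 \<or> r = 1\<rbrakk> \<Longrightarrow> glue g a (j, Complex r (1/2)) = (0, side_mid j r)"
  using glue_side_K(1) [of j "Complex r (1/2)"] by (auto simp: rectangle_def prod_eq_iff)

text \<open>At s = 0 and s = 1/2 the curve is on a glued side and its point has index 0. So the
  index j occurs exactly for 0 < s < 1/2, from which injectivity and intersections can be read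
  off.\<close>

lemma bridge_curve_value:
  assumes "j \<in> J" "0 \<le> s" "s \<le> 1"
  shows "bridge_curve g a j s =
    (if s = 0 then (0, side_mid j 0)
     else if s < 1/2 then (j, Complex (2 * s) (1/2))
     else (0, linepath (side_mid j 1) (side_mid j 0) (2 * s - 1)))"
proof -
  have "j \<noteq> 0" using assms zero_J by metis
  consider "s = 0" | "0 < s" "s < 1/2" | "s = 1/2" | "s > 1/2" using assms by linarith
  then show ?thesis
  proof cases
    case 1
    then show ?thesis using side_mid_glue [OF assms(1), of 0] by (simp add: bridge_curve_def)
  next
    case 2
    then show ?thesis using \<open>j \<noteq> 0\<close> by (simp add: bridge_curve_def glue_def Let_def)
  next
    case 3
    then show ?thesis
      using side_mid_glue [OF assms(1), of 1] unfolding 3 by (simp add: bridge_curve_def linepath_def)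
  next
    case 4
    then show ?thesis by (simp add: bridge_curve_def)
  qed
qed

lemma bridge_curve_image:
  assumes "j \<in> J"
  shows "bridge_curve g a j ` {0..1} =
    {0} \<times> closed_segment (side_mid j 0) (side_mid j 1) \<union> {j} \<times> {Complex r (1/2) | r. 0 < r \<and> r < 1}"
    (is "?L = ?R")
proof (intro equalityI subsetI)
  fix x assume "x \<in> ?L"
  then obtain s where s: "0 \<le> s" "s \<le> 1" "x = bridge_curve g a j s" by auto
  show "x \<in> ?R"
  proof (cases "s < 1/2")
    case True
    then show ?thesis using s bridge_curve_value [OF assms s(1,2)] by auto
  next
    case False
    then have "linepath (side_mid j 1) (side_mid j 0) (2 * s - 1) \<in> closed_segment (side_mid j 1) (side_mid j 0)"
      using s by (simp add: linepath_in_path)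
    then show ?thesis
      using False s bridge_curve_value [OF assms s(1,2)] by (auto simp: closed_segment_commute)
  qed
next
  fix x assume "x \<in> ?R"
  then consider z where "x = (0, z)" "z \<in> closed_segment (side_mid j 1) (side_mid j 0)"
    | r where "x = (j, Complex r (1/2))" "0 < r" "r < 1"
    by (auto simp: closed_segment_commute)
  then show "x \<in> ?L"
  proof cases
    case 1
    then obtain t where t: "t \<in> {0..1}" "z = linepath (side_mid j 1) (side_mid j 0) t"
      unfolding linepath_image_01 [symmetric] by auto
    have "bridge_curve g a j ((1 + t) / 2) = x"
      using t 1 bridge_curve_value [OF assms, of "(1 + t) / 2"] by (auto simp: field_simps)
    then show ?thesis using t by (intro image_eqI [of _ _ "(1 + t) / 2"]) auto
  next
    case 2
    then have "bridge_curve g a j (r / 2) = x"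
      using bridge_curve_value [OF assms, of "r / 2"] by simp
    then show ?thesis using 2 by (intro image_eqI [of _ _ "r / 2"]) auto
  qed
qed

lemma simple_closed_bridge_curve:
  assumes "j \<in> J" "side_mid j 0 \<noteq> side_mid j 1"
  shows "simple_closed_curve X (\<lambda>s. \<iota> (bridge_curve g a j s))"
  unfolding simple_closed_curve_def
proof (intro conjI)
  show "pathin X (\<lambda>s. \<iota> (bridge_curve g a j s))" using assms(1) by (rule pathin_bridge_curve)
  show "\<iota> (bridge_curve g a j 0) = \<iota> (bridge_curve g a j 1)" using bridge_curve_closed [OF assms(1)] by simp
  have "j \<noteq> 0" using assms zero_J by metis
  have "inj_on (bridge_curve g a j) {0..<1}"
  proof (rule linorder_inj_onI')
    fix s t :: real assume st: "s \<in> {0..<1}" "t \<in> {0..<1}" "s < t"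
    have inj: "linepath (side_mid j 1) (side_mid j 0) u \<noteq> linepath (side_mid j 1) (side_mid j 0) v"
      if "u \<noteq> v" for u v :: real
    proof -
      have "linepath (side_mid j 1) (side_mid j 0) u - linepath (side_mid j 1) (side_mid j 0) v =
          (u - v) *\<^sub>R (side_mid j 0 - side_mid j 1)"
        by (simp add: linepath_def algebra_simps)
      moreover have "\<dots> \<noteq> 0" using that assms(2) by simp
      ultimately show ?thesis by auto
    qed
    \<comment> \<open>The start of the curve is the end of its return segment, so it is compared
      with the other points of that segment as the point at parameter 1.\<close>
    have end0: "linepath (side_mid j 1) (side_mid j 0) 1 = side_mid j 0" by (simp add: linepath_def)
    show "bridge_curve g a j s \<noteq> bridge_curve g a j t"
      using st bridge_curve_value [OF assms(1), of s] bridge_curve_value [OF assms(1), of t] \<open>j \<noteq> 0\<close>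
        inj [of "2 * s - 1" "2 * t - 1"] inj [of 1 "2 * t - 1"] end0
      by (auto split: if_splits)
  qed
  then show "inj_on (\<lambda>s. \<iota> (bridge_curve g a j s)) {0..<1}"
    using inj_chart unfolding inj_on_def inj_def by blast
qed

text \<open>Off R_0 the two curves have different indices, so they can meet only on their return
  segments.\<close>

lemma bridge_curves_intersection:
  assumes "i \<in> J" "j \<in> J" "i \<noteq> j"
  shows "(\<lambda>s. \<iota> (bridge_curve g a i s)) ` {0..1} \<inter> (\<lambda>s. \<iota> (bridge_curve g a j s)) ` {0..1} =
    (\<lambda>z. \<iota> (0, z)) ` (closed_segment (side_mid i 0) (side_mid i 1) \<inter> closed_segment (side_mid j 0) (side_mid j 1))"
proof -
  have ne: "i \<noteq> 0" "j \<noteq> 0" using assms zero_J by metis+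
  have "(\<lambda>s. \<iota> (bridge_curve g a i s)) ` {0..1} \<inter> (\<lambda>s. \<iota> (bridge_curve g a j s)) ` {0..1} =
    \<iota> ` (bridge_curve g a i ` {0..1} \<inter> bridge_curve g a j ` {0..1})"
    using image_Int [OF inj_chart] by (simp add: image_image)
  also have "bridge_curve g a i ` {0..1} \<inter> bridge_curve g a j ` {0..1} =
     Pair 0 ` (closed_segment (side_mid i 0) (side_mid i 1) \<inter> closed_segment (side_mid j 0) (side_mid j 1))"
    unfolding bridge_curve_image [OF assms(1)] bridge_curve_image [OF assms(2)] using assms(3) ne by auto
  finally show ?thesis by (simp add: image_image)
qed

lemma intersection_disjoint_bridges:
  assumes "intersection_form X dot" "i \<in> J" "j \<in> J" "i \<noteq> j"
    "side_mid i 0 \<noteq> side_mid i 1" "side_mid j 0 \<noteq> side_mid j 1"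
    "closed_segment (side_mid i 0) (side_mid i 1) \<inter> closed_segment (side_mid j 0) (side_mid j 1) = {}"
  shows "dot (mod2_class X (bridge_chain i)) (mod2_class X (bridge_chain j)) = 0"
proof -
  let ?c = "\<lambda>s. \<iota> (bridge_curve g a i s)" and ?d = "\<lambda>s. \<iota> (bridge_curve g a j s)"
  have e: "?c ` {0..1} \<inter> ?d ` {0..1} = {}"
    using bridge_curves_intersection [OF assms(2-4)] assms(7) by simp
  have "dot (curve_class X ?c) (curve_class X ?d) = of_nat (card (?c ` {0..1} \<inter> ?d ` {0..1}))"
  proof -
    have "finite (?c ` {0..1} \<inter> ?d ` {0..1})" unfolding e by simp
    moreover have "\<forall>p \<in> ?c ` {0..1} \<inter> ?d ` {0..1}. transversal_at X (?c ` {0..1}) (?d ` {0..1}) p"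
      unfolding e by simp
    ultimately show ?thesis
      using assms(1) simple_closed_bridge_curve [OF assms(2,5)] simple_closed_bridge_curve [OF assms(3,6)]
      unfolding intersection_form_def by blast
  qed
  then show ?thesis unfolding e by simp
qed

lemma homeomorphic_plane:
  assumes "open W" "W \<subseteq> interior K"
  shows "homeomorphic_map (top_of_set W) (subtopology X ((\<lambda>z. \<iota> (0, z)) ` W)) (\<lambda>z. \<iota> (0, z))"
proof (rule bijective_open_imp_homeomorphic_map)
  have WK: "W \<subseteq> K" using assms interior_subset by blast
  show "continuous_map (top_of_set W) (subtopology X ((\<lambda>z. \<iota> (0, z)) ` W)) (\<lambda>z. \<iota> (0, z))"
    using continuous_map_from_subtopology_mono [OF continuous_plane WK] by (auto simp: continuous_map_in_subtopology)
  show "open_map (top_of_set W) (subtopology X ((\<lambda>z. \<iota> (0, z)) ` W)) (\<lambda>z. \<iota> (0, z))"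
    unfolding open_map_def
  proof (intro allI impI)
    fix T assume "openin (top_of_set W) T"
    then have T: "open T" "T \<subseteq> W" using assms(1) openin_open_eq by blast+
    then have "openin X ((\<lambda>z. \<iota> (0, z)) ` T)" using assms by (intro open_plane) auto
    then show "openin (subtopology X ((\<lambda>z. \<iota> (0, z)) ` W)) ((\<lambda>z. \<iota> (0, z)) ` T)"
      using T by (auto intro: openin_subset_topspace_eq simp: openin_subtopology)
  qed
  show "inj_on (\<lambda>z. \<iota> (0, z)) (topspace (top_of_set W))"
    using inj_chart by (auto simp: inj_on_def)
  show "(\<lambda>z. \<iota> (0, z)) ` topspace (top_of_set W) = topspace (subtopology X ((\<lambda>z. \<iota> (0, z)) ` W))"
    using openin_subset [OF open_plane [OF assms]] by auto
qed

text \<open>The return segments pq and rs separate each other's end points, so they cross once. The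
  affine functions \<open>orient r s\<close> and \<open>orient p q\<close> are coordinates that
  carry the two lines to the axes, which gives the chart required for transversality.\<close>

lemma intersection_crossing_bridges:
  assumes form: "intersection_form X dot" and ij: "i \<in> J" "j \<in> J" "i \<noteq> j"
    and pt: "p = side_mid i 0" "q = side_mid i 1" "r = side_mid j 0" "s = side_mid j 1"
    and o: "orient p q r > 0" "orient p q s < 0" "orient r s p < 0" "orient r s q > 0"
    and int: "\<And>t. \<lbrakk>0 < t; t < 1\<rbrakk> \<Longrightarrow> linepath p q t \<in> interior K"
  shows "dot (mod2_class X (bridge_chain i)) (mod2_class X (bridge_chain j)) = 1"
proof -
  have ne: "p \<noteq> q" "r \<noteq> s" using o by auto
  define h where "h z = Complex (orient r s z) (orient p q z)" for z
  \<comment> \<open>The strips keep strictly between the levels of the end points, so inside W the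
    lines through pq and rs contain nothing but points of the segments.\<close>
  define W where "W = interior K \<inter> {z. orient r s p < orient r s z} \<inter> {z. orient r s z < orient r s q} \<inter>
     {z. orient p q s < orient p q z} \<inter> {z. orient p q z < orient p q r}"
  \<comment> \<open>The zero of the affine function \<open>orient r s\<close> along pq.\<close>
  define t where "t = orient r s p / (orient r s p - orient r s q)"
  define m where "m = linepath p q t"
  have t: "0 < t" "t < 1" using o by (auto simp: t_def divide_simps)
  have om: "orient r s m = 0" "orient p q m = 0"
    using o unfolding m_def orient_linepath t_def by (simp_all add: field_simps)
  have open_W: "open W"
    unfolding W_def by (intro open_Int open_interior open_Collect_less continuous_intros)
  have m_W: "m \<in> W" using int [OF t] om o by (simp add: W_def m_def)
  have inj: "inj h"
  proof (rule injI)
    fix x y assume "h x = h y"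
    then have e: "orient r s x = orient r s y" "orient p q x = orient p q y" by (auto simp: h_def)
    define d where "d = x - y"
    have "Im (cnj (s - r) * d) = 0" "Im (cnj (q - p) * d) = 0"
      using e by (simp_all add: orient_def d_def algebra_simps)
    then have z: "Re (s - r) * Im d = Im (s - r) * Re d" "Re (q - p) * Im d = Im (q - p) * Re d"
      by (simp_all add: algebra_simps)
    \<comment> \<open>The determinant of the directions of the two segments. It is the change of
      \<open>orient p q\<close> from r to s, nonzero because r and s lie on opposite sides of
      pq.\<close>
    have "Re (q - p) * Im (s - r) - Im (q - p) * Re (s - r) = orient p q s - orient p q r"
      by (simp add: orient_def algebra_simps)
    then have D: "Re (q - p) * Im (s - r) - Im (q - p) * Re (s - r) \<noteq> 0" using o by simp
    have "(Re (q - p) * Im (s - r) - Im (q - p) * Re (s - r)) * Re d = 0"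
      "(Re (q - p) * Im (s - r) - Im (q - p) * Re (s - r)) * Im d = 0"
    proof -
      have *: "(u * y - v * x) * k = 0" "(u * y - v * x) * l = 0" if e: "x * l = y * k" "u * l = v * k"
        for u v x y k l :: real
      proof -
        have "(u * y - v * x) * k = u * (y * k) - x * (v * k)" by (simp add: algebra_simps)
        then show "(u * y - v * x) * k = 0" unfolding e [symmetric] by (simp add: algebra_simps)
        have "(u * y - v * x) * l = y * (u * l) - v * (x * l)" by (simp add: algebra_simps)
        then show "(u * y - v * x) * l = 0" unfolding e by (simp add: algebra_simps)
      qed
      show "(Re (q - p) * Im (s - r) - Im (q - p) * Re (s - r)) * Re d = 0"
        "(Re (q - p) * Im (s - r) - Im (q - p) * Re (s - r)) * Im d = 0"
        by (rule * [OF z])+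
    qed
    then have "d = 0" using D by (simp add: complex_eq_iff)
    then show "x = y" by (simp add: d_def)
  qed
  have cont: "continuous_on S h" for S
    unfolding h_def Complex_eq by (intro continuous_intros)
  have seg1: "z \<in> closed_segment p q \<longleftrightarrow> Im (h z) = 0" if "z \<in> W" for z
  proof
    show "Im (h z) = 0" if "z \<in> closed_segment p q"
      using that by (auto simp: h_def orient_linepath simp flip: linepath_image_01)
    assume "Im (h z) = 0"
    then have "orient p q z = 0" by (simp add: h_def)
    then obtain u where u: "z = linepath p q u" using orient_zero_line ne by metis
    \<comment> \<open>Along pq the function \<open>orient r s\<close> is affine and increasing, so
      the bounds that define W become bounds on u.\<close>
    have "0 < u * (orient r s q - orient r s p)" "0 < (1 - u) * (orient r s q - orient r s p)"
      using that by (simp_all add: W_def u orient_linepath algebra_simps)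
    then have "0 \<le> u" "u \<le> 1" using o by (simp_all add: zero_less_mult_iff)
    then show "z \<in> closed_segment p q" by (simp add: u linepath_in_path)
  qed
  have seg2: "z \<in> closed_segment r s \<longleftrightarrow> Re (h z) = 0" if "z \<in> W" for z
  proof
    show "Re (h z) = 0" if "z \<in> closed_segment r s"
      using that by (auto simp: h_def orient_linepath simp flip: linepath_image_01)
    assume "Re (h z) = 0"
    then have "orient r s z = 0" by (simp add: h_def)
    then obtain u where u: "z = linepath r s u" using orient_zero_line ne by metis
    have "0 < u * (orient p q r - orient p q s)" "0 < (1 - u) * (orient p q r - orient p q s)"
      using that by (simp_all add: W_def u orient_linepath algebra_simps)
    then have "0 \<le> u" "u \<le> 1" using o by (simp_all add: zero_less_mult_iff)
    then show "z \<in> closed_segment r s" by (simp add: u linepath_in_path)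
  qed
  have hm: "h m = 0" using om by (simp add: h_def complex_eq_iff)
  have cross: "closed_segment p q \<inter> closed_segment r s = {m}"
  proof -
    have "z = m" if "z \<in> closed_segment p q" "z \<in> closed_segment r s" for z
    proof -
      have "h z = h m"
      proof -
        have "orient p q z = 0"
          using that(1) by (auto simp: orient_linepath simp flip: linepath_image_01)
        moreover have "orient r s z = 0"
          using that(2) by (auto simp: orient_linepath simp flip: linepath_image_01)
        ultimately show ?thesis unfolding hm by (simp add: h_def complex_eq_iff)
      qed
      then show ?thesis using inj by (simp add: inj_eq)
    qed
    moreover have "m \<in> closed_segment p q" "m \<in> closed_segment r s"
      using seg1 [OF m_W] seg2 [OF m_W] hm by simp_all
    ultimately show ?thesis by blast
  qed
  let ?c = "\<lambda>s. \<iota> (bridge_curve g a i s)" and ?d = "\<lambda>s. \<iota> (bridge_curve g a j s)" and ?e = "\<lambda>z. \<iota> (0, z)"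
  have meet: "?c ` {0..1} \<inter> ?d ` {0..1} = {?e m}"
    using bridge_curves_intersection [OF ij] cross unfolding pt by simp
  have WK: "W \<subseteq> interior K" by (auto simp: W_def)
  have hW: "homeomorphic_map (top_of_set W) (top_of_set (h ` W)) h"
  proof (rule bijective_open_imp_homeomorphic_map)
    show "open_map (top_of_set W) (top_of_set (h ` W)) h"
      unfolding open_map_def
    proof (intro allI impI)
      fix T assume "openin (top_of_set W) T"
      then have T: "open T" "T \<subseteq> W" using open_W openin_open_eq by blast+
      then have "open (h ` T)"
        using invariance_of_domain [OF cont T(1)] inj inj_on_subset by blast
      then show "openin (top_of_set (h ` W)) (h ` T)" using T by (auto intro: open_subset)
    qed
  qed (use cont inj in \<open>auto simp: inj_on_def\<close>)
  obtain f where f: "homeomorphic_maps (top_of_set W) (subtopology X (?e ` W)) ?e f"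
    using homeomorphic_plane [OF open_W WK] unfolding homeomorphic_map_maps by blast
  then have fe: "f (?e z) = z" if "z \<in> W" for z
    using that by (simp add: homeomorphic_maps_def)
  have "homeomorphic_map (subtopology X (?e ` W)) (top_of_set W) f"
    using f homeomorphic_maps_map by blast
  then have hom: "homeomorphic_map (subtopology X (?e ` W)) (top_of_set (h ` W)) (h \<circ> f)"
    using hW by (rule homeomorphic_map_compose)
  \<comment> \<open>The chart sees only the return segment of each curve, since the remaining points
    have a nonzero index.\<close>
  have image: "(h \<circ> f) ` (?e ` W \<inter> (\<lambda>s. \<iota> (bridge_curve g a l s)) ` {0..1}) = h ` (W \<inter> closed_segment (side_mid l 0) (side_mid l 1))"
    if l: "l \<in> J" for l
  proof -
    have "l \<noteq> 0" using l zero_J by metis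
    have "?e ` W \<inter> (\<lambda>s. \<iota> (bridge_curve g a l s)) ` {0..1} = \<iota> ` (Pair 0 ` W \<inter> bridge_curve g a l ` {0..1})"
      using image_Int [OF inj_chart] by (simp add: image_image)
    also have "Pair 0 ` W \<inter> bridge_curve g a l ` {0..1} = Pair 0 ` (W \<inter> closed_segment (side_mid l 0) (side_mid l 1))"
      unfolding bridge_curve_image [OF l] using \<open>l \<noteq> 0\<close> by auto
    finally have "?e ` W \<inter> (\<lambda>s. \<iota> (bridge_curve g a l s)) ` {0..1} = ?e ` (W \<inter> closed_segment (side_mid l 0) (side_mid l 1))"
      by (simp add: image_image)
    then show ?thesis by (simp only:) (force simp: fe image_image)
  qed
  have trans: "transversal_at X (?c ` {0..1}) (?d ` {0..1}) (?e m)"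
    unfolding transversal_at_def
  proof (intro exI conjI)
    show "openin X (?e ` W)" using open_W WK by (rule open_plane)
    show "?e m \<in> ?e ` W" using m_W by blast
    show "open (h ` W)" using invariance_of_domain [OF cont open_W] inj inj_on_subset by blast
    show "homeomorphic_map (subtopology X (?e ` W)) (top_of_set (h ` W)) (h \<circ> f)" by (rule hom)
    show "(h \<circ> f) (?e m) = 0" using fe [OF m_W] hm by simp
    show "(h \<circ> f) ` (?e ` W \<inter> ?c ` {0..1}) = h ` W \<inter> {z. Im z = 0}"
      unfolding image [OF ij(1)] pt [symmetric] using seg1 by blast
    show "(h \<circ> f) ` (?e ` W \<inter> ?d ` {0..1}) = h ` W \<inter> {z. Re z = 0}"
      unfolding image [OF ij(2)] pt [symmetric] using seg2 by blast
  qed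
  have "dot (curve_class X ?c) (curve_class X ?d) = of_nat (card (?c ` {0..1} \<inter> ?d ` {0..1}))"
  proof -
    have "simple_closed_curve X ?c" "simple_closed_curve X ?d"
      using simple_closed_bridge_curve [OF ij(1)] simple_closed_bridge_curve [OF ij(2)] ne unfolding pt by blast+
    moreover have "finite (?c ` {0..1} \<inter> ?d ` {0..1})" unfolding meet by simp
    moreover have "\<forall>p \<in> ?c ` {0..1} \<inter> ?d ` {0..1}. transversal_at X (?c ` {0..1}) (?d ` {0..1}) p"
      unfolding meet using trans by simp
    ultimately show ?thesis using form unfolding intersection_form_def by blast
  qed
  then show ?thesis unfolding meet by simp
qed

end

context octagon
begin

text \<open>Each handle uses five cyclically consecutive vertices b1, ..., b5: the first bridge sits
  on b1 b2 and b4 b3, the second on b2 b3 and b5 b4. This is the configuration of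
  \<open>midpoints_cross\<close>. K may be the octagon or one of its halves.\<close>

lemma crossing_bridges:
  assumes "highway_chart 2 a X \<iota> K J" and form: "intersection_form X dot"
  shows "\<lbrakk>{1, 2} \<subseteq> J; a ` {1..5} \<subseteq> K\<rbrakk> \<Longrightarrow>
      dot (curve_class X (\<lambda>s. \<iota> (bridge_curve 2 a 1 s))) (curve_class X (\<lambda>s. \<iota> (bridge_curve 2 a 2 s))) = 1"
    "\<lbrakk>{3, 4} \<subseteq> J; a ` {1, 5, 6, 7, 8} \<subseteq> K\<rbrakk> \<Longrightarrow>
      dot (curve_class X (\<lambda>s. \<iota> (bridge_curve 2 a 3 s))) (curve_class X (\<lambda>s. \<iota> (bridge_curve 2 a 4 s))) = 1"
proof -
  interpret highway_chart 2 a X \<iota> K J by fact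
  have cross: "dot (mod2_class X (bridge_chain i)) (mod2_class X (bridge_chain j)) = 1"
    if J: "i \<in> J" "j \<in> J" "i \<noteq> j"
      and mid: "side_mid i 0 = midpoint b1 b2" "side_mid i 1 = midpoint b4 b3"
        "side_mid j 0 = midpoint b2 b3" "side_mid j 1 = midpoint b5 b4"
      and b: "b1 \<in> K" "b2 \<in> K" "b3 \<in> K" "b4 \<in> K"
      and o: "orient b1 b2 b3 < 0" "orient b1 b2 b4 < 0" "orient b1 b2 b5 < 0" "orient b1 b3 b4 < 0"
    "orient b1 b3 b5 < 0" "orient b1 b4 b5 < 0" "orient b2 b3 b4 < 0" "orient b2 b3 b5 < 0"
    "orient b2 b4 b5 < 0" "orient b3 b4 b5 < 0" for b1 b2 b3 b4 b5 i j
  proof (rule intersection_crossing_bridges [OF form J mid [symmetric]])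
    show "linepath (midpoint b1 b2) (midpoint b4 b3) t \<in> interior K" if "0 < t" "t < 1" for t
      using convex_midpoints_interior [OF convex_K b _ that] o(1) by (simp add: midpoint_sym [of b4 b3])
  qed (use midpoints_cross [OF o] in auto)
  show "dot (mod2_class X (bridge_chain 1)) (mod2_class X (bridge_chain 2)) = 1"
    if "{1, 2} \<subseteq> J" "a ` {1..5} \<subseteq> K"
    by (rule cross [of 1 2 "a 1" "a 2" "a 4" "a 3" "a 5"])
      (use that side_mids orient_vertices in auto)
  \<comment> \<open>The second handle ends at vertex 1; rotating the triple brings this vertex to
    the front, where the indices increase.\<close>
  have o: "orient (a i) (a j) (a 1) < 0" if "1 < i" "i < j" "j \<le> 8" for i j
    using orient_vertices [of 1 i j] orient_cyclic [of "a 1" "a i" "a j"] that by simp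
  show "dot (mod2_class X (bridge_chain 3)) (mod2_class X (bridge_chain 4)) = 1"
    if "{3, 4} \<subseteq> J" "a ` {1, 5, 6, 7, 8} \<subseteq> K"
    by (rule cross [of 3 4 "a 5" "a 6" "a 8" "a 7" "a 1"])
      (use that side_mids orient_vertices o in auto)
qed

text \<open>Equal end points would make \<open>orient\<close> vanish, against the strict
  inequalities of \<open>midpoints_cross\<close>.\<close>

lemma bridge_mids_distinct:
  assumes "j \<in> {1..4}"
  shows "snd (glue 2 a (j, Complex 0 (1/2))) \<noteq> snd (glue 2 a (j, Complex 1 (1/2)))"
proof -
  have o: "orient (a i) (a j) (a 1) < 0" if "1 < i" "i < j" "j \<le> 8" for i j
    using orient_vertices [of 1 i j] orient_cyclic [of "a 1" "a i" "a j"] that by simp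
  have 1: "midpoint (a 1) (a 2) \<noteq> midpoint (a 4) (a 3)" "midpoint (a 2) (a 3) \<noteq> midpoint (a 5) (a 4)"
    using midpoints_cross [of "a 1" "a 2" "a 3" "a 4" "a 5"] orient_vertices by force+
  have 2: "midpoint (a 5) (a 6) \<noteq> midpoint (a 8) (a 7)" "midpoint (a 6) (a 7) \<noteq> midpoint (a 1) (a 8)"
    using midpoints_cross [of "a 5" "a 6" "a 7" "a 8" "a 1"] orient_vertices o by force+
  have "j = 1 \<or> j = 2 \<or> j = 3 \<or> j = 4" using assms by auto
  then show ?thesis using 1 2 by (elim disjE) (simp_all only: side_mids not_False_eq_True)
qed

text \<open>The chord strictly separates the return segments of the two handles.\<close>

lemma disjoint_bridges:
  assumes form: "intersection_form (double_torus a) dot" and ij: "i \<in> {1, 2}" "j \<in> {3, 4}"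
  shows "dot (curve_class (double_torus a) (\<lambda>s. (bridge_curve 2 a i s, 0)))
    (curve_class (double_torus a) (\<lambda>s. (bridge_curve 2 a j s, 0))) = 0"
proof -
  interpret highway_chart 2 a "double_torus a" "\<lambda>y. (y, 0)" P "{1..4}"
    by (rule highway_chart_double_torus)
  have "closed_segment (side_mid i 0) (side_mid i 1) \<subseteq> {z. orient (a 1) (a 5) z > 0}"
    using bridge_mid_side(1) [OF ij(1)] by (intro closed_segment_subset convex_orient) (auto simp: side_def)
  moreover have "closed_segment (side_mid j 0) (side_mid j 1) \<subseteq> {z. orient (a 1) (a 5) z < 0}"
    using bridge_mid_side(2) [OF ij(2)] by (intro closed_segment_subset convex_orient) (auto simp: side_def)
  ultimately have "closed_segment (side_mid i 0) (side_mid i 1) \<inter> closed_segment (side_mid j 0) (side_mid j 1) = {}"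
    by force
  then show ?thesis
    using ij bridge_mids_distinct by (intro intersection_disjoint_bridges [OF form]) auto
qed

end

subsection \<open>Values of quadratic forms\<close>

locale quadratic_surface =
  fixes X :: "'x topology" and dot :: "'x chain set \<Rightarrow> 'x chain set \<Rightarrow> bit" and q :: "'x chain set \<Rightarrow> bit"
  assumes form: "intersection_form X dot" and quadratic: "quadratic_form X dot q"
begin

abbreviation cl :: "'x chain \<Rightarrow> 'x chain set" where "cl \<equiv> mod2_class X"

lemma dot_add:
  assumes "x \<in> mod2_cycles 1 X" "y \<in> mod2_cycles 1 X" "z \<in> mod2_cycles 1 X"
  shows "dot (cl (x + y)) (cl z) = dot (cl x) (cl z) + dot (cl y) (cl z)"
    "dot (cl z) (cl (x + y)) = dot (cl z) (cl x) + dot (cl z) (cl y)"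
  using form mod2_class_in_homology [OF assms(1)] mod2_class_in_homology [OF assms(2)]
    mod2_class_in_homology [OF assms(3)]
  unfolding intersection_form_def Let_def mod2_class_add [symmetric] by blast+

text \<open>Additivity applied to 0 = 0 + 0 gives a value that equals its own double.\<close>

lemma dot_zero:
  assumes "x \<in> mod2_cycles 1 X"
  shows "dot (cl 0) (cl x) = 0" "dot (cl x) (cl 0) = 0"
  using dot_add [of 0 0 x] assms by simp_all

lemma quadratic_add:
  assumes "x \<in> mod2_cycles 1 X" "y \<in> mod2_cycles 1 X"
  shows "q (cl (x + y)) = q (cl x) + q (cl y) + dot (cl x) (cl y)"
  using quadratic mod2_class_in_homology [OF assms(1)] mod2_class_in_homology [OF assms(2)]
  unfolding quadratic_form_def Let_def mod2_class_add [symmetric] by blast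

lemma quadratic_zero: "q (cl 0) = 0"
  using quadratic_add [of 0 0] dot_zero [of 0] by simp

text \<open>The right-hand side mentions only the values of the form on the two curves, so it is the
  same expression in the double torus and in a capped torus.\<close>

lemma quadratic_handle:
  assumes "x \<in> mod2_cycles 1 X" "y \<in> mod2_cycles 1 X" "dot (cl x) (cl y) = 1"
  shows "q (cl ((if A then x else 0) + (if B then y else 0))) =
    (if A then q (cl x) else 0) + (if B then q (cl y) else 0) + (if A \<and> B then 1 else 0)"
  using quadratic_add [OF assms(1,2)] assms(3) quadratic_zero by simp

lemma quadratic_orthogonal:
  assumes cyc: "x \<in> mod2_cycles 1 X" "y \<in> mod2_cycles 1 X" "z \<in> mod2_cycles 1 X" "w \<in> mod2_cycles 1 X"
    and orth: "dot (cl x) (cl z) = 0" "dot (cl x) (cl w) = 0" "dot (cl y) (cl z) = 0" "dot (cl y) (cl w) = 0"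
  shows "q (cl (((if A then x else 0) + (if B then y else 0)) + ((if A' then z else 0) + (if B' then w else 0)))) =
     q (cl ((if A then x else 0) + (if B then y else 0))) + q (cl ((if A' then z else 0) + (if B' then w else 0)))"
proof -
  define x' y' z' w' where d: "x' = (if A then x else 0)" "y' = (if B then y else 0)"
    "z' = (if A' then z else 0)" "w' = (if B' then w else 0)"
  have c: "x' \<in> mod2_cycles 1 X" "y' \<in> mod2_cycles 1 X" "z' \<in> mod2_cycles 1 X" "w' \<in> mod2_cycles 1 X"
    using cyc by (simp_all add: d)
  have o: "dot (cl x') (cl z') = 0" "dot (cl x') (cl w') = 0" "dot (cl y') (cl z') = 0" "dot (cl y') (cl w') = 0"
    using orth dot_zero cyc by (simp_all add: d)
  have "dot (cl (x' + y')) (cl (z' + w')) = 0"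
    using c o by (simp add: dot_add mod2_cycles_add)
  then show ?thesis
    using quadratic_add [of "x' + y'" "z' + w'"] c by (simp add: mod2_cycles_add flip: d)
qed

end

subsection \<open>The class of an edge set\<close>

definition crossings :: "('e \<Rightarrow> nat) \<Rightarrow> ('e \<Rightarrow> nat \<Rightarrow> nat) \<Rightarrow> 'e set \<Rightarrow> nat \<Rightarrow> nat" where
  "crossings n \<kappa> E j = (\<Sum>e\<in>E. card {i. i < n e \<and> \<kappa> e i = j})"

lemma frag_cmul_sum_left: "frag_cmul (sum f I) c = (\<Sum>i\<in>I. frag_cmul (f i) c)"
  by (induction I rule: infinite_finite_induct) (auto simp: frag_cmul_distrib)

context highway_part
begin

lemma crossing_chain:
  fixes \<kappa> :: "nat \<Rightarrow> nat"
  assumes "finite J" "\<And>i. i < n \<Longrightarrow> \<kappa> i \<in> insert 0 J"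
  shows "(\<Sum>i<n. if \<kappa> i = 0 then 0 else bridge_chain (\<kappa> i)) =
     (\<Sum>j\<in>J. frag_cmul (int (card {i. i < n \<and> \<kappa> i = j})) (bridge_chain j))"
proof -
  have "(\<Sum>i<n. if \<kappa> i = 0 then 0 else bridge_chain (\<kappa> i)) =
      (\<Sum>i<n. \<Sum>j\<in>J. if \<kappa> i = j then bridge_chain j else 0)"
  proof (intro sum.cong refl)
    fix i assume "i \<in> {..<n}"
    then have "\<kappa> i = 0 \<or> \<kappa> i \<in> J" using assms(2) by simp
    then show "(if \<kappa> i = 0 then 0 else bridge_chain (\<kappa> i)) = (\<Sum>j\<in>J. if \<kappa> i = j then bridge_chain j else 0)"
      unfolding sum.delta' [OF assms(1)] using zero_J by (metis (full_types))
  qed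
  also have "\<dots> = (\<Sum>j\<in>J. \<Sum>i<n. if \<kappa> i = j then bridge_chain j else 0)"
    by (rule sum.swap)
  also have "\<dots> = (\<Sum>j\<in>J. frag_cmul (int (card {i. i < n \<and> \<kappa> i = j})) (bridge_chain j))"
  proof (intro sum.cong refl)
    fix j
    have "(\<Sum>i<n. if \<kappa> i = j then bridge_chain j else 0) = (\<Sum>i\<in>{i. i < n \<and> \<kappa> i = j}. bridge_chain j)"
    proof -
      have "(\<Sum>i\<in>{i \<in> {..<n}. \<kappa> i = j}. bridge_chain j) = (\<Sum>i<n. if \<kappa> i = j then bridge_chain j else 0)"
        by (rule sum.inter_filter) simp
      moreover have "{i \<in> {..<n}. \<kappa> i = j} = {i. i < n \<and> \<kappa> i = j}" by auto
      ultimately show ?thesis by metis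
    qed
    then show "(\<Sum>i<n. if \<kappa> i = j then bridge_chain j else 0) =
        frag_cmul (int (card {i. i < n \<and> \<kappa> i = j})) (bridge_chain j)"
      by (simp add: frag_cmul_of_nat_sum)
  qed
  finally show ?thesis .
qed

text \<open>Summation over vertices with multiplicity counts a loop twice, exactly as the degree
  does.\<close>

lemma ends_chain:
  assumes V: "finite V" "set_mset M \<subseteq> V" and M: "image_mset pos M = {#x, y#}"
  shows "spoke c (snd x) + spoke c (snd y) = (\<Sum>v\<in>V. frag_cmul (int (count M v)) (spoke c (snd (pos v))))"
proof -
  have "spoke c (snd x) + spoke c (snd y) = (\<Sum>p\<in>#image_mset pos M. spoke c (snd p))"
    unfolding M by simp
  also have "\<dots> = (\<Sum>v\<in>#M. spoke c (snd (pos v)))" by (simp add: image_mset.compositionality o_def)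
  also have "\<dots> = (\<Sum>v\<in>V. frag_cmul (int (count M v)) (spoke c (snd (pos v))))"
    using V
  proof (induction M)
    case (add u M)
    have "(\<Sum>v\<in>V. frag_cmul (int (count (add_mset u M) v)) (spoke c (snd (pos v)))) =
        (\<Sum>v\<in>V. (if u = v then spoke c (snd (pos v)) else 0) + frag_cmul (int (count M v)) (spoke c (snd (pos v))))"
      by (intro sum.cong refl) (simp add: frag_cmul_distrib)
    also have "\<dots> = spoke c (snd (pos u)) + (\<Sum>v\<in>V. frag_cmul (int (count M v)) (spoke c (snd (pos v))))"
      using add.prems by (simp add: sum.distrib sum.delta')
    finally show ?case using add by simp
  qed simp
  finally show ?thesis .
qed

text \<open>Interchanging the sums makes the number of crossings the coefficient of a bridge and the
  degree of a vertex the coefficient of its spoke; modulo 2 only the parities remain.\<close>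

lemma edge_set_homologous:
  assumes J: "finite J" and c: "c \<in> K" and V: "finite V" "\<And>v. v \<in> V \<Longrightarrow> snd (pos v) \<in> K"
    and E: "\<And>e. e \<in> E \<Longrightarrow> set_mset (ends G e) \<subseteq> V"
      "\<And>e. e \<in> E \<Longrightarrow> image_mset pos (ends G e) = {#\<gamma> e 0, \<gamma> e 1#}"
      "\<And>e. e \<in> E \<Longrightarrow> highway_subdivision g a (\<gamma> e) (n e) (t e) (\<kappa> e)"
      "\<And>e. e \<in> E \<Longrightarrow> pathin X (\<lambda>s. \<iota> (\<gamma> e s))"
      "\<And>e i. \<lbrakk>e \<in> E; i < n e\<rbrakk> \<Longrightarrow> \<kappa> e i \<in> insert 0 J"
      "\<And>e s. \<lbrakk>e \<in> E; s \<in> {0..1}; fst (\<gamma> e s) = 0\<rbrakk> \<Longrightarrow> snd (\<gamma> e s) \<in> K"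
  shows "mod2_homologous X (\<Sum>e\<in>E. frag_of (path_simplex (\<lambda>s. \<iota> (\<gamma> e s))))
    ((\<Sum>j\<in>J. if odd (crossings n \<kappa> E j) then bridge_chain j else 0) +
     (\<Sum>v\<in>V. if odd (degree_in G E v) then spoke c (snd (pos v)) else 0))"
proof -
  let ?b = "\<lambda>e. \<Sum>j\<in>J. frag_cmul (int (card {i. i < n e \<and> \<kappa> e i = j})) (bridge_chain j)"
    and ?d = "\<lambda>e. \<Sum>v\<in>V. frag_cmul (int (count (ends G e) v)) (spoke c (snd (pos v)))"
  have edge: "mod2_homologous X (frag_of (path_simplex (\<lambda>s. \<iota> (\<gamma> e s)))) (?b e + ?d e)" if e: "e \<in> E" for e
  proof -
    have end_K: "snd x \<in> K" if "x \<in># {#\<gamma> e 0, \<gamma> e 1#}" for x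
    proof -
      have "x \<in> pos ` set_mset (ends G e)" using that unfolding E(2) [OF e, symmetric] by simp
      then show ?thesis using V(2) E(1) [OF e] by blast
    qed
    have end_K: "snd (\<gamma> e 0) \<in> K" "snd (\<gamma> e 1) \<in> K"
      by (rule end_K; simp)+
    have "mod2_homologous X (frag_of (path_simplex (\<lambda>s. \<iota> (\<gamma> e s))))
       ((\<Sum>i<n e. if \<kappa> e i = 0 then 0 else bridge_chain (\<kappa> e i)) + spoke c (snd (\<gamma> e 1)) - spoke c (snd (\<gamma> e 0)))"
      using e E c by (intro highway_curve_homologous) auto
    also have "(\<Sum>i<n e. if \<kappa> e i = 0 then 0 else bridge_chain (\<kappa> e i)) = ?b e"
      using e E(5) J by (intro crossing_chain) auto
    also have "?b e + spoke c (snd (\<gamma> e 1)) - spoke c (snd (\<gamma> e 0)) = (?b e + spoke c (snd (\<gamma> e 1))) + - spoke c (snd (\<gamma> e 0))"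
      by simp
    \<comment> \<open>Modulo 2 the spoke at the initial end is added instead of subtracted, so both
      ends contribute alike to the degree.\<close>
    also have "mod2_homologous X \<dots> ((?b e + spoke c (snd (\<gamma> e 1))) + spoke c (snd (\<gamma> e 0)))"
      using c end_K by (intro mod2_homologous_add mod2_homologous_refl mod2_homologous_uminus singular_chain_spoke)
    also have "\<dots> = ?b e + ?d e"
      unfolding ends_chain [OF V(1) E(1) [OF e] E(2) [OF e], symmetric] by (simp add: algebra_simps)
    finally show ?thesis .
  qed
  have "mod2_homologous X (\<Sum>e\<in>E. frag_of (path_simplex (\<lambda>s. \<iota> (\<gamma> e s)))) (\<Sum>e\<in>E. ?b e + ?d e)"
    using edge by (rule mod2_homologous_sum)
  also have "(\<Sum>e\<in>E. ?b e + ?d e) = (\<Sum>j\<in>J. frag_cmul (int (crossings n \<kappa> E j)) (bridge_chain j)) +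
      (\<Sum>v\<in>V. frag_cmul (int (degree_in G E v)) (spoke c (snd (pos v))))"
    unfolding crossings_def degree_in_def of_nat_sum frag_cmul_sum_left sum.distrib
    by (simp add: sum.swap [of _ E])
  also have "mod2_homologous X \<dots>
    ((\<Sum>j\<in>J. if odd (crossings n \<kappa> E j) then bridge_chain j else 0) +
     (\<Sum>v\<in>V. if odd (degree_in G E v) then spoke c (snd (pos v)) else 0))"
    using V(2) c pathin_bridge_curve
    by (intro mod2_homologous_add mod2_homologous_sum mod2_homologous_cmul singular_chain_spoke singular_chain_path)
  finally show ?thesis .
qed

end

subsection \<open>The target in the capping disc\<close>

context separated
begin

text \<open>The cone over the chord is the image of a strip whose edge at height 1 collapses to the
  apex. A ray is therefore homologous to the ray over \<open>a 1\<close> followed by a spoke along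
  the chord. That fixed ray is w; it is chosen before z, so that all rays share it.\<close>

lemma target_ray:
  assumes chart: "highway_chart 2 a (capped a c U) (\<lambda>y. ((y, 0), 0)) K J" and K: "closed_segment (a 1) (a 5) \<subseteq> K"
  shows "\<exists>w. singular_chain 1 (capped a c U) w \<and> (\<forall>z\<in>closed_segment (a 1) (a 5).
     mod2_homologous (capped a c U)
      (frag_of (path_simplex (\<lambda>s. cone_point ((0, z), 0) (1 - s / 2))) +
       frag_of (path_simplex (\<lambda>s. cone_point ((0, z), 0) (1 / 2 - s / 2))))
      (w + segment_chain (\<lambda>z. (((0, z), 0), 0)) (a 1) z))"
proof -
  interpret highway_chart 2 a "capped a c U" "\<lambda>y. ((y, 0), 0)" K J by (rule chart)
  let ?T = "capped a c U" and ?A = "closed_segment (a 1) (a 5) \<times> {0..1::real}"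
  define F :: "complex \<times> real \<Rightarrow> ((nat \<times> complex) \<times> real) \<times> real" where "F = (\<lambda>(z, t). cone_point ((0::nat, z), 0::real) t)"
  have A: "convex ?A" by (intro convex_Times) auto
  have F: "continuous_map (top_of_set ?A) ?T F"
    unfolding F_def capped_def case_prod_unfold
  proof (rule continuous_map_cone_point)
    have "continuous_map (top_of_set ?A) (top_of_set P) fst"
      using chord_iff by (auto intro!: continuous_intros)
    from continuous_map_compose [OF this continuous_map_double_torus [OF continuous_map_highway_plane]]
    have "continuous_map (top_of_set ?A) (double_torus a) (\<lambda>z. ((0, fst z), 0))"
      by (simp add: o_def)
    moreover have "((0, z), 0) \<in> C" if "z \<in> closed_segment (a 1) (a 5)" for z
      using that chord_iff plane_in_curve by blast
    ultimately show "continuous_map (top_of_set ?A) (subtopology (double_torus a) (U \<union> C)) (\<lambda>z. ((0, fst z), 0))"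
      "\<And>z. z \<in> topspace (top_of_set ?A) \<Longrightarrow> ((0, fst z), 0) \<in> C \<or> snd z = 0"
      by (auto simp: continuous_map_in_subtopology)
  qed (auto intro!: continuous_intros)
  have a1: "a 1 \<in> closed_segment (a 1) (a 5)" by simp
  define w where "w = segment_chain F (a 1, 1) (a 1, 0)"
  have w: "singular_chain 1 ?T w"
    unfolding w_def using a1 by (intro singular_chain_segment [OF A F]) auto
  have "mod2_homologous ?T
      (frag_of (path_simplex (\<lambda>s. cone_point ((0, z), 0) (1 - s / 2))) +
       frag_of (path_simplex (\<lambda>s. cone_point ((0, z), 0) (1 / 2 - s / 2))))
      (w + segment_chain (\<lambda>z. (((0, z), 0), 0)) (a 1) z)" if z: "z \<in> closed_segment (a 1) (a 5)" for z
  proof -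
    have e1: "frag_of (path_simplex (\<lambda>s. cone_point ((0, z), 0) (1 - s / 2))) = segment_chain F (z, 1) (z, 1/2)"
      "frag_of (path_simplex (\<lambda>s. cone_point ((0, z), 0) (1 / 2 - s / 2))) = segment_chain F (z, 1/2) (z, 0)"
      unfolding segment_chain_def by (simp_all add: F_def linepath_def field_simps flip: scaleR_add_left)
    have "mod2_homologous ?T (segment_chain F (z, 1) (z, 1/2) + segment_chain F (z, 1/2) (z, 0))
        (segment_chain F (z, 1) (z, 0))"
      using z by (intro segment_chain_triangle [OF A F]) auto
    also have "mod2_homologous ?T \<dots> (segment_chain F (a 1, 1) (z, 0) - segment_chain F (a 1, 1) (z, 1))"
      using z a1 by (intro segment_chain_diff [OF A F]) auto
    \<comment> \<open>\<open>cone_point\<close> ignores its first argument at height 1, so this edge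
      is constant at the apex.\<close>
    also have "mod2_homologous ?T \<dots> (segment_chain F (a 1, 1) (z, 0) - 0)"
    proof (intro mod2_homologous_diff mod2_homologous_refl segment_chain_const)
      show "(undefined, 1) \<in> topspace ?T"
      proof -
        have "F (a 1, 1) \<in> topspace ?T"
          using continuous_map_image_subset_topspace [OF F] a1 by (auto simp: image_subset_iff)
        then show ?thesis by (simp add: F_def cone_point_def)
      qed
      show "F (linepath (a 1, 1) (z, 1) s) = (undefined, 1)" for s
        by (simp add: F_def linepath_def cone_point_def)
    qed
    also have "segment_chain F (a 1, 1) (z, 0) - 0 = segment_chain F (a 1, 1) (z, 0)" by simp
    also have "mod2_homologous ?T \<dots> (w + segment_chain F (a 1, 0) (z, 0))"
      unfolding w_def using z a1 by (intro mod2_homologous_sym [OF segment_chain_triangle [OF A F]]) auto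
    also have "segment_chain F (a 1, 0) (z, 0) = segment_chain (\<lambda>z. (((0, z), 0), 0)) (a 1) z"
      unfolding segment_chain_def by (simp add: F_def linepath_def)
    finally show ?thesis unfolding e1 .
  qed
  then show ?thesis using w by blast
qed

end

subsection \<open>The two sides of the graph\<close>

lemma crossings_union:
  "\<lbrakk>finite A; finite B; A \<inter> B = {}\<rbrakk> \<Longrightarrow> crossings n \<kappa> (A \<union> B) j = crossings n \<kappa> A j + crossings n \<kappa> B j"
  unfolding crossings_def by (rule sum.union_disjoint)

locale separated_graph = separated +
  fixes G :: "('v, 'e) mgraph" and pos :: "'v \<Rightarrow> nat \<times> complex" and \<gamma> :: "'e \<Rightarrow> real \<Rightarrow> nat \<times> complex"
    and k :: nat and vc :: "nat \<Rightarrow> 'v"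
  assumes finite_graph: "finite_mgraph G"
    and highway: "highway_graph 2 a G pos \<gamma>"
    and meets: "meets_in_vertices c G pos \<gamma> k vc"
begin

abbreviation part :: "((nat \<times> complex) \<times> real) set \<Rightarrow> ('v, 'e) mgraph" where
  "part U \<equiv> side_graph G pos \<gamma> k vc U"

abbreviation lift :: "'e set \<Rightarrow> nat set \<Rightarrow> 'e tedge set" where
  "lift E I \<equiv> Edge ` E \<union> Outer ` I \<union> Inner ` I"

lemma finite_G: "finite (verts G)" "finite (edges G)"
  and ends_size: "e \<in> edges G \<Longrightarrow> size (ends G e) = 2"
  and ends_verts: "e \<in> edges G \<Longrightarrow> set_mset (ends G e) \<subseteq> verts G"
  using finite_graph by (auto simp: finite_mgraph_def)

lemma pos_interior: "v \<in> verts G \<Longrightarrow> fst (pos v) = 0" "v \<in> verts G \<Longrightarrow> snd (pos v) \<in> interior P"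
  using highway by (auto simp: highway_graph_def)

lemma pos_eq: "v \<in> verts G \<Longrightarrow> pos v = (0, snd (pos v))"
  using pos_interior(1) by (simp add: prod_eq_iff)

lemma pos_P: "v \<in> verts G \<Longrightarrow> snd (pos v) \<in> P"
  using pos_interior(2) interior_subset by blast

lemma pathin_edge: "e \<in> edges G \<Longrightarrow> pathin (highway_surface 2 a) (\<gamma> e)"
  and edge_ends: "e \<in> edges G \<Longrightarrow> image_mset pos (ends G e) = {#\<gamma> e 0, \<gamma> e 1#}"
  using highway by (auto simp: highway_graph_def embedded_graph_def)

lemma pathin_edge_torus: "e \<in> edges G \<Longrightarrow> pathin (double_torus a) (\<lambda>s. (\<gamma> e s, 0))"
  using continuous_map_double_torus pathin_edge unfolding pathin_def by blast

lemma curve_vertices: "{v \<in> verts G. (pos v, 0) \<in> C} = vc ` {1..k}"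
  and edges_avoid_curve: "\<lbrakk>e \<in> edges G; s \<in> {0<..<1}\<rbrakk> \<Longrightarrow> (\<gamma> e s, 0) \<notin> C"
  using meets by (auto simp: meets_in_vertices_def)

lemma vc_vertex: "i \<in> {1..k} \<Longrightarrow> vc i \<in> verts G" "i \<in> {1..k} \<Longrightarrow> (pos (vc i), 0) \<in> C"
  using curve_vertices by auto

text \<open>The parameters of the numbered vertices increase strictly within [0,1), where the curve
  is injective.\<close>

lemma inj_vc: "inj_on vc {1..k}"
proof (rule inj_onI)
  fix i j assume ij: "i \<in> {1..k}" "j \<in> {1..k}" "vc i = vc j"
  obtain \<sigma> where \<sigma>: "strict_mono_on {1..k} \<sigma>" "\<forall>i\<in>{1..k}. \<sigma> i \<in> {0..<1} \<and> c (\<sigma> i) = (pos (vc i), 0)"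
    using meets by (auto simp: meets_in_vertices_def)
  have "inj_on c {0..<1}" using separating by (auto simp: separating_curve_def simple_closed_curve_def)
  moreover have "c (\<sigma> i) = c (\<sigma> j)" "\<sigma> i \<in> {0..<1}" "\<sigma> j \<in> {0..<1}" using \<sigma>(2) ij by auto
  ultimately have "\<sigma> i = \<sigma> j" by (auto dest: inj_onD)
  then show "i = j" using strict_mono_on_imp_inj_on [OF \<sigma>(1)] ij by (auto dest: inj_onD)
qed

lemma edge_connected:
  assumes e: "e \<in> edges G" and S: "connected S" "S \<subseteq> {0..1}" "\<And>s. s \<in> S \<Longrightarrow> (\<gamma> e s, 0) \<notin> C"
    and s: "s \<in> S" "(\<gamma> e s, 0) \<in> U" "U \<in> {U1, U2}" and t: "t \<in> S"
  shows "(\<gamma> e t, 0) \<in> U"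
proof -
  have "continuous_map (top_of_set S) (double_torus a) (\<lambda>s. (\<gamma> e s, 0))"
    using pathin_edge_torus [OF e] continuous_map_from_subtopology_mono [OF _ S(2)] unfolding pathin_def by blast
  then have "connectedin (double_torus a) ((\<lambda>s. (\<gamma> e s, 0)) ` S)"
    using S(1) by (intro connectedin_continuous_map_image) (auto simp: connectedin_subtopology)
  then have "(\<lambda>s. (\<gamma> e s, 0)) ` S \<subseteq> U"
  proof (rule connected_in_component)
    show "(\<lambda>s. (\<gamma> e s, 0)) ` S \<inter> C = {}" using S(3) by blast
    show "(\<lambda>s. (\<gamma> e s, 0)) ` S \<inter> U \<noteq> {}" using s by blast
  qed (rule s)
  then show ?thesis using t by blast
qed

lemma edge_component:
  assumes e: "e \<in> edges G"
  shows "\<exists>U\<in>{U1, U2}. \<forall>s\<in>{0<..<1}. (\<gamma> e s, 0) \<in> U"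
proof -
  have "(\<gamma> e (1/2), 0) \<in> topspace (double_torus a) - C"
    using pathin_edge_torus [OF e] edges_avoid_curve [OF e, of "1/2"]
    by (auto simp: pathin_def continuous_map_def Pi_iff)
  then have "(\<gamma> e (1/2), 0) \<in> U1 \<union> U2" by (simp only: union_U)
  then obtain U where U: "U \<in> {U1, U2}" "(\<gamma> e (1/2), 0) \<in> U" by blast
  have "(\<gamma> e s, 0) \<in> U" if s: "s \<in> {0<..<1}" for s
  proof (rule edge_connected [OF e, of "{0<..<1}" "1/2"])
    show "(\<gamma> e r, 0) \<notin> C" if "r \<in> {0<..<1}" for r using edges_avoid_curve [OF e that] .
  qed (use s U in auto)
  then show ?thesis using U by blast
qed

text \<open>An end off the curve is joined to the open edge through a half-open parameter interval
  that avoids the curve, so it lies in the same component.\<close>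

lemma edge_closure:
  assumes e: "e \<in> edges G" and U: "U \<in> {U1, U2}" "\<forall>s\<in>{0<..<1}. (\<gamma> e s, 0) \<in> U" and s: "s \<in> {0..1}"
  shows "(\<gamma> e s, 0) \<in> U \<union> C"
proof (cases "s \<in> {0<..<1} \<or> (\<gamma> e s, 0) \<in> C")
  case False
  then have C: "(\<gamma> e s, 0) \<notin> C" and "s = 0 \<or> s = 1" using s by auto
  then have "connected (insert s {0<..<1})"
  proof (elim disjE)
    assume "s = 0"
    then have "insert s {0<..<1} = {0..<1}" by auto
    then show ?thesis by simp
  next
    assume "s = 1"
    then have "insert s {0<..<1} = {0<..1}" by auto
    then show ?thesis by simp
  qed
  then have "(\<gamma> e s, 0) \<in> U"
  proof (rule edge_connected [OF e])
    show "(\<gamma> e r, 0) \<notin> C" if "r \<in> insert s {0<..<1}" for r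
      using edges_avoid_curve [OF e, of r] C that by (metis insertE)
    show "(\<gamma> e (1/2), 0) \<in> U" "1/2 \<in> insert s {0<..<1}" using U(2) by auto
  qed (use s U(1) in auto)
  then show ?thesis by (rule UnI1)
next
  case True
  then show ?thesis using U(2) by (metis UnCI)
qed

lemma edges_part: "edges (part U) = {e \<in> edges G. \<forall>s\<in>{0<..<1}. (\<gamma> e s, 0) \<in> U}"
  and verts_part: "verts (part U) = {v \<in> verts G. (pos v, 0) \<in> U} \<union> vc ` {1..k}"
  and ends_part: "ends (part U) = ends G"
  by (simp_all add: side_graph_def)

lemma degree_part: "degree_in (part U) = degree_in G"
  by (simp add: degree_in_def ends_part fun_eq_iff)

lemma verts_part_subset: "verts (part U) \<subseteq> verts G"
  using vc_vertex by (auto simp: verts_part)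

lemma edges_union: "edges G = edges (part U1) \<union> edges (part U2)"
  using edge_component by (auto simp: edges_part)

lemma edges_disjoint: "edges (part U1) \<inter> edges (part U2) = {}"
proof -
  have "(1/2 :: real) \<in> {0<..<1}" by simp
  then show ?thesis using disjoint_U unfolding edges_part by blast
qed

lemma ends_in_part:
  assumes e: "e \<in> edges (part U)" and U: "U \<in> {U1, U2}"
  shows "set_mset (ends G e) \<subseteq> verts (part U)"
proof
  fix v assume v: "v \<in># ends G e"
  have eG: "e \<in> edges G" using e by (simp add: edges_part)
  then have vG: "v \<in> verts G" using ends_verts v by blast
  have "pos v \<in># {#\<gamma> e 0, \<gamma> e 1#}" using v unfolding edge_ends [OF eG, symmetric] by simp
  then have "\<exists>s\<in>{0, 1}. pos v = \<gamma> e s" by auto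
  then obtain s where s': "s \<in> {0, 1}" "pos v = \<gamma> e s" by (elim bexE)
  then have s: "s \<in> {0..1}" "pos v = \<gamma> e s" by auto
  have "\<forall>s\<in>{0<..<1}. (\<gamma> e s, 0) \<in> U" using e unfolding edges_part by blast
  then have "(pos v, 0) \<in> U \<union> C" unfolding s(2) using s(1) by (rule edge_closure [OF eG U])
  moreover have "v \<in> vc ` {1..k}" if "(pos v, 0) \<in> C"
    using that vG unfolding curve_vertices [symmetric] by simp
  ultimately show "v \<in> verts (part U)" using vG unfolding verts_part by blast
qed

lemma degree_zero:
  assumes "E \<subseteq> edges (part U)" "U \<in> {U1, U2}" "v \<notin> verts (part U)"
  shows "degree_in G E v = 0"
  using ends_in_part assms unfolding degree_in_def
  by (intro sum.neutral) (meson count_eq_zero_iff subsetD ballI)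

lemma verts_disjoint:
  assumes "v \<in> verts (part U1)" "v \<in> verts (part U2)"
  shows "v \<in> vc ` {1..k}"
  using assms disjoint_U by (auto simp: verts_part)

lemma subdivisions:
  "\<exists>n t \<kappa>. \<forall>e\<in>edges G. highway_subdivision 2 a (\<gamma> e) (n e) (t e) (\<kappa> e)"
proof -
  have "\<forall>e\<in>edges G. \<exists>n t \<kappa>. highway_subdivision 2 a (\<gamma> e) n t \<kappa>"
    using highway highway_curve_subdivision by (auto simp: highway_graph_def)
  then show ?thesis by metis
qed

lemma edge_plane_P: "\<lbrakk>e \<in> edges G; s \<in> {0..1}; fst (\<gamma> e s) = 0\<rbrakk> \<Longrightarrow> snd (\<gamma> e s) \<in> P"
proof -
  assume e: "e \<in> edges G" "s \<in> {0..1}" "fst (\<gamma> e s) = 0"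
  then have "\<gamma> e s \<in> topspace (highway_surface 2 a)"
    using pathin_edge by (auto simp: pathin_def continuous_map_def Pi_iff)
  then show ?thesis using plane_in_highway_iff [of "snd (\<gamma> e s)"] e(3) by (metis prod.collapse)
qed

end

section \<open>Classes of even sets and of their lifts\<close>

text \<open>One subdivision per edge is fixed for all three surfaces, so that the crossing numbers
  of the two parts of an edge set add up to those of the whole.\<close>

locale subdivided_graph = separated_graph +
  fixes n :: "'b \<Rightarrow> nat" and t :: "'b \<Rightarrow> nat \<Rightarrow> real" and \<kappa> :: "'b \<Rightarrow> nat \<Rightarrow> nat"
  assumes subdivision: "e \<in> edges G \<Longrightarrow> highway_subdivision 2 a (\<gamma> e) (n e) (t e) (\<kappa> e)"
begin

text \<open>All degrees are even, so no spoke survives in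
  \<open>edge_set_homologous\<close>.\<close>

lemma class_even_set:
  assumes E: "E \<in> even_sets G"
  shows "edge_set_class (double_torus a) (\<lambda>e s. (\<gamma> e s, 0)) E =
    mod2_class (double_torus a) (\<Sum>j\<in>{1..4}. if odd (crossings n \<kappa> E j)
      then frag_of (path_simplex (\<lambda>s. (bridge_curve 2 a j s, 0))) else 0)"
proof -
  interpret D: highway_chart 2 a "double_torus a" "\<lambda>y. (y, 0)" P "{1..4}"
    by (rule highway_chart_double_torus)
  have EG: "e \<in> edges G" if "e \<in> E" for e using E that by (auto simp: even_sets_def)
  have even: "even (degree_in G E v)" if "v \<in> verts G" for v using E that by (auto simp: even_sets_def)
  have "mod2_homologous (double_torus a) (\<Sum>e\<in>E. frag_of (path_simplex (\<lambda>s. (\<gamma> e s, 0))))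
    ((\<Sum>j\<in>{1..4}. if odd (crossings n \<kappa> E j) then D.bridge_chain j else 0) +
     (\<Sum>v\<in>verts G. if odd (degree_in G E v) then D.spoke (a 1) (snd (pos v)) else 0))"
  proof (rule D.edge_set_homologous [where t = t])
    show "\<kappa> e i \<in> insert 0 {1..4}" if "e \<in> E" "i < n e" for e i
      using subdivision [OF EG [OF that(1)]] that(2) by (auto simp: highway_subdivision_def split: if_splits)
  qed (use EG finite_G pos_P ends_verts edge_ends subdivision pathin_edge_torus edge_plane_P vertex_in_polygon in auto)
  moreover have "(\<Sum>v\<in>verts G. if odd (degree_in G E v) then D.spoke (a 1) (snd (pos v)) else 0) = 0"
    using even by (intro sum.neutral) auto
  ultimately show ?thesis
    unfolding edge_set_class_def by (intro mod2_class_eqI) simp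
qed

lemma crossed_bridges:
  assumes e: "e \<in> edges (part U)" and i: "i < n e"
    and J: "\<And>j z. \<lbrakk>j \<in> {1..4}; j \<notin> J; z \<in> rectangle\<rbrakk> \<Longrightarrow> (glue 2 a (j, z), 0) \<notin> U"
  shows "\<kappa> e i \<in> insert 0 J"
proof (rule ccontr)
  assume notin: "\<kappa> e i \<notin> insert 0 J"
  have eG: "e \<in> edges G" using e by (simp add: edges_part)
  note sub = subdivision [OF eG]
  have \<kappa>: "\<kappa> e i \<in> {1..4}" "bridge_piece 2 a (\<kappa> e i) (\<gamma> e) (t e i) (t e (Suc i))" "t e i < t e (Suc i)"
    using sub i notin by (auto simp: highway_subdivision_def split: if_splits)
  obtain f where f: "f ` {t e i..t e (Suc i)} = closed_segment (f (t e i)) (f (t e (Suc i)))"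
      "f (t e i) \<in> rectangle" "f (t e (Suc i)) \<in> rectangle"
      "\<forall>s\<in>{t e i..t e (Suc i)}. \<gamma> e s = glue 2 a (\<kappa> e i, f s)"
    using \<kappa>(2) by (auto simp: bridge_piece_def)
  \<comment> \<open>The midpoint of the piece is on the bridge and also on the open edge, even when
    the piece contains an end of the edge.\<close>
  define s where "s = (t e i + t e (Suc i)) / 2"
  have "0 \<le> t e i" "t e (Suc i) \<le> 1" using highway_subdivision_range [OF sub] i by auto
  then have s: "s \<in> {t e i..t e (Suc i)}" "s \<in> {0<..<1}" using \<kappa>(3) by (auto simp: s_def field_simps)
  have "convex rectangle"
    using highway_chart_double_torus highway_part.convex_rectangle highway_chart.axioms(1) by blast
  then have "f s \<in> rectangle" using f(1-3) s(1) closed_segment_subset by blast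
  then have "(\<gamma> e s, 0) \<notin> U" using J [OF \<kappa>(1)] notin f(4) s(1) by auto
  then show False using e s(2) by (auto simp: edges_part)
qed

text \<open>The edges leave one spoke at each odd vertex \<open>vc i\<close>, i in I, and the ray
  over i contributes w and the same spoke. So every spoke occurs twice, and w occurs
  \<open>card I\<close> times, an even number.\<close>

lemma class_lift:
  assumes chart: "highway_chart 2 a (capped a c U) (\<lambda>y. ((y, 0), 0)) K J"
    and K: "\<And>z. \<lbrakk>z \<in> P; ((0, z), 0) \<in> U \<union> C\<rbrakk> \<Longrightarrow> z \<in> K" and J: "finite J"
      "\<And>j z. \<lbrakk>j \<in> {1..4}; j \<notin> J; z \<in> rectangle\<rbrakk> \<Longrightarrow> (glue 2 a (j, z), 0) \<notin> U"
    and U: "U \<in> {U1, U2}" and E: "E \<subseteq> edges (part U)" and I: "I \<subseteq> {1..k}" "even (card I)"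
    and odd: "\<And>v. v \<in> verts (part U) \<Longrightarrow> odd (degree_in G E v) \<longleftrightarrow> v \<in> vc ` I"
  shows "edge_set_class (capped a c U) (target_curve pos \<gamma> vc) (lift E I) =
    mod2_class (capped a c U) (\<Sum>j\<in>J. if odd (crossings n \<kappa> E j)
      then frag_of (path_simplex (\<lambda>s. ((bridge_curve 2 a j s, 0), 0))) else 0)"
proof -
  let ?T = "capped a c U"
  interpret D: highway_chart 2 a ?T "\<lambda>y. ((y, 0), 0)" K J by (rule chart)
  let ?S = "\<lambda>v. D.spoke (a 1) (snd (pos v))"
  define B where "B = (\<Sum>j\<in>J. if odd (crossings n \<kappa> E j) then D.bridge_chain j else 0)"
  have EG: "e \<in> edges G" if "e \<in> E" for e using E that by (auto simp: edges_part)
  have chord: "closed_segment (a 1) (a 5) \<subseteq> K" using chord_iff plane_in_curve K by blast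
  then have a1: "a 1 \<in> K" by auto
  have closure: "(\<gamma> e s, 0) \<in> U \<union> C" if "e \<in> E" "s \<in> {0..1}" for e s
    using that EG E U by (intro edge_closure) (auto simp: edges_part)
  have pathin: "pathin ?T (\<lambda>s. ((\<gamma> e s, 0), 0))" if "e \<in> E" for e
    unfolding pathin_def capped_def
    using pathin_edge_torus [OF EG [OF that]] closure [OF that]
    by (intro continuous_map_cone_off) (auto simp: continuous_map_in_subtopology pathin_def)
  have plane: "snd (\<gamma> e s) \<in> K" if "e \<in> E" "s \<in> {0..1}" "fst (\<gamma> e s) = 0" for e s
  proof (rule K)
    show "snd (\<gamma> e s) \<in> P" using edge_plane_P that EG by blast
    show "((0, snd (\<gamma> e s)), 0) \<in> U \<union> C" using closure [OF that(1,2)] that(3) by (metis prod.collapse)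
  qed
  have V_K: "snd (pos v) \<in> K" if "v \<in> verts (part U)" for v
  proof (rule K)
    show "snd (pos v) \<in> P" using pos_P that verts_part_subset by blast
    have "(pos v, 0) \<in> U \<union> C" using that vc_vertex by (auto simp: verts_part)
    moreover have "pos v = (0, snd (pos v))" using pos_eq that verts_part_subset by blast
    ultimately show "((0, snd (pos v)), 0) \<in> U \<union> C" by (simp only:)
  qed
  have edges: "mod2_homologous ?T (\<Sum>e\<in>E. frag_of (path_simplex (\<lambda>s. ((\<gamma> e s, 0), 0))))
    (B + (\<Sum>v\<in>verts (part U). if odd (degree_in G E v) then ?S v else 0))"
    unfolding B_def
  proof (rule D.edge_set_homologous [where t = t])
    show "finite (verts (part U))" using finite_G verts_part_subset finite_subset by blast
    show "\<kappa> e i \<in> insert 0 J" if "e \<in> E" "i < n e" for e i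
      using that E J(2) by (intro crossed_bridges [of e U]) auto
    show "set_mset (ends G e) \<subseteq> verts (part U)" if "e \<in> E" for e using ends_in_part that E U by blast
  qed (use J(1) a1 V_K EG edge_ends subdivision pathin plane in auto)
  have fin: "finite E" "finite I"
    using E finite_G I finite_subset [of E "edges G"] finite_subset [of I "{1..k}"] by (auto simp: edges_part)
  have "(\<Sum>v\<in>verts (part U). if odd (degree_in G E v) then ?S v else 0) =
      (\<Sum>v\<in>verts (part U). if v \<in> vc ` I then ?S v else 0)"
    using odd by (intro sum.cong) auto
  also have "\<dots> = (\<Sum>v\<in>vc ` I. ?S v)"
  proof -
    have "vc ` I \<subseteq> verts (part U)" "finite (verts (part U))"
      using I finite_G verts_part_subset finite_subset by (auto simp: verts_part)
    then show ?thesis by (simp add: sum.If_cases Int_absorb1)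
  qed
  also have "\<dots> = (\<Sum>i\<in>I. ?S (vc i))"
    using inj_on_subset [OF inj_vc I(1)] by (simp add: sum.reindex)
  finally have odd_sum: "(\<Sum>v\<in>verts (part U). if odd (degree_in G E v) then ?S v else 0) = (\<Sum>i\<in>I. ?S (vc i))" .
  obtain w where w: "singular_chain 1 ?T w" and ray: "\<And>z. z \<in> closed_segment (a 1) (a 5) \<Longrightarrow>
     mod2_homologous ?T
      (frag_of (path_simplex (\<lambda>s. cone_point ((0, z), 0) (1 - s / 2))) +
       frag_of (path_simplex (\<lambda>s. cone_point ((0, z), 0) (1 / 2 - s / 2))))
      (w + D.spoke (a 1) z)"
    using target_ray [OF chart chord] by blast
  let ?c = "\<lambda>d. frag_of (path_simplex (target_curve pos \<gamma> vc d))"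
  have target: "mod2_homologous ?T (?c (Outer i) + ?c (Inner i)) (w + ?S (vc i))" if i: "i \<in> I" for i
  proof -
    have iv: "vc i \<in> verts G" "(pos (vc i), 0) \<in> C" using vc_vertex i I by auto
    then have "snd (pos (vc i)) \<in> closed_segment (a 1) (a 5)"
      using chord_iff plane_in_curve pos_P pos_eq by metis
    from ray [OF this] show ?thesis
      using pos_eq [OF iv(1)] by (simp add: target_curve_def [abs_def])
  qed
  have "(\<Sum>d\<in>lift E I. ?c d) = (\<Sum>d\<in>Edge ` E. ?c d) + (\<Sum>d\<in>Outer ` I. ?c d) + (\<Sum>d\<in>Inner ` I. ?c d)"
    using fin by (subst sum.union_disjoint; auto)+
  also have "\<dots> = (\<Sum>e\<in>E. ?c (Edge e)) + (\<Sum>i\<in>I. ?c (Outer i) + ?c (Inner i))"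
    by (simp add: sum.reindex inj_on_def sum.distrib add.assoc)
  also have "(\<Sum>e\<in>E. ?c (Edge e)) = (\<Sum>e\<in>E. frag_of (path_simplex (\<lambda>s. ((\<gamma> e s, 0), 0))))"
    by (simp add: target_curve_def [abs_def])
  also have "mod2_homologous ?T (\<dots> + (\<Sum>i\<in>I. ?c (Outer i) + ?c (Inner i)))
      ((B + (\<Sum>i\<in>I. ?S (vc i))) + (\<Sum>i\<in>I. w + ?S (vc i)))"
    by (rule mod2_homologous_add [OF edges [unfolded odd_sum] mod2_homologous_sum [OF target]])
  also have "\<dots> = B + ((\<Sum>i\<in>I. ?S (vc i)) + (\<Sum>i\<in>I. ?S (vc i))) + frag_cmul (int (card I)) w"
    by (simp add: frag_cmul_of_nat_sum [OF fin(2)] sum.distrib algebra_simps)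
  also have "mod2_homologous ?T \<dots> (B + 0 + 0)"
  proof (intro mod2_homologous_add mod2_homologous_refl)
    have "singular_chain 1 ?T (\<Sum>i\<in>I. ?S (vc i))"
      using V_K a1 I by (intro singular_chain_sum D.singular_chain_spoke) (auto simp: verts_part)
    then show "mod2_homologous ?T ((\<Sum>i\<in>I. ?S (vc i)) + (\<Sum>i\<in>I. ?S (vc i))) 0"
      by (simp add: mod2_homologous_def mod2_boundaries_double)
    show "mod2_homologous ?T (frag_cmul (int (card I)) w) 0"
      using mod2_homologous_cmul [OF w, of "card I"] I(2) by simp
  qed
  finally show ?thesis
    unfolding edge_set_class_def by (intro mod2_class_eqI) (simp add: B_def)
qed

end

subsection \<open>Even sets of a graph with the target\<close>

lemma degree_in_union:
  "\<lbrakk>finite A; finite B; A \<inter> B = {}\<rbrakk> \<Longrightarrow> degree_in G (A \<union> B) v = degree_in G A v + degree_in G B v"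
  unfolding degree_in_def by (rule sum.union_disjoint)

text \<open>Outer and inner edges are indexed by separate sets; their equality for even sets is to
  be read off from the degrees of the middle vertices.\<close>

lemma degree_attach_target:
  fixes H :: "('v, 'e) mgraph"
  assumes "finite E" "finite O'" "finite N"
  defines "D \<equiv> Edge ` E \<union> Outer ` O' \<union> Inner ` N"
  shows "degree_in (attach_target k vc H) D (Vert v) = degree_in H E v + card {i \<in> N. vc i = v}"
    "degree_in (attach_target k vc H) D (Mid i) = (if i \<in> O' then 1 else 0) + (if i \<in> N then 1 else 0)"
    "degree_in (attach_target k vc H) D Hub = card O'"
proof -
  have D: "degree_in (attach_target k vc H) D x =
    (\<Sum>e\<in>E. count (image_mset Vert (ends H e)) x) + (\<Sum>j\<in>O'. count {#Hub, Mid j#} x)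
      + (\<Sum>j\<in>N. count {#Mid j, Vert (vc j)#} x)" for x
  proof -
    have "degree_in (attach_target k vc H) D x = degree_in (attach_target k vc H) (Edge ` E) x
        + degree_in (attach_target k vc H) (Outer ` O') x + degree_in (attach_target k vc H) (Inner ` N) x"
      unfolding D_def using assms(1-3) by (subst degree_in_union; auto)+
    then show ?thesis
      by (simp add: degree_in_def attach_target_def sum.reindex inj_on_def)
  qed
  have cnt: "count (image_mset Vert M) (Vert v) = count M v" "count (image_mset Vert M) (Mid i) = 0"
    "count (image_mset Vert M) Hub = 0" for M :: "'v multiset" and v i
    by (induction M) auto
  have cnt2: "count {#Mid j, Vert w#} (Vert v) = (if w = v then 1 else 0)"
    "count {#Hub, Mid j#} (Vert v) = 0" "count {#Mid j, Vert w#} (Mid i) = (if j = i then 1 else 0)"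
    "count {#Hub, Mid j#} (Mid i) = (if j = i then 1 else 0)" "count {#Mid j, Vert w#} Hub = 0"
    "count {#Hub, Mid j#} (Hub :: 'v tvert) = 1" for v w :: 'v and i j
    by simp_all
  have "(\<Sum>j\<in>N. if vc j = v then 1 else 0) = card {i \<in> N. vc i = v}"
    using sum.inter_filter [OF assms(3), of "\<lambda>_. 1::nat" "\<lambda>j. vc j = v"] by simp
  then show "degree_in (attach_target k vc H) D (Vert v) = degree_in H E v + card {i \<in> N. vc i = v}"
    unfolding D cnt cnt2 by (simp add: degree_in_def [of H])
  show "degree_in (attach_target k vc H) D (Mid i) = (if i \<in> O' then 1 else 0) + (if i \<in> N then 1 else 0)"
    unfolding D cnt cnt2 using assms(2,3) by (simp only: sum.delta sum.neutral_const)
  show "degree_in (attach_target k vc H) D Hub = card O'"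
    unfolding D cnt cnt2 by simp
qed

context separated_graph
begin

text \<open>Evenness of \<open>lift E I\<close> expressed without the target: \<open>card I\<close>
  is the degree of the hub, and each ray used changes the parity at its vertex on the curve.\<close>

definition admissible :: "((nat \<times> complex) \<times> real) set \<Rightarrow> 'e set \<Rightarrow> nat set \<Rightarrow> bool" where
  "admissible U E I \<longleftrightarrow> E \<subseteq> edges (part U) \<and> I \<subseteq> {1..k} \<and> even (card I) \<and>
     (\<forall>v\<in>verts (part U). odd (degree_in G E v) \<longleftrightarrow> v \<in> vc ` I)"

lemma finite_part: "finite (edges (part U))" "finite (verts (part U))"
  using finite_G(2) finite_subset [OF verts_part_subset finite_G(1)] by (auto simp: edges_part)

lemma card_vc:
  assumes "I \<subseteq> {1..k}"
  shows "card {i \<in> I. vc i = v} = (if v \<in> vc ` I then 1 else 0)"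
proof (cases "v \<in> vc ` I")
  case True
  then obtain j where j: "j \<in> I" "v = vc j" by auto
  then have "{i \<in> I. vc i = v} = {j}" using inj_on_subset [OF inj_vc assms] by (auto dest: inj_onD)
  then show ?thesis using True by simp
next
  case False
  then have "{i \<in> I. vc i = v} = {}" by auto
  then show ?thesis using False by (simp only: card.empty if_False)
qed

text \<open>Evenness at a middle vertex says that the path through it is used entirely or not at
  all, which is why one set I suffices.\<close>

lemma even_sets_attach_target:
  "D \<in> even_sets (attach_target k vc (part U)) \<longleftrightarrow> (\<exists>E I. D = lift E I \<and> admissible U E I)"
proof
  assume "D \<in> even_sets (attach_target k vc (part U))"
  then have D: "D \<subseteq> edges (attach_target k vc (part U))"
    and even: "\<And>x. x \<in> verts (attach_target k vc (part U)) \<Longrightarrow> even (degree_in (attach_target k vc (part U)) D x)"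
    by (auto simp: even_sets_def)
  define E O' N where "E = {e. Edge e \<in> D}" and "O' = {i. Outer i \<in> D}" and "N = {i. Inner i \<in> D}"
  have sub: "E \<subseteq> edges (part U)" "O' \<subseteq> {1..k}" "N \<subseteq> {1..k}"
    using D by (auto simp: E_def O'_def N_def attach_target_def)
  have fin: "finite E" "finite O'" "finite N"
    using sub finite_part by (auto intro: finite_subset)
  have DE: "D = Edge ` E \<union> Outer ` O' \<union> Inner ` N"
  proof -
    have "d \<in> D \<longleftrightarrow> d \<in> Edge ` E \<union> Outer ` O' \<union> Inner ` N" for d
      by (cases d) (auto simp: E_def O'_def N_def)
    then show ?thesis by blast
  qed
  note deg = degree_attach_target [OF fin, folded DE]
  have "O' = N"
  proof -
    have "i \<in> O' \<longleftrightarrow> i \<in> N" if "i \<in> {1..k}" for i :: nat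
      using even [of "Mid i"] that unfolding deg by (auto simp: attach_target_def split: if_splits)
    then show ?thesis using sub by blast
  qed
  have "even (card N)"
  \<comment> \<open>For k = 0 the target has no hub, and the set of rays is empty.\<close>
  proof (cases "k = 0")
    case True
    then show ?thesis using sub by simp
  next
    case False
    then have "1 \<in> {1..k}" by simp
    then have "Hub \<in> verts (attach_target k vc (part U))" unfolding attach_target_def by auto
    then show ?thesis using even [of Hub] unfolding deg \<open>O' = N\<close> by simp
  qed
  moreover have "odd (degree_in G E v) \<longleftrightarrow> v \<in> vc ` N" if "v \<in> verts (part U)" for v
    using even [of "Vert v"] that unfolding deg degree_part card_vc [OF sub(3)]
    by (auto simp: attach_target_def split: if_splits)
  ultimately have "admissible U E N" using sub by (auto simp: admissible_def)
  then show "\<exists>E I. D = lift E I \<and> admissible U E I" using DE \<open>O' = N\<close> by blast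
next
  assume "\<exists>E I. D = lift E I \<and> admissible U E I"
  then obtain E I where D: "D = lift E I" and adm: "admissible U E I" by blast
  have sub: "E \<subseteq> edges (part U)" "I \<subseteq> {1..k}" using adm by (auto simp: admissible_def)
  then have fin: "finite E" "finite I" using finite_part by (auto intro: finite_subset)
  note deg = degree_attach_target [OF fin fin(2), folded D]
  have "even (degree_in (attach_target k vc (part U)) D x)" if "x \<in> verts (attach_target k vc (part U))" for x
  proof (cases x)
    case (Vert v)
    then have "v \<in> verts (part U)" using that by (auto simp: attach_target_def)
    then show ?thesis
      using adm unfolding Vert deg degree_part card_vc [OF sub(2)] admissible_def by auto
  next
    case (Mid i)
    then show ?thesis unfolding Mid deg by auto
  next
    case Hub
    then show ?thesis using adm unfolding Hub deg admissible_def by blast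
  qed
  moreover have "D \<subseteq> edges (attach_target k vc (part U))"
    using sub unfolding D by (auto simp: attach_target_def)
  ultimately show "D \<in> even_sets (attach_target k vc (part U))" by (auto simp: even_sets_def)
qed

text \<open>For even E the edges in the second part have the same odd vertices on the curve, so the
  first part may serve for both.\<close>

definition odd_cut :: "'e set \<Rightarrow> nat set" where
  "odd_cut E = {i \<in> {1..k}. odd (degree_in G (E \<inter> edges (part U1)) (vc i))}"

lemma degree_split:
  assumes "E \<subseteq> edges G"
  shows "degree_in G E v = degree_in G (E \<inter> edges (part U1)) v + degree_in G (E \<inter> edges (part U2)) v"
proof -
  have "degree_in G E v = degree_in G ((E \<inter> edges (part U1)) \<union> (E \<inter> edges (part U2))) v"
    using assms edges_union by (intro arg_cong2 [where f = "degree_in G"]) auto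
  also have "\<dots> = degree_in G (E \<inter> edges (part U1)) v + degree_in G (E \<inter> edges (part U2)) v"
    using finite_part edges_disjoint by (intro degree_in_union) auto
  finally show ?thesis .
qed

text \<open>The handshake lemma inside one part: its edges have both ends among its vertices, so the
  degrees sum to twice the number of edges.\<close>

lemma even_card_odd_cut:
  assumes "E \<subseteq> edges (part U)" "U \<in> {U1, U2}"
  shows "even (card {v \<in> verts (part U). odd (degree_in G E v)})"
proof -
  have "(\<Sum>v\<in>verts (part U). degree_in G E v) = (\<Sum>e\<in>E. \<Sum>v\<in>verts (part U). count (ends G e) v)"
    unfolding degree_in_def by (rule sum.swap)
  also have "\<dots> = (\<Sum>e\<in>E. 2)"
  proof (intro sum.cong refl)
    fix e assume "e \<in> E"
    then have e: "e \<in> edges (part U)" "e \<in> edges G" using assms by (auto simp: edges_part)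
    have "(\<Sum>v\<in>verts (part U). count (ends G e) v) = (\<Sum>v\<in>set_mset (ends G e). count (ends G e) v)"
      using finite_part ends_in_part [OF e(1) assms(2)]
      by (intro sum.mono_neutral_right) (auto simp: count_eq_zero_iff)
    then show "(\<Sum>v\<in>verts (part U). count (ends G e) v) = 2"
      using ends_size [OF e(2)] by (simp add: size_multiset_overloaded_eq)
  qed
  finally have "even (\<Sum>v\<in>verts (part U). degree_in G E v)" by simp
  then show ?thesis using even_sum_iff [OF finite_part(2)] by blast
qed

text \<open>A vertex off the curve meets edges of one part only and keeps its even degree; at a
  vertex on the curve the two partial degrees have equal parity. The handshake lemma in the first
  part makes the number of rays even.\<close>

lemma split_admissible:
  assumes E: "E \<in> even_sets G"
  shows "admissible U1 (E \<inter> edges (part U1)) (odd_cut E)" "admissible U2 (E \<inter> edges (part U2)) (odd_cut E)"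
proof -
  let ?E1 = "E \<inter> edges (part U1)" and ?E2 = "E \<inter> edges (part U2)"
  have EG: "E \<subseteq> edges G" and even: "\<And>v. v \<in> verts G \<Longrightarrow> even (degree_in G E v)"
    using E by (auto simp: even_sets_def)
  have parity: "odd (degree_in G ?E1 v) \<longleftrightarrow> odd (degree_in G ?E2 v)" if "v \<in> verts G" for v
    using even [OF that] degree_split [OF EG, of v] by auto
  have cut: "odd (degree_in G ?E1 v) \<longleftrightarrow> v \<in> vc ` odd_cut E" if v: "v \<in> verts G" for v
  proof (cases "v \<in> vc ` {1..k}")
    case True
    then show ?thesis using inj_vc by (auto simp: odd_cut_def dest: inj_onD)
  next
    case False
    then have "v \<notin> verts (part U1) \<or> v \<notin> verts (part U2)" using verts_disjoint by blast
    then have "degree_in G ?E1 v = 0 \<or> degree_in G ?E2 v = 0"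
      using degree_zero [of ?E1 U1 v] degree_zero [of ?E2 U2 v] by auto
    then have "even (degree_in G ?E1 v)" using parity [OF v] by auto
    moreover have "v \<notin> vc ` odd_cut E" using False by (auto simp: odd_cut_def)
    ultimately show ?thesis by simp
  qed
  have "{v \<in> verts (part U1). odd (degree_in G ?E1 v)} = vc ` odd_cut E"
    using cut verts_part_subset [of U1] by (auto simp: verts_part odd_cut_def)
  moreover have sub: "odd_cut E \<subseteq> {1..k}" by (auto simp: odd_cut_def)
  ultimately have card: "even (card (odd_cut E))"
    using even_card_odd_cut [of ?E1 U1] card_image [OF inj_on_subset [OF inj_vc sub]] by simp
  show "admissible U1 ?E1 (odd_cut E)"
    unfolding admissible_def using cut sub card verts_part_subset [of U1] by blast
  show "admissible U2 ?E2 (odd_cut E)"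
    unfolding admissible_def using cut parity sub card verts_part_subset [of U2] by blast
qed

text \<open>The inverse of the splitting: at each vertex the degrees in the two parts have the same
  parity, odd exactly at the vertices selected by I, so they add up to an even degree.\<close>

lemma admissible_join:
  assumes "admissible U1 E1 I" "admissible U2 E2 I"
  shows "E1 \<union> E2 \<in> even_sets G" "odd_cut (E1 \<union> E2) = I"
    "(E1 \<union> E2) \<inter> edges (part U1) = E1" "(E1 \<union> E2) \<inter> edges (part U2) = E2"
proof -
  have sub: "E1 \<subseteq> edges (part U1)" "E2 \<subseteq> edges (part U2)" "I \<subseteq> {1..k}"
    using assms by (auto simp: admissible_def)
  show e: "(E1 \<union> E2) \<inter> edges (part U1) = E1" "(E1 \<union> E2) \<inter> edges (part U2) = E2"
    using sub edges_disjoint by blast+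
  have o1: "odd (degree_in G E1 v) \<longleftrightarrow> v \<in> vc ` I" if "v \<in> verts G" for v
  proof (cases "v \<in> verts (part U1)")
    case False
    then show ?thesis using degree_zero [OF sub(1)] sub(3) by (auto simp: verts_part)
  qed (use assms in \<open>auto simp: admissible_def\<close>)
  have o2: "odd (degree_in G E2 v) \<longleftrightarrow> v \<in> vc ` I" if "v \<in> verts G" for v
  proof (cases "v \<in> verts (part U2)")
    case False
    then show ?thesis using degree_zero [OF sub(2)] sub(3) by (auto simp: verts_part)
  qed (use assms in \<open>auto simp: admissible_def\<close>)
  have EG: "E1 \<union> E2 \<subseteq> edges G" using sub edges_union by blast
  moreover have "even (degree_in G (E1 \<union> E2) v)" if "v \<in> verts G" for v
    unfolding degree_split [OF EG] e using o1 [OF that] o2 [OF that] by auto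
  ultimately show "E1 \<union> E2 \<in> even_sets G" by (simp add: even_sets_def)
  show "odd_cut (E1 \<union> E2) = I"
  proof -
    have "odd (degree_in G E1 (vc i)) \<longleftrightarrow> i \<in> I" if i: "i \<in> {1..k}" for i
      unfolding o1 [OF vc_vertex(1) [OF i]] using inj_on_image_mem_iff [OF inj_vc i sub(3)] .
    then show ?thesis unfolding odd_cut_def e using sub(3) by blast
  qed
qed

end

subsection \<open>The pairing\<close>

lemma set_generators: "set (generators k) = {1..k} \<times> {1, 2}"
  by (auto simp: generators_def)

lemma increasing_monomial_eq_iff:
  assumes "A \<subseteq> {1..k} \<times> {1, 2}" "B \<subseteq> {1..k} \<times> {1, 2}"
  shows "increasing_monomial k A = increasing_monomial k B \<longleftrightarrow> A = B"
proof
  assume "increasing_monomial k A = increasing_monomial k B"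
  then have "set (increasing_monomial k A) = set (increasing_monomial k B)" by simp
  then show "A = B" using assms by (auto simp: increasing_monomial_def set_generators)
qed simp

lemma finite_basis: "finite (basis k)" "finite (dual_basis k)"
  by (simp_all add: basis_def dual_basis_def)

lemma pairing_single:
  assumes "b \<in> basis k"
  shows "pairing k (Poly_Mapping.single b x) (Poly_Mapping.single (rev b') y) = (if b = b' then x * y else 0)"
proof -
  have "rev b \<in> dual_basis k" using assms by (simp add: dual_basis_def)
  have "pairing k (Poly_Mapping.single b x) (Poly_Mapping.single (rev b') y) =
      (\<Sum>u\<in>basis k. \<Sum>u'\<in>dual_basis k. if u = b then (if u' = rev b then (if b = b' then x * y else 0) else 0) else 0)"
    unfolding pairing_def by (intro sum.cong refl) (auto simp: lookup_single when_def)
  also have "\<dots> = (\<Sum>u\<in>basis k. if u = b then (\<Sum>u'\<in>dual_basis k. if u' = rev b then (if b = b' then x * y else 0) else 0) else 0)"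
    by (intro sum.cong refl) simp
  also have "\<dots> = (if b = b' then x * y else 0)"
    using assms \<open>rev b \<in> dual_basis k\<close> by (simp only: sum.delta [OF finite_basis(1)] sum.delta [OF finite_basis(2)] if_True)
  finally show ?thesis .
qed

lemma pairing_add:
  "pairing k (f + f') h = pairing k f h + pairing k f' h"
  "pairing k f (h + h') = pairing k f h + pairing k f h'"
  unfolding pairing_def by (simp_all add: lookup_add distrib_left distrib_right sum.distrib)

lemma pairing_zero: "pairing k 0 h = 0" "pairing k f 0 = 0"
  by (simp_all add: pairing_def)

lemma pairing_uminus: "pairing k (- f) h = - pairing k f h" "pairing k f (- h) = - pairing k f h"
  unfolding pairing_def by (simp_all add: sum_negf)

lemma pairing_sum:
  "pairing k (sum f A) (sum h B) = (\<Sum>x\<in>A. \<Sum>y\<in>B. pairing k (f x) (h y))"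
proof -
  have l: "pairing k (sum f A) (sum h B) = (\<Sum>x\<in>A. pairing k (f x) (sum h B))"
    by (induction A rule: infinite_finite_induct) (simp_all add: pairing_add pairing_zero)
  have r: "pairing k u (sum h B) = (\<Sum>y\<in>B. pairing k u (h y))" for u
    by (induction B rule: infinite_finite_induct) (simp_all add: pairing_add pairing_zero)
  show ?thesis unfolding l by (intro sum.cong refl r)
qed

text \<open>The second weight exchanges the variables of outer and inner edges. As each path is used
  with both of its edges, the two monomials still come from \<open>I \<times> {1, 2}\<close> and
  \<open>I' \<times> {1, 2}\<close>, and they are dual exactly when the same rays are used.\<close>

lemma pairing_weights:
  assumes "I \<subseteq> {1..k}" "I' \<subseteq> {1..k}"
  shows "pairing k (weight1 k (Edge ` E \<union> Outer ` I \<union> Inner ` I)) (weight2 k (Edge ` E' \<union> Outer ` I' \<union> Inner ` I')) =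
    (if I = I' then weight E * weight E' else 0)"
proof -
  have "{(i, 1) | i. Outer i \<in> Edge ` E \<union> Outer ` I \<union> Inner ` I} \<union> {(i, 2) | i. Inner i \<in> Edge ` E \<union> Outer ` I \<union> Inner ` I} = I \<times> {1, 2::nat}"
    by auto
  moreover have "{(i, 2) | i. Outer i \<in> Edge ` E' \<union> Outer ` I' \<union> Inner ` I'} \<union> {(i, 1) | i. Inner i \<in> Edge ` E' \<union> Outer ` I' \<union> Inner ` I'} = I' \<times> {1, 2::nat}"
    by auto
  moreover have "{e. Edge e \<in> Edge ` E \<union> Outer ` I \<union> Inner ` I} = E" "{e. Edge e \<in> Edge ` E' \<union> Outer ` I' \<union> Inner ` I'} = E'"
    by auto
  moreover have "increasing_monomial k (I \<times> {1, 2}) \<in> basis k"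
    using assms unfolding basis_def set_generators by (intro imageI) auto
  moreover have "increasing_monomial k (I \<times> {1, 2}) = increasing_monomial k (I' \<times> {1, 2}) \<longleftrightarrow> I = I'"
    using assms by (subst increasing_monomial_eq_iff) auto
  ultimately show ?thesis
    unfolding weight1_def weight2_def by (simp only: pairing_single)
qed

section \<open>Comparison of the quadratic forms\<close>

context subdivided_graph
begin

lemma crossings_zero:
  assumes "E \<subseteq> edges (part U)" "\<And>i z. \<lbrakk>i \<in> {1..4}; i \<notin> J; z \<in> rectangle\<rbrakk> \<Longrightarrow> (glue 2 a (i, z), 0) \<notin> U"
    "j \<notin> insert 0 J"
  shows "crossings n \<kappa> E j = 0"
  unfolding crossings_def
proof (intro sum.neutral ballI)
  fix e assume "e \<in> E"
  then have "\<kappa> e i \<noteq> j" if "i < n e" for i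
    using crossed_bridges [of e U i J] assms that by blast
  then show "card {i. i < n e \<and> \<kappa> e i = j} = 0" by auto
qed

lemma other_bridges:
  "\<lbrakk>j \<in> {1..4}; j \<notin> {1, 2}; z \<in> rectangle\<rbrakk> \<Longrightarrow> (glue 2 a (j, z), 0) \<notin> U1"
  "\<lbrakk>j \<in> {1..4}; j \<notin> {3, 4}; z \<in> rectangle\<rbrakk> \<Longrightarrow> (glue 2 a (j, z), 0) \<notin> U2"
proof -
  have C: "x \<notin> C" if "x \<in> U1 \<union> U2" for x
    using that by (simp only: union_U Diff_iff simp_thms)
  show "(glue 2 a (j, z), 0) \<notin> U1" if "j \<in> {1..4}" "j \<notin> {1, 2}" "z \<in> rectangle"
  proof
    assume U: "(glue 2 a (j, z), 0) \<in> U1"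
    have "j \<in> {3, 4}" using that by auto
    then have "(glue 2 a (j, z), 0) \<in> (glue 2 a ` ({3, 4} \<times> rectangle)) \<times> {0} - C"
      using C U that by blast
    then show False using bridges_U2 disjoint_U U by blast
  qed
  show "(glue 2 a (j, z), 0) \<notin> U2" if "j \<in> {1..4}" "j \<notin> {3, 4}" "z \<in> rectangle"
  proof
    assume U: "(glue 2 a (j, z), 0) \<in> U2"
    have "j \<in> {1, 2}" using that by auto
    then have "(glue 2 a (j, z), 0) \<in> (glue 2 a ` ({1, 2} \<times> rectangle)) \<times> {0} - C"
      using C U that by blast
    then show False using bridges_U1 disjoint_U U by blast
  qed
qed

text \<open>All three classes are sums of bridge curves governed by the same four parities of
  crossings of E. The handles are orthogonal in the double torus, and on each of them
  \<open>quadratic_handle\<close> evaluates both forms to the same expression.\<close>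

lemma quadratic_split:
  fixes dot q dot1 q1 dot2 q2
  assumes forms: "intersection_form (double_torus a) dot" "quadratic_form (double_torus a) dot q"
      "intersection_form (capped a c U1) dot1" "quadratic_form (capped a c U1) dot1 q1"
      "intersection_form (capped a c U2) dot2" "quadratic_form (capped a c U2) dot2 q2"
    and values1: "\<And>j. j \<in> {1, 2} \<Longrightarrow> q1 (curve_class (capped a c U1) (\<lambda>s. ((bridge_curve 2 a j s, 0), 0))) =
         q (curve_class (double_torus a) (\<lambda>s. (bridge_curve 2 a j s, 0)))"
    and values2: "\<And>j. j \<in> {3, 4} \<Longrightarrow> q2 (curve_class (capped a c U2) (\<lambda>s. ((bridge_curve 2 a j s, 0), 0))) =
         q (curve_class (double_torus a) (\<lambda>s. (bridge_curve 2 a j s, 0)))"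
    and E: "E \<in> even_sets G"
  shows "q (edge_set_class (double_torus a) (\<lambda>e s. (\<gamma> e s, 0)) E) =
    q1 (edge_set_class (capped a c U1) (target_curve pos \<gamma> vc) (lift (E \<inter> edges (part U1)) (odd_cut E))) +
    q2 (edge_set_class (capped a c U2) (target_curve pos \<gamma> vc) (lift (E \<inter> edges (part U2)) (odd_cut E)))"
proof -
  let ?E1 = "E \<inter> edges (part U1)" and ?E2 = "E \<inter> edges (part U2)" and ?I = "odd_cut E"
  interpret D: highway_chart 2 a "double_torus a" "\<lambda>y. (y, 0)" P "{1..4}"
    by (rule highway_chart_double_torus)
  interpret D1: highway_chart 2 a "capped a c U1" "\<lambda>y. ((y, 0), 0)" half1 "{1, 2}"
    by (rule highway_chart_capped1)
  interpret D2: highway_chart 2 a "capped a c U2" "\<lambda>y. ((y, 0), 0)" half2 "{3, 4}"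
    by (rule highway_chart_capped2)
  interpret Q: quadratic_surface "double_torus a" dot q using forms by unfold_locales
  interpret Q1: quadratic_surface "capped a c U1" dot1 q1 using forms by unfold_locales
  interpret Q2: quadratic_surface "capped a c U2" dot2 q2 using forms by unfold_locales
  let ?A = "\<lambda>j. odd (crossings n \<kappa> E j)"
  have cross1: "crossings n \<kappa> ?E1 j = crossings n \<kappa> E j" if "j \<in> {1, 2}" for j
  proof -
    have "crossings n \<kappa> E j = crossings n \<kappa> (?E1 \<union> ?E2) j"
      using E edges_union by (intro arg_cong2 [where f = "crossings n \<kappa>"]) (auto simp: even_sets_def)
    also have "\<dots> = crossings n \<kappa> ?E1 j + crossings n \<kappa> ?E2 j"
      using finite_part edges_disjoint by (intro crossings_union) auto
    \<comment> \<open>Edges of the second part never cross a bridge of the first handle.\<close>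
    also have "crossings n \<kappa> ?E2 j = 0"
      using that by (intro crossings_zero [where U = U2 and J = "{3, 4}"] other_bridges) auto
    finally show ?thesis by simp
  qed
  have cross2: "crossings n \<kappa> ?E2 j = crossings n \<kappa> E j" if "j \<in> {3, 4}" for j
  proof -
    have "crossings n \<kappa> E j = crossings n \<kappa> (?E1 \<union> ?E2) j"
      using E edges_union by (intro arg_cong2 [where f = "crossings n \<kappa>"]) (auto simp: even_sets_def)
    also have "\<dots> = crossings n \<kappa> ?E1 j + crossings n \<kappa> ?E2 j"
      using finite_part edges_disjoint by (intro crossings_union) auto
    also have "crossings n \<kappa> ?E1 j = 0"
      using that by (intro crossings_zero [where U = U1 and J = "{1, 2}"] other_bridges) auto
    finally show ?thesis by simp
  qed
  have adm: "admissible U1 ?E1 ?I" "admissible U2 ?E2 ?I" using split_admissible [OF E] .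
  have "edge_set_class (capped a c U1) (target_curve pos \<gamma> vc) (lift ?E1 ?I) =
      mod2_class (capped a c U1) (\<Sum>j\<in>{1, 2}. if odd (crossings n \<kappa> ?E1 j) then D1.bridge_chain j else 0)"
  proof (rule class_lift [OF highway_chart_capped1])
    show "z \<in> half1" if "z \<in> P" "((0, z), 0) \<in> U1 \<union> C" for z
      using that by (rule plane_component_half)
    show "(glue 2 a (j, z), 0) \<notin> U1" if "j \<in> {1..4}" "j \<notin> {1, 2}" "z \<in> rectangle" for j z
      using that by (rule other_bridges)
  qed (use adm(1) in \<open>simp_all add: admissible_def\<close>)
  also have "(\<Sum>j\<in>{1, 2}. if odd (crossings n \<kappa> ?E1 j) then D1.bridge_chain j else 0) =
      (if ?A 1 then D1.bridge_chain 1 else 0) + (if ?A 2 then D1.bridge_chain 2 else 0)"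
    using cross1 [of 1] cross1 [of 2] by simp
  finally have c1: "edge_set_class (capped a c U1) (target_curve pos \<gamma> vc) (lift ?E1 ?I) =
      mod2_class (capped a c U1) ((if ?A 1 then D1.bridge_chain 1 else 0) + (if ?A 2 then D1.bridge_chain 2 else 0))" .
  have "edge_set_class (capped a c U2) (target_curve pos \<gamma> vc) (lift ?E2 ?I) =
      mod2_class (capped a c U2) (\<Sum>j\<in>{3, 4}. if odd (crossings n \<kappa> ?E2 j) then D2.bridge_chain j else 0)"
  proof (rule class_lift [OF highway_chart_capped2])
    show "z \<in> half2" if "z \<in> P" "((0, z), 0) \<in> U2 \<union> C" for z
      using that by (rule plane_component_half)
    show "(glue 2 a (j, z), 0) \<notin> U2" if "j \<in> {1..4}" "j \<notin> {3, 4}" "z \<in> rectangle" for j z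
      using that by (rule other_bridges)
  qed (use adm(2) in \<open>simp_all add: admissible_def\<close>)
  also have "(\<Sum>j\<in>{3, 4}. if odd (crossings n \<kappa> ?E2 j) then D2.bridge_chain j else 0) =
      (if ?A 3 then D2.bridge_chain 3 else 0) + (if ?A 4 then D2.bridge_chain 4 else 0)"
    using cross2 [of 3] cross2 [of 4] by simp
  finally have c2: "edge_set_class (capped a c U2) (target_curve pos \<gamma> vc) (lift ?E2 ?I) =
      mod2_class (capped a c U2) ((if ?A 3 then D2.bridge_chain 3 else 0) + (if ?A 4 then D2.bridge_chain 4 else 0))" .
  have four: "(\<Sum>j\<in>{1..4}. f j) = (f 1 + f 2) + (f 3 + f 4)" for f :: "nat \<Rightarrow> ((nat \<times> complex) \<times> real) chain"
  proof -
    have "{1..4} = {1, 2, 3, 4::nat}" by auto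
    then show ?thesis by (simp add: add.assoc)
  qed
  have c0: "edge_set_class (double_torus a) (\<lambda>e s. (\<gamma> e s, 0)) E = mod2_class (double_torus a)
     (((if ?A 1 then D.bridge_chain 1 else 0) + (if ?A 2 then D.bridge_chain 2 else 0)) +
      ((if ?A 3 then D.bridge_chain 3 else 0) + (if ?A 4 then D.bridge_chain 4 else 0)))"
    unfolding class_even_set [OF E] four ..
  have cyc: "D.bridge_chain j \<in> mod2_cycles 1 (double_torus a)" if "j \<in> {1..4}" for j
    using D.bridge_chain_cycle [OF that] .
  have "a ` {1..5} \<subseteq> P" "a ` {1, 5, 6, 7, 8} \<subseteq> P" using vertex_in_polygon by auto
  then have dot: "dot (mod2_class (double_torus a) (D.bridge_chain 1)) (mod2_class (double_torus a) (D.bridge_chain 2)) = 1"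
    "dot (mod2_class (double_torus a) (D.bridge_chain 3)) (mod2_class (double_torus a) (D.bridge_chain 4)) = 1"
    by (intro crossing_bridges [OF highway_chart_double_torus forms(1)]; simp)+
  have "a ` {1..5} \<subseteq> half1" using vertex_in_half1 by auto
  then have dot1: "dot1 (mod2_class (capped a c U1) (D1.bridge_chain 1)) (mod2_class (capped a c U1) (D1.bridge_chain 2)) = 1"
    by (intro crossing_bridges(1) [OF highway_chart_capped1 forms(3)]) simp
  have "a ` {1, 5, 6, 7, 8} \<subseteq> half2" using vertex_in_half2 by auto
  then have dot2: "dot2 (mod2_class (capped a c U2) (D2.bridge_chain 3)) (mod2_class (capped a c U2) (D2.bridge_chain 4)) = 1"
    by (intro crossing_bridges(2) [OF highway_chart_capped2 forms(5)]) simp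
  have "q (edge_set_class (double_torus a) (\<lambda>e s. (\<gamma> e s, 0)) E) =
      q (mod2_class (double_torus a) ((if ?A 1 then D.bridge_chain 1 else 0) + (if ?A 2 then D.bridge_chain 2 else 0))) +
      q (mod2_class (double_torus a) ((if ?A 3 then D.bridge_chain 3 else 0) + (if ?A 4 then D.bridge_chain 4 else 0)))"
    unfolding c0 by (intro Q.quadratic_orthogonal cyc disjoint_bridges [OF forms(1)]) auto
  also have "q (mod2_class (double_torus a) ((if ?A 1 then D.bridge_chain 1 else 0) + (if ?A 2 then D.bridge_chain 2 else 0))) =
      q1 (edge_set_class (capped a c U1) (target_curve pos \<gamma> vc) (lift ?E1 ?I))"
  proof -
    have "D.bridge_chain 1 \<in> mod2_cycles 1 (double_torus a)" "D.bridge_chain 2 \<in> mod2_cycles 1 (double_torus a)"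
      by (rule cyc; simp)+
    note l = Q.quadratic_handle [OF this dot(1)]
    have "D1.bridge_chain 1 \<in> mod2_cycles 1 (capped a c U1)" "D1.bridge_chain 2 \<in> mod2_cycles 1 (capped a c U1)"
      by (rule D1.bridge_chain_cycle; simp)+
    note r = Q1.quadratic_handle [OF this dot1]
    have v: "q1 (mod2_class (capped a c U1) (D1.bridge_chain 1)) = q (mod2_class (double_torus a) (D.bridge_chain 1))"
      "q1 (mod2_class (capped a c U1) (D1.bridge_chain 2)) = q (mod2_class (double_torus a) (D.bridge_chain 2))"
      by (rule values1; simp)+
    show ?thesis unfolding c1 l r v ..
  qed
  also have "q (mod2_class (double_torus a) ((if ?A 3 then D.bridge_chain 3 else 0) + (if ?A 4 then D.bridge_chain 4 else 0))) =
      q2 (edge_set_class (capped a c U2) (target_curve pos \<gamma> vc) (lift ?E2 ?I))"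
  proof -
    have "D.bridge_chain 3 \<in> mod2_cycles 1 (double_torus a)" "D.bridge_chain 4 \<in> mod2_cycles 1 (double_torus a)"
      by (rule cyc; simp)+
    note l = Q.quadratic_handle [OF this dot(2)]
    have "D2.bridge_chain 3 \<in> mod2_cycles 1 (capped a c U2)" "D2.bridge_chain 4 \<in> mod2_cycles 1 (capped a c U2)"
      by (rule D2.bridge_chain_cycle; simp)+
    note r = Q2.quadratic_handle [OF this dot2]
    have v: "q2 (mod2_class (capped a c U2) (D2.bridge_chain 3)) = q (mod2_class (double_torus a) (D.bridge_chain 3))"
      "q2 (mod2_class (capped a c U2) (D2.bridge_chain 4)) = q (mod2_class (double_torus a) (D.bridge_chain 4))"
      by (rule values2; simp)+
    show ?thesis unfolding c2 l r v ..
  qed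
  finally show ?thesis .
qed

end

section \<open>Comparison of the generating functions\<close>

theorem theorem6:
  fixes a :: "nat \<Rightarrow> complex"
    and G :: "('v, 'e) mgraph"
    and pos :: "'v \<Rightarrow> nat \<times> complex"
    and \<gamma> :: "'e \<Rightarrow> real \<Rightarrow> nat \<times> complex"
    and c :: "real \<Rightarrow> (nat \<times> complex) \<times> real"
    and U\<^sub>1 U\<^sub>2 :: "((nat \<times> complex) \<times> real) set"
    and k :: nat
    and vc :: "nat \<Rightarrow> 'v"
  defines "T\<^sub>1 \<equiv> capped a c U\<^sub>1" and "T\<^sub>2 \<equiv> capped a c U\<^sub>2"
    and "G\<^sub>1 \<equiv> side_graph G pos \<gamma> k vc U\<^sub>1" and "G\<^sub>2 \<equiv> side_graph G pos \<gamma> k vc U\<^sub>2"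
  assumes "clockwise_convex 8 a"
    and "finite_mgraph G"
    and "highway_graph 2 a G pos \<gamma>"
    and "separating_curve a c U\<^sub>1 U\<^sub>2"
    and "even k"
    and "meets_in_vertices c G pos \<gamma> k vc"
    and "even (card {v \<in> verts G. (pos v, 0) \<in> U\<^sub>1})"
    and "even (card {v \<in> verts G. (pos v, 0) \<in> U\<^sub>2})"
    and "intersection_form (double_torus a) dot" and "quadratic_form (double_torus a) dot q"
    and "intersection_form T\<^sub>1 dot\<^sub>1" and "quadratic_form T\<^sub>1 dot\<^sub>1 q\<^sub>1"
    and "intersection_form T\<^sub>2 dot\<^sub>2" and "quadratic_form T\<^sub>2 dot\<^sub>2 q\<^sub>2"
    and "q\<^sub>1 (curve_class T\<^sub>1 (\<lambda>s. ((bridge_curve 2 a 1 s, 0), 0))) =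
         q (curve_class (double_torus a) (\<lambda>s. (bridge_curve 2 a 1 s, 0)))"
    and "q\<^sub>1 (curve_class T\<^sub>1 (\<lambda>s. ((bridge_curve 2 a 2 s, 0), 0))) =
         q (curve_class (double_torus a) (\<lambda>s. (bridge_curve 2 a 2 s, 0)))"
    and "q\<^sub>2 (curve_class T\<^sub>2 (\<lambda>s. ((bridge_curve 2 a 3 s, 0), 0))) =
         q (curve_class (double_torus a) (\<lambda>s. (bridge_curve 2 a 3 s, 0)))"
    and "q\<^sub>2 (curve_class T\<^sub>2 (\<lambda>s. ((bridge_curve 2 a 4 s, 0), 0))) =
         q (curve_class (double_torus a) (\<lambda>s. (bridge_curve 2 a 4 s, 0)))"
  shows "signed_gf (double_torus a) G (\<lambda>e s. (\<gamma> e s, 0)) q weight =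
    pairing k
      (signed_gf T\<^sub>1 (attach_target k vc G\<^sub>1) (target_curve pos \<gamma> vc) q\<^sub>1 (weight1 k))
      (signed_gf T\<^sub>2 (attach_target k vc G\<^sub>2) (target_curve pos \<gamma> vc) q\<^sub>2 (weight2 k))"
proof -
  interpret separated_graph a c U\<^sub>1 U\<^sub>2 G pos \<gamma> k vc
    using \<open>clockwise_convex 8 a\<close> \<open>finite_mgraph G\<close> \<open>highway_graph 2 a G pos \<gamma>\<close>
      \<open>separating_curve a c U\<^sub>1 U\<^sub>2\<close> \<open>meets_in_vertices c G pos \<gamma> k vc\<close>
    by unfold_locales
  obtain n t \<kappa> where "\<forall>e\<in>edges G. highway_subdivision 2 a (\<gamma> e) (n e) (t e) (\<kappa> e)"
    using subdivisions by blast
  then interpret subdivided_graph a c U\<^sub>1 U\<^sub>2 G pos \<gamma> k vc n t \<kappa>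
    by unfold_locales blast
  let ?e1 = "\<lambda>E. E \<inter> edges G\<^sub>1" and ?e2 = "\<lambda>E. E \<inter> edges G\<^sub>2"
  let ?A1 = "even_sets (attach_target k vc G\<^sub>1)" and ?A2 = "even_sets (attach_target k vc G\<^sub>2)"
  let ?s = "\<lambda>E. q (edge_set_class (double_torus a) (\<lambda>e s. (\<gamma> e s, 0)) E)"
    and ?s1 = "\<lambda>D. q\<^sub>1 (edge_set_class T\<^sub>1 (target_curve pos \<gamma> vc) D)"
    and ?s2 = "\<lambda>D. q\<^sub>2 (edge_set_class T\<^sub>2 (target_curve pos \<gamma> vc) D)"
  let ?w1 = "\<lambda>D. if ?s1 D = 0 then weight1 k D else - weight1 k D"
    and ?w2 = "\<lambda>D. if ?s2 D = 0 then weight2 k D else - weight2 k D"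
    and ?w = "\<lambda>E. if ?s E = 0 then weight E else - (weight E :: 'e polyring)"
  let ?D1 = "\<lambda>E. lift (?e1 E) (odd_cut E)" and ?D2 = "\<lambda>E. lift (?e2 E) (odd_cut E)"
  \<comment> \<open>The pairs of lifts with the same rays, parametrised by the even sets of G; the
    double sum reduces to these.\<close>
  let ?M = "(\<lambda>E. (?D1 E, ?D2 E)) ` even_sets G"
  have values1: "q\<^sub>1 (curve_class T\<^sub>1 (\<lambda>s. ((bridge_curve 2 a j s, 0), 0))) =
         q (curve_class (double_torus a) (\<lambda>s. (bridge_curve 2 a j s, 0)))" if "j \<in> {1, 2}" for j
    using that assms(19,20) by blast
  have values2: "q\<^sub>2 (curve_class T\<^sub>2 (\<lambda>s. ((bridge_curve 2 a j s, 0), 0))) =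
         q (curve_class (double_torus a) (\<lambda>s. (bridge_curve 2 a j s, 0)))" if "j \<in> {3, 4}" for j
    using that assms(21,22) by blast
  have sign: "?s E = ?s1 (?D1 E) + ?s2 (?D2 E)" if "E \<in> even_sets G" for E
    unfolding T\<^sub>1_def T\<^sub>2_def G\<^sub>1_def G\<^sub>2_def
    by (rule quadratic_split [OF assms(13-18) [unfolded T\<^sub>1_def T\<^sub>2_def]
          values1 [unfolded T\<^sub>1_def] values2 [unfolded T\<^sub>2_def] that])
  have mem: "D \<in> ?A1 \<longleftrightarrow> (\<exists>E I. D = lift E I \<and> admissible U\<^sub>1 E I)"
    "D \<in> ?A2 \<longleftrightarrow> (\<exists>E I. D = lift E I \<and> admissible U\<^sub>2 E I)" for D
    unfolding G\<^sub>1_def G\<^sub>2_def by (rule even_sets_attach_target)+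
  have sub: "?M \<subseteq> ?A1 \<times> ?A2"
  proof (intro image_subsetI SigmaI)
    fix E assume E: "E \<in> even_sets G"
    show "?D1 E \<in> ?A1" unfolding mem unfolding G\<^sub>1_def using split_admissible(1) [OF E] by blast
    show "?D2 E \<in> ?A2" unfolding mem unfolding G\<^sub>2_def using split_admissible(2) [OF E] by blast
  qed
  have finite: "finite ?A1" "finite ?A2"
  proof -
    have "finite (edges (attach_target k vc (part U)))" for U
      using finite_part(1) by (simp add: attach_target_def)
    then show "finite ?A1" "finite ?A2"
      unfolding even_sets_def G\<^sub>1_def G\<^sub>2_def by simp_all
  qed
  \<comment> \<open>A sum of two bits is 0 exactly when they agree, so the signs multiply.\<close>
  have sgn: "pairing k (?w1 D1) (?w2 D2) =
      (if ?s1 D1 + ?s2 D2 = 0 then pairing k (weight1 k D1) (weight2 k D2) else - pairing k (weight1 k D1) (weight2 k D2))"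
    for D1 D2
    by (cases "?s1 D1"; cases "?s2 D2") (simp_all add: pairing_uminus)
  \<comment> \<open>A pair outside the image has different sets of rays, since a pair with equal
    ones would be joined to an even set of G; different monomials pair to 0.\<close>
  have zero: "pairing k (?w1 (fst p)) (?w2 (snd p)) = 0" if p: "p \<in> ?A1 \<times> ?A2 - ?M" for p
  proof -
    obtain E1 I1 E2 I2 where D: "fst p = lift E1 I1" "snd p = lift E2 I2"
        and adm: "admissible U\<^sub>1 E1 I1" "admissible U\<^sub>2 E2 I2"
      using p mem by (auto simp: mem_Times_iff)
    have "I1 \<noteq> I2"
    proof
      assume "I1 = I2"
      note j = admissible_join [OF adm(1) adm(2) [folded \<open>I1 = I2\<close>]]
      have "p = (?D1 (E1 \<union> E2), ?D2 (E1 \<union> E2))"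
        using D j(2-4) \<open>I1 = I2\<close> unfolding G\<^sub>1_def G\<^sub>2_def by (simp add: prod_eq_iff)
      then show False using p j(1) by blast
    qed
    then have "pairing k (weight1 k (fst p)) (weight2 k (snd p)) = 0"
      using adm unfolding D by (subst pairing_weights) (auto simp: admissible_def)
    then show ?thesis unfolding sgn by simp
  qed
  \<comment> \<open>The two parts of E are recovered as the graph edges of the lifts, and together
    they exhaust E.\<close>
  have inj: "inj_on (\<lambda>E. (?D1 E, ?D2 E)) (even_sets G)"
  proof (rule inj_onI)
    fix E E' assume E: "E \<in> even_sets G" "E' \<in> even_sets G" and eq: "(?D1 E, ?D2 E) = (?D1 E', ?D2 E')"
    have l: "{e. Edge e \<in> lift F I} = F" for F :: "'e set" and I by auto
    have "?e1 E = ?e1 E'" "?e2 E = ?e2 E'"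
      using eq l by (metis prod.inject)+
    then show "E = E'"
      using E edges_union unfolding even_sets_def G\<^sub>1_def G\<^sub>2_def by blast
  qed
  have summand: "pairing k (?w1 (?D1 E)) (?w2 (?D2 E)) = ?w E" if E: "E \<in> even_sets G" for E
  proof -
    have "weight E = weight (?e1 E \<union> ?e2 E)"
      using E edges_union unfolding even_sets_def G\<^sub>1_def G\<^sub>2_def by (intro arg_cong [where f = weight]) blast
    also have "\<dots> = weight (?e1 E) * (weight (?e2 E) :: 'e polyring)"
      unfolding weight_def G\<^sub>1_def G\<^sub>2_def
      using finite_part edges_disjoint by (intro prod.union_disjoint) auto
    finally have "pairing k (weight1 k (?D1 E)) (weight2 k (?D2 E)) = weight E"
      by (subst pairing_weights) (auto simp: odd_cut_def)
    then show ?thesis unfolding sgn sign [OF E] by (simp only:)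
  qed
  have "pairing k (signed_gf T\<^sub>1 (attach_target k vc G\<^sub>1) (target_curve pos \<gamma> vc) q\<^sub>1 (weight1 k))
      (signed_gf T\<^sub>2 (attach_target k vc G\<^sub>2) (target_curve pos \<gamma> vc) q\<^sub>2 (weight2 k)) =
      (\<Sum>D1\<in>?A1. \<Sum>D2\<in>?A2. pairing k (?w1 D1) (?w2 D2))"
    unfolding signed_gf_def by (rule pairing_sum)
  also have "\<dots> = (\<Sum>p\<in>?A1 \<times> ?A2. pairing k (?w1 (fst p)) (?w2 (snd p)))"
    by (simp only: sum.cartesian_product case_prod_unfold)
  also have "\<dots> = (\<Sum>p\<in>?M. pairing k (?w1 (fst p)) (?w2 (snd p)))"
    by (rule sum.mono_neutral_right [OF finite_cartesian_product [OF finite] sub]) (intro ballI zero)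
  also have "\<dots> = (\<Sum>E\<in>even_sets G. pairing k (?w1 (?D1 E)) (?w2 (?D2 E)))"
    unfolding sum.reindex [OF inj] o_def fst_conv snd_conv ..
  also have "\<dots> = (\<Sum>E\<in>even_sets G. ?w E)"
    using summand by (rule sum.cong [OF refl])
  finally show ?thesis unfolding signed_gf_def ..
qed

end
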